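(* Let $H$ be a finite-dimensional cocommutative Hopf algebra over a field $k$, $\omega:H\otimes H\otimes H\to k$ a normalized $3$-cocycle on $H$ and $\zeta:H\to k$ an algebra map. Let $u$ be the element of the quasitriangular quasi-Hopf algebra $D^\omega(H)$ given by $u=s(R^2x^2\beta_{D}\,s(x^3))\,\alpha_{D}\,R^1x^1$, where $R=R^1\otimes R^2$, $\Phi^{-1}=x^1\otimes x^2\otimes x^3$, $s$, $\alpha_D$, $\beta_D$ are the $R$-matrix, the inverse reassociator, the antipode and the distinguished elements of $D^\omega(H)$. Let $\beta\in H^*$, $\beta(h)=\omega(h_1,S(h_2),h_3)$, and let $\mu_H\in H^*$ be the modular element of $H$. Then the element $$\nu=u\,(\zeta\beta\#1_H)\in D^\omega(H)$$ is a ribbon element for $D^\omega(H)$ if and only if $\zeta^2=\mu_H$ (in the convolution algebra $H^*$).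
   Context: $H$ is a finite-dimensional cocommutative Hopf algebra over $k$ with antipode $S$; Sweedler notation is used for iterated comultiplications. $H^*$ is the dual commutative Hopf algebra: unit $\varepsilon$, product $(\varphi\psi)(h)=\varphi(h_1)\psi(h_2)$, $\Delta(\varphi)=\varphi_1\otimes\varphi_2$ iff $\varphi(hg)=\varphi_1(h)\varphi_2(g)$ for all $h,g$, counit $\varphi\mapsto\varphi(1_H)$, antipode $\overline S(\varphi)=\varphi\circ S$. Regular actions: $(h\rightharpoonup\varphi)(a)=\varphi(ah)$, $(\varphi\leftharpoonup h)(a)=\varphi(ha)$. The modular element $\mu_H:H\to k$ is defined by $th=\mu_H(h)t$ for all $h\in H$, where $t\in H$ is a non-zero left integral ($ht=\varepsilon(h)t$ for all $h$). A normalized $3$-cocycle is a convolution invertible linear map $\omega:H\otimes H\otimes H\to k$ with $\omega(x_1,y_1,z_1t_1)\,\omega(x_2y_2,z_2,t_2)=\omega(y_1,z_1,t_1)\,\omega(x_1,y_2z_2,t_2)\,\omega(x_2,y_3,z_3)$ and $\omega(1,x,y)=\omega(x,1,y)=\omega(x,y,1)=\varepsilon(x)\varepsilon(y)$ for all $x,y,z,t\in H$. View $\omega=\omega_1\otimes\omega_2\otimes\omega_3$ and its convolution inverse $\omega^{-1}=\overline\omega_1\otimes\overline\omega_2\otimes\overline\omega_3$ as elements of $H^*\otimes H^*\otimes H^*$. The quasitriangular quasi-Hopf algebra $D^\omega(H)$. Put $g\triangleleft x=S(x_1)gx_2$ and, for $g,h,x,y\in H$, $\theta(g;x,y)=\omega(g_1,x_1,y_1)\,\omega(x_2,y_2,g_2\triangleleft(x_3y_3))\,\omega^{-1}(x_4,g_3\triangleleft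 x_5,y_4)$, $\gamma(g,h;x)=\omega(g_1,h_1,x_1)\,\omega(x_2,g_2\triangleleft x_3,h_2\triangleleft x_4)\,\omega^{-1}(g_3,x_5,h_3\triangleleft x_6)$. Let $\sigma:H\otimes H\to H^*$, $\sigma(x,y)(g)=\theta(g;x,y)$, and $\kappa:H\to(H\otimes H)^*=H^*\otimes H^*$, $\kappa(h)(x\otimes y)=\gamma(x,y;h)$, written $\kappa(h)=\kappa_1(h)\otimes\kappa_2(h)$; $\sigma^{-1}$ and $\kappa^{-1}=\kappa_1^{-1}\otimes\kappa_2^{-1}$ denote convolution inverses. Then $D^\omega(H)=H^*\otimes H$ as a vector space (elements written $\varphi\#h$) with - product $(\varphi\#h)(\varphi'\#h')=\varphi(h_1\rightharpoonup\varphi'\leftharpoonup S(h_2))\sigma(h_3,h'_1)\#h_4h'_2$ and unit $\varepsilon\#1_H$; - reassociator $\Phi=(\overline\omega_1\#1_H)\otimes(\overline\omega_2\#1_H)\otimes(\overline\omega_3\#1_H)$; - comultiplication $\Delta(\varphi\#h)=(\kappa_1(h_1)\varphi_1\#h_2)\otimes(\kappa_2(h_1)\varphi_2\#h_3)$ and counit $\varepsilon(\varphi\#h)=\varphi(1_H)\varepsilon(h)$; - $\alpha_D=\varepsilon\#1_H$, $\beta_D=\beta\#1_H$, antipode $s(\varphi\#h)=[\varepsilon\#S(h_1)]\,[\sigma^{-1}(h_2,S(h_3))\,\overline S(\varphi\kappa_1^{-1}(h_4))\,\kappa_2^{-1}(h_4)\#1_H]$; - $R$-matrix $R=\sum_i(e^i\#1_H)\otimes(\varepsilon\#e_i)$,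 where $\{e_i\}$, $\{e^i\}$ are dual bases of $H$ and $H^*$. Ribbon element: for a quasitriangular quasi-Hopf algebra $(A,R)$ with antipode $(S_A,\alpha_A,\beta_A)$ and $u=S_A(R^2x^2\beta_A S_A(x^3))\alpha_A R^1x^1$, a ribbon element is a central element $\nu\in A$ with $\Delta(\nu)=(\nu\otimes\nu)(R_{21}R)^{-1}$, $S_A(\nu)=\nu$ and $\nu^2=uS_A(u)$, where $R_{21}=R^2\otimes R^1$. *)

theory Defs
  imports "HOL-Analysis.Analysis"
begin

text \<open>
  Tensor products of finite-dimensional spaces are taken in coordinates: if \<open>V\<close> and \<open>W\<close> have bases
  indexed by the finite types \<open>'n\<close> and \<open>'m\<close>, then \<open>V \<otimes> W\<close> is \<open>'k ^ ('n \<times> 'm)\<close>, the entry at \<open>(i, j)\<close>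
  being the coefficient of \<open>v\<^sub>i \<otimes> w\<^sub>j\<close>.  The space \<open>H\<close> itself is an abstract vector space on a type
  \<open>'h\<close> with an arbitrary basis \<open>bas\<close>.  Elements of \<open>H\<^sup>*\<close> are linear functionals \<open>'h \<Rightarrow> 'k\<close>;
  elements of \<open>H\<^sup>* \<otimes> H\<^sup>* = (H \<otimes> H)\<^sup>*\<close> and \<open>H\<^sup>* \<otimes> H\<^sup>* \<otimes> H\<^sup>*\<close> are bilinear and trilinear forms.
\<close>

section \<open>Finite-dimensional cocommutative Hopf algebras\<close>

text \<open>The product and unit of \<open>H\<close> are those of the \<^class>\<open>ring_1\<close> structure of the type \<open>'h\<close>.\<close>

record ('k, 'h, 'n) hopf =
  scl :: "'k \<Rightarrow> 'h \<Rightarrow> 'h"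
  bas :: "'n \<Rightarrow> 'h"
  comul :: "'h \<Rightarrow> 'k ^ ('n::finite \<times> 'n)"
  cou :: "'h \<Rightarrow> 'k"
  anti :: "'h \<Rightarrow> 'h"

text \<open>For a basis given by \<open>bas H\<close>, the functionals \<open>dbas H i\<close> form the dual basis.\<close>

definition dbas :: "('k::field, 'h::ring_1, 'n::finite) hopf \<Rightarrow> 'n \<Rightarrow> 'h \<Rightarrow> 'k" where
  "dbas H i v = module.representation (scl H) (range (bas H)) v (bas H i)"

definition tens2 :: "('k::field, 'h::ring_1, 'n::finite) hopf \<Rightarrow> 'h \<Rightarrow> 'h \<Rightarrow> 'k ^ ('n \<times> 'n)" where
  "tens2 H a b = (\<chi> p. case p of (i, j) \<Rightarrow> dbas H i a * dbas H j b)"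

definition tens3 :: "('k::field, 'h::ring_1, 'n::finite) hopf \<Rightarrow> 'h \<Rightarrow> 'h \<Rightarrow> 'h \<Rightarrow> 'k ^ ('n \<times> 'n \<times> 'n)" where
  "tens3 H a b c = (\<chi> p. case p of (i, j, l) \<Rightarrow> dbas H i a * dbas H j b * dbas H l c)"

text \<open>
  Sweedler notation: \<open>sw2 H s h (\<lambda>h1 h2. f h1 h2)\<close> is \<open>f(h\<^sub>1, h\<^sub>2)\<close> for a bilinear map \<open>f\<close> into a
  vector space with scalar multiplication \<open>s\<close>, and similarly for the iterated comultiplications.
\<close>

definition sw2 :: "('k::field, 'h::ring_1, 'n::finite) hopf \<Rightarrow> ('k \<Rightarrow> 'v \<Rightarrow> 'v::comm_monoid_add)
    \<Rightarrow> 'h \<Rightarrow> ('h \<Rightarrow> 'h \<Rightarrow> 'v) \<Rightarrow> 'v" where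
  "sw2 H s h f = (\<Sum>i\<in>UNIV. \<Sum>j\<in>UNIV. s (comul H h $ (i, j)) (f (bas H i) (bas H j)))"

definition sw3 :: "('k::field, 'h::ring_1, 'n::finite) hopf \<Rightarrow> ('k \<Rightarrow> 'v \<Rightarrow> 'v::comm_monoid_add)
    \<Rightarrow> 'h \<Rightarrow> ('h \<Rightarrow> 'h \<Rightarrow> 'h \<Rightarrow> 'v) \<Rightarrow> 'v" where
  "sw3 H s h f = sw2 H s h (\<lambda>h1 h'. sw2 H s h' (f h1))"

definition sw4 :: "('k::field, 'h::ring_1, 'n::finite) hopf \<Rightarrow> ('k \<Rightarrow> 'v \<Rightarrow> 'v::comm_monoid_add)
    \<Rightarrow> 'h \<Rightarrow> ('h \<Rightarrow> 'h \<Rightarrow> 'h \<Rightarrow> 'h \<Rightarrow> 'v) \<Rightarrow> 'v" where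
  "sw4 H s h f = sw2 H s h (\<lambda>h1 h'. sw3 H s h' (f h1))"

definition sw5 :: "('k::field, 'h::ring_1, 'n::finite) hopf \<Rightarrow> ('k \<Rightarrow> 'v \<Rightarrow> 'v::comm_monoid_add)
    \<Rightarrow> 'h \<Rightarrow> ('h \<Rightarrow> 'h \<Rightarrow> 'h \<Rightarrow> 'h \<Rightarrow> 'h \<Rightarrow> 'v) \<Rightarrow> 'v" where
  "sw5 H s h f = sw2 H s h (\<lambda>h1 h'. sw4 H s h' (f h1))"

definition sw6 :: "('k::field, 'h::ring_1, 'n::finite) hopf \<Rightarrow> ('k \<Rightarrow> 'v \<Rightarrow> 'v::comm_monoid_add)
    \<Rightarrow> 'h \<Rightarrow> ('h \<Rightarrow> 'h \<Rightarrow> 'h \<Rightarrow> 'h \<Rightarrow> 'h \<Rightarrow> 'h \<Rightarrow> 'v) \<Rightarrow> 'v" where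
  "sw6 H s h f = sw2 H s h (\<lambda>h1 h'. sw5 H s h' (f h1))"

definition fd_hopf_algebra :: "('k::field, 'h::ring_1, 'n::finite) hopf \<Rightarrow> bool" where
  "fd_hopf_algebra H \<longleftrightarrow>
     finite_dimensional_vector_space (scl H) (range (bas H)) \<and> inj (bas H) \<and>
     (\<forall>c x y. scl H c (x * y) = scl H c x * y \<and> scl H c (x * y) = x * scl H c y) \<and>
     Vector_Spaces.linear (scl H) (*s) (comul H) \<and>
     Vector_Spaces.linear (scl H) (*) (cou H) \<and>
     Vector_Spaces.linear (scl H) (scl H) (anti H) \<and>
     (\<forall>h. sw2 H (*s) h (\<lambda>a b. sw2 H (*s) a (\<lambda>c d. tens3 H c d b))
        = sw2 H (*s) h (\<lambda>a b. sw2 H (*s) b (\<lambda>c d. tens3 H a c d))) \<and>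
     (\<forall>h. sw2 H (scl H) h (\<lambda>a b. scl H (cou H a) b) = h \<and>
          sw2 H (scl H) h (\<lambda>a b. scl H (cou H b) a) = h) \<and>
     (\<forall>x y. comul H (x * y) = sw2 H (*s) x (\<lambda>a b. sw2 H (*s) y (\<lambda>c d. tens2 H (a * c) (b * d)))) \<and>
     comul H 1 = tens2 H 1 1 \<and>
     (\<forall>x y. cou H (x * y) = cou H x * cou H y) \<and> cou H 1 = 1 \<and>
     (\<forall>h. sw2 H (scl H) h (\<lambda>a b. anti H a * b) = scl H (cou H h) 1 \<and>
          sw2 H (scl H) h (\<lambda>a b. a * anti H b) = scl H (cou H h) 1)"

definition cocommutative :: "('k::field, 'h::ring_1, 'n::finite) hopf \<Rightarrow> bool" where
  "cocommutative H \<longleftrightarrow> (\<forall>h i j. comul H h $ (i, j) = comul H h $ (j, i))"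

definition left_integral :: "('k::field, 'h::ring_1, 'n::finite) hopf \<Rightarrow> 'h \<Rightarrow> bool" where
  "left_integral H t \<longleftrightarrow> (\<forall>h. h * t = scl H (cou H h) t)"

text \<open>The left integrals form a one-dimensional space, so exactly one \<open>\<mu>\<close> satisfies this.\<close>

definition modular_element :: "('k::field, 'h::ring_1, 'n::finite) hopf \<Rightarrow> ('h \<Rightarrow> 'k) \<Rightarrow> bool" where
  "modular_element H \<mu> \<longleftrightarrow> (\<exists>t. t \<noteq> 0 \<and> left_integral H t \<and> (\<forall>h. t * h = scl H (\<mu> h) t))"

definition algebra_map :: "('k::field, 'h::ring_1, 'n::finite) hopf \<Rightarrow> ('h \<Rightarrow> 'k) \<Rightarrow> bool" where
  "algebra_map H \<zeta> \<longleftrightarrow> Vector_Spaces.linear (scl H) (*) \<zeta> \<and> (\<forall>x y. \<zeta> (x * y) = \<zeta> x * \<zeta> y) \<and> \<zeta> 1 = 1"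


section \<open>The dual Hopf algebra\<close>

definition dmul :: "('k::field, 'h::ring_1, 'n::finite) hopf \<Rightarrow> ('h \<Rightarrow> 'k) \<Rightarrow> ('h \<Rightarrow> 'k) \<Rightarrow> 'h \<Rightarrow> 'k" where
  "dmul H \<phi> \<psi> h = sw2 H (*) h (\<lambda>a b. \<phi> a * \<psi> b)"

text \<open>The comultiplication of \<open>H\<^sup>*\<close>, as a bilinear form.\<close>

definition dcomul :: "('h::ring_1 \<Rightarrow> 'k) \<Rightarrow> 'h \<Rightarrow> 'h \<Rightarrow> 'k" where
  "dcomul \<phi> x y = \<phi> (x * y)"

definition danti :: "('k::field, 'h::ring_1, 'n::finite) hopf \<Rightarrow> ('h \<Rightarrow> 'k) \<Rightarrow> 'h \<Rightarrow> 'k" where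
  "danti H \<phi> = \<phi> \<circ> anti H"

definition lact :: "'h::ring_1 \<Rightarrow> ('h \<Rightarrow> 'k) \<Rightarrow> 'h \<Rightarrow> 'k" where
  "lact h \<phi> a = \<phi> (a * h)"

definition ract :: "('h::ring_1 \<Rightarrow> 'k) \<Rightarrow> 'h \<Rightarrow> 'h \<Rightarrow> 'k" where
  "ract \<phi> h a = \<phi> (h * a)"

text \<open>
  For a bilinear form \<open>B\<close>, viewed as \<open>B\<^sub>1 \<otimes> B\<^sub>2 \<in> H\<^sup>* \<otimes> H\<^sup>*\<close>, and a bilinear \<open>f\<close>, \<open>dsw2 H s B f\<close> is
  \<open>f(B\<^sub>1, B\<^sub>2)\<close>; likewise for trilinear forms.
\<close>

definition dsw2 :: "('k::field, 'h::ring_1, 'n::finite) hopf \<Rightarrow> ('k \<Rightarrow> 'v \<Rightarrow> 'v::comm_monoid_add)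
    \<Rightarrow> ('h \<Rightarrow> 'h \<Rightarrow> 'k) \<Rightarrow> (('h \<Rightarrow> 'k) \<Rightarrow> ('h \<Rightarrow> 'k) \<Rightarrow> 'v) \<Rightarrow> 'v" where
  "dsw2 H s B f = (\<Sum>i\<in>UNIV. \<Sum>j\<in>UNIV. s (B (bas H i) (bas H j)) (f (dbas H i) (dbas H j)))"

definition dsw3 :: "('k::field, 'h::ring_1, 'n::finite) hopf \<Rightarrow> ('k \<Rightarrow> 'v \<Rightarrow> 'v::comm_monoid_add)
    \<Rightarrow> ('h \<Rightarrow> 'h \<Rightarrow> 'h \<Rightarrow> 'k) \<Rightarrow> (('h \<Rightarrow> 'k) \<Rightarrow> ('h \<Rightarrow> 'k) \<Rightarrow> ('h \<Rightarrow> 'k) \<Rightarrow> 'v) \<Rightarrow> 'v" where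
  "dsw3 H s T f = (\<Sum>i\<in>UNIV. \<Sum>j\<in>UNIV. \<Sum>l\<in>UNIV.
     s (T (bas H i) (bas H j) (bas H l)) (f (dbas H i) (dbas H j) (dbas H l)))"


section \<open>Normalized 3-cocycles\<close>

definition trilinear :: "('k::field, 'h::ring_1, 'n::finite) hopf \<Rightarrow> ('h \<Rightarrow> 'h \<Rightarrow> 'h \<Rightarrow> 'k) \<Rightarrow> bool" where
  "trilinear H F \<longleftrightarrow>
     (\<forall>y z. Vector_Spaces.linear (scl H) (*) (\<lambda>x. F x y z)) \<and>
     (\<forall>x z. Vector_Spaces.linear (scl H) (*) (\<lambda>y. F x y z)) \<and>
     (\<forall>x y. Vector_Spaces.linear (scl H) (*) (\<lambda>z. F x y z))"

definition conv3 :: "('k::field, 'h::ring_1, 'n::finite) hopf \<Rightarrow> ('h \<Rightarrow> 'h \<Rightarrow> 'h \<Rightarrow> 'k)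
    \<Rightarrow> ('h \<Rightarrow> 'h \<Rightarrow> 'h \<Rightarrow> 'k) \<Rightarrow> 'h \<Rightarrow> 'h \<Rightarrow> 'h \<Rightarrow> 'k" where
  "conv3 H F G x y z =
     sw2 H (*) x (\<lambda>x1 x2. sw2 H (*) y (\<lambda>y1 y2. sw2 H (*) z (\<lambda>z1 z2. F x1 y1 z1 * G x2 y2 z2)))"

definition conv_inverse3 :: "('k::field, 'h::ring_1, 'n::finite) hopf \<Rightarrow> ('h \<Rightarrow> 'h \<Rightarrow> 'h \<Rightarrow> 'k)
    \<Rightarrow> ('h \<Rightarrow> 'h \<Rightarrow> 'h \<Rightarrow> 'k) \<Rightarrow> bool" where
  "conv_inverse3 H F G \<longleftrightarrow> trilinear H G \<and>
     conv3 H F G = (\<lambda>x y z. cou H x * cou H y * cou H z) \<and>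
     conv3 H G F = (\<lambda>x y z. cou H x * cou H y * cou H z)"

definition cinv3 :: "('k::field, 'h::ring_1, 'n::finite) hopf \<Rightarrow> ('h \<Rightarrow> 'h \<Rightarrow> 'h \<Rightarrow> 'k)
    \<Rightarrow> 'h \<Rightarrow> 'h \<Rightarrow> 'h \<Rightarrow> 'k" where
  "cinv3 H F = (THE G. conv_inverse3 H F G)"

definition normalized_3cocycle :: "('k::field, 'h::ring_1, 'n::finite) hopf
    \<Rightarrow> ('h \<Rightarrow> 'h \<Rightarrow> 'h \<Rightarrow> 'k) \<Rightarrow> bool" where
  "normalized_3cocycle H \<omega> \<longleftrightarrow>
     trilinear H \<omega> \<and> (\<exists>G. conv_inverse3 H \<omega> G) \<and>
     (\<forall>x y z t.
        sw2 H (*) x (\<lambda>x1 x2. sw2 H (*) y (\<lambda>y1 y2. sw2 H (*) z (\<lambda>z1 z2. sw2 H (*) t (\<lambda>t1 t2.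
          \<omega> x1 y1 (z1 * t1) * \<omega> (x2 * y2) z2 t2))))
      = sw2 H (*) x (\<lambda>x1 x2. sw3 H (*) y (\<lambda>y1 y2 y3. sw3 H (*) z (\<lambda>z1 z2 z3. sw2 H (*) t (\<lambda>t1 t2.
          \<omega> y1 z1 t1 * \<omega> x1 (y2 * z2) t2 * \<omega> x2 y3 z3))))) \<and>
     (\<forall>x y. \<omega> 1 x y = cou H x * cou H y \<and> \<omega> x 1 y = cou H x * cou H y \<and> \<omega> x y 1 = cou H x * cou H y)"


section \<open>Ribbon elements of quasitriangular quasi-Hopf algebras\<close>

text \<open>
  The structure maps of a quasitriangular quasi-Hopf algebra with underlying space \<open>'k ^ 'a\<close>; its
  tensor square and cube are \<open>'k ^ ('a \<times> 'a)\<close> and \<open>'k ^ ('a \<times> 'a \<times> 'a)\<close>.  The record carries no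
  axioms.
\<close>

record ('k, 'a) quasi_hopf =
  qmul :: "'k ^ 'a::finite \<Rightarrow> 'k ^ 'a \<Rightarrow> 'k ^ 'a"
  qone :: "'k ^ 'a"
  qcomul :: "'k ^ 'a \<Rightarrow> 'k ^ ('a \<times> 'a)"
  qcou :: "'k ^ 'a \<Rightarrow> 'k"
  qassoc :: "'k ^ ('a \<times> 'a \<times> 'a)"
  qanti :: "'k ^ 'a \<Rightarrow> 'k ^ 'a"
  qalpha :: "'k ^ 'a"
  qbeta :: "'k ^ 'a"
  qR :: "'k ^ ('a \<times> 'a)"

definition vtens2 :: "'k::field ^ 'a::finite \<Rightarrow> 'k ^ 'a \<Rightarrow> 'k ^ ('a \<times> 'a)" where
  "vtens2 a b = (\<chi> p. case p of (i, j) \<Rightarrow> a $ i * b $ j)"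

definition vtens3 :: "'k::field ^ 'a::finite \<Rightarrow> 'k ^ 'a \<Rightarrow> 'k ^ 'a \<Rightarrow> 'k ^ ('a \<times> 'a \<times> 'a)" where
  "vtens3 a b c = (\<chi> p. case p of (i, j, l) \<Rightarrow> a $ i * b $ j * c $ l)"

text \<open>
  \<open>vsw2 X (\<lambda>a b. f a b)\<close> is \<open>f(X\<^sup>1, X\<^sup>2)\<close> for \<open>X = X\<^sup>1 \<otimes> X\<^sup>2\<close> and \<open>f\<close> bilinear; similarly \<open>vsw3\<close>.
\<close>

definition vsw2 :: "'k::field ^ ('a::finite \<times> 'a) \<Rightarrow> ('k ^ 'a \<Rightarrow> 'k ^ 'a \<Rightarrow> 'k ^ 'b) \<Rightarrow> 'k ^ 'b" where
  "vsw2 X f = (\<Sum>i\<in>UNIV. \<Sum>j\<in>UNIV. X $ (i, j) *s f (axis i 1) (axis j 1))"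

definition vsw3 :: "'k::field ^ ('a::finite \<times> 'a \<times> 'a)
    \<Rightarrow> ('k ^ 'a \<Rightarrow> 'k ^ 'a \<Rightarrow> 'k ^ 'a \<Rightarrow> 'k ^ 'b) \<Rightarrow> 'k ^ 'b" where
  "vsw3 X f = (\<Sum>i\<in>UNIV. \<Sum>j\<in>UNIV. \<Sum>l\<in>UNIV.
     X $ (i, j, l) *s f (axis i 1) (axis j 1) (axis l 1))"

definition qmul2 :: "('k::field, 'a::finite) quasi_hopf
    \<Rightarrow> 'k ^ ('a \<times> 'a) \<Rightarrow> 'k ^ ('a \<times> 'a) \<Rightarrow> 'k ^ ('a \<times> 'a)" where
  "qmul2 A X Y = vsw2 X (\<lambda>a b. vsw2 Y (\<lambda>c d. vtens2 (qmul A a c) (qmul A b d)))"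

definition qmul3 :: "('k::field, 'a::finite) quasi_hopf
    \<Rightarrow> 'k ^ ('a \<times> 'a \<times> 'a) \<Rightarrow> 'k ^ ('a \<times> 'a \<times> 'a) \<Rightarrow> 'k ^ ('a \<times> 'a \<times> 'a)" where
  "qmul3 A X Y = vsw3 X (\<lambda>a b c. vsw3 Y (\<lambda>d e f.
     vtens3 (qmul A a d) (qmul A b e) (qmul A c f)))"

definition qinv2 :: "('k::field, 'a::finite) quasi_hopf \<Rightarrow> 'k ^ ('a \<times> 'a) \<Rightarrow> 'k ^ ('a \<times> 'a)" where
  "qinv2 A X = (THE Y. qmul2 A X Y = vtens2 (qone A) (qone A) \<and> qmul2 A Y X = vtens2 (qone A) (qone A))"

definition qinv3 :: "('k::field, 'a::finite) quasi_hopf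
    \<Rightarrow> 'k ^ ('a \<times> 'a \<times> 'a) \<Rightarrow> 'k ^ ('a \<times> 'a \<times> 'a)" where
  "qinv3 A X = (THE Y. qmul3 A X Y = vtens3 (qone A) (qone A) (qone A) \<and>
                       qmul3 A Y X = vtens3 (qone A) (qone A) (qone A))"

definition qR21 :: "('k::field, 'a::finite) quasi_hopf \<Rightarrow> 'k ^ ('a \<times> 'a)" where
  "qR21 A = vsw2 (qR A) (\<lambda>R1 R2. vtens2 R2 R1)"

definition drinfeld_u :: "('k::field, 'a::finite) quasi_hopf \<Rightarrow> 'k ^ 'a" where
  "drinfeld_u A =
     vsw2 (qR A) (\<lambda>R1 R2. vsw3 (qinv3 A (qassoc A)) (\<lambda>x1 x2 x3.
       qmul A (qmul A (qmul A
         (qanti A (qmul A (qmul A (qmul A R2 x2) (qbeta A)) (qanti A x3)))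
         (qalpha A)) R1) x1))"

definition ribbon_element :: "('k::field, 'a::finite) quasi_hopf \<Rightarrow> 'k ^ 'a \<Rightarrow> bool" where
  "ribbon_element A \<nu> \<longleftrightarrow>
     (\<forall>a. qmul A \<nu> a = qmul A a \<nu>) \<and>
     qcomul A \<nu> = qmul2 A (vtens2 \<nu> \<nu>) (qinv2 A (qmul2 A (qR21 A) (qR A))) \<and>
     qanti A \<nu> = \<nu> \<and>
     qmul A \<nu> \<nu> = qmul A (drinfeld_u A) (qanti A (drinfeld_u A))"


section \<open>The quasitriangular quasi-Hopf algebra \<open>D\<^sup>\<omega>(H)\<close>\<close>

text \<open>The action \<open>g \<triangleleft> x = S(x\<^sub>1) g x\<^sub>2\<close>.\<close>

definition hact :: "('k::field, 'h::ring_1, 'n::finite) hopf \<Rightarrow> 'h \<Rightarrow> 'h \<Rightarrow> 'h" where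
  "hact H g x = sw2 H (scl H) x (\<lambda>x1 x2. anti H x1 * g * x2)"

definition theta :: "('k::field, 'h::ring_1, 'n::finite) hopf \<Rightarrow> ('h \<Rightarrow> 'h \<Rightarrow> 'h \<Rightarrow> 'k)
    \<Rightarrow> 'h \<Rightarrow> 'h \<Rightarrow> 'h \<Rightarrow> 'k" where
  "theta H \<omega> g x y =
     sw3 H (*) g (\<lambda>g1 g2 g3. sw5 H (*) x (\<lambda>x1 x2 x3 x4 x5. sw4 H (*) y (\<lambda>y1 y2 y3 y4.
       \<omega> g1 x1 y1 * \<omega> x2 y2 (hact H g2 (x3 * y3)) * cinv3 H \<omega> x4 (hact H g3 x5) y4)))"

definition gamma3 :: "('k::field, 'h::ring_1, 'n::finite) hopf \<Rightarrow> ('h \<Rightarrow> 'h \<Rightarrow> 'h \<Rightarrow> 'k)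
    \<Rightarrow> 'h \<Rightarrow> 'h \<Rightarrow> 'h \<Rightarrow> 'k" where
  "gamma3 H \<omega> g h x =
     sw3 H (*) g (\<lambda>g1 g2 g3. sw3 H (*) h (\<lambda>h1 h2 h3. sw6 H (*) x (\<lambda>x1 x2 x3 x4 x5 x6.
       \<omega> g1 h1 x1 * \<omega> x2 (hact H g2 x3) (hact H h2 x4) * cinv3 H \<omega> g3 x5 (hact H h3 x6))))"

text \<open>
  The products of \<open>H\<^sup>*\<close> and \<open>(H \<otimes> H)\<^sup>*\<close> are convolution products, so convolution in
  \<open>Hom(H \<otimes> H, H\<^sup>*)\<close> and \<open>Hom(H, (H \<otimes> H)\<^sup>*)\<close> is, written out, \<^const>\<open>conv3\<close> of the corresponding
  trilinear forms.
\<close>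

definition sigma :: "('k::field, 'h::ring_1, 'n::finite) hopf \<Rightarrow> ('h \<Rightarrow> 'h \<Rightarrow> 'h \<Rightarrow> 'k)
    \<Rightarrow> 'h \<Rightarrow> 'h \<Rightarrow> 'h \<Rightarrow> 'k" where
  "sigma H \<omega> x y = (\<lambda>g. theta H \<omega> g x y)"

definition sigma_inv :: "('k::field, 'h::ring_1, 'n::finite) hopf \<Rightarrow> ('h \<Rightarrow> 'h \<Rightarrow> 'h \<Rightarrow> 'k)
    \<Rightarrow> 'h \<Rightarrow> 'h \<Rightarrow> 'h \<Rightarrow> 'k" where
  "sigma_inv H \<omega> = cinv3 H (sigma H \<omega>)"

definition kappa :: "('k::field, 'h::ring_1, 'n::finite) hopf \<Rightarrow> ('h \<Rightarrow> 'h \<Rightarrow> 'h \<Rightarrow> 'k)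
    \<Rightarrow> 'h \<Rightarrow> 'h \<Rightarrow> 'h \<Rightarrow> 'k" where
  "kappa H \<omega> h = (\<lambda>x y. gamma3 H \<omega> x y h)"

definition kappa_inv :: "('k::field, 'h::ring_1, 'n::finite) hopf \<Rightarrow> ('h \<Rightarrow> 'h \<Rightarrow> 'h \<Rightarrow> 'k)
    \<Rightarrow> 'h \<Rightarrow> 'h \<Rightarrow> 'h \<Rightarrow> 'k" where
  "kappa_inv H \<omega> = cinv3 H (kappa H \<omega>)"

definition beta :: "('k::field, 'h::ring_1, 'n::finite) hopf \<Rightarrow> ('h \<Rightarrow> 'h \<Rightarrow> 'h \<Rightarrow> 'k) \<Rightarrow> 'h \<Rightarrow> 'k" where
  "beta H \<omega> h = sw3 H (*) h (\<lambda>h1 h2 h3. \<omega> h1 (anti H h2) h3)"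

text \<open>
  \<open>D\<^sup>\<omega>(H) = H\<^sup>* \<otimes> H\<close> is \<open>'k ^ ('n \<times> 'n)\<close>, the entry at \<open>(i, j)\<close> being the coefficient of
  \<open>e\<^sup>i # e\<^sub>j\<close>.  The element \<open>\<phi> # h\<close> is \<open>hash H \<phi> h\<close>, and \<open>hash_lift H s d f\<close> is the value at \<open>d\<close> of
  the linear map with \<open>\<phi> # h \<mapsto> f \<phi> h\<close>.
\<close>

definition hash :: "('k::field, 'h::ring_1, 'n::finite) hopf \<Rightarrow> ('h \<Rightarrow> 'k) \<Rightarrow> 'h \<Rightarrow> 'k ^ ('n \<times> 'n)" where
  "hash H \<phi> h = (\<chi> p. case p of (i, j) \<Rightarrow> \<phi> (bas H i) * dbas H j h)"

definition hash_lift :: "('k::field, 'h::ring_1, 'n::finite) hopf \<Rightarrow> ('k \<Rightarrow> 'v \<Rightarrow> 'v::comm_monoid_add)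
    \<Rightarrow> 'k ^ ('n \<times> 'n) \<Rightarrow> (('h \<Rightarrow> 'k) \<Rightarrow> 'h \<Rightarrow> 'v) \<Rightarrow> 'v" where
  "hash_lift H s d f = (\<Sum>i\<in>UNIV. \<Sum>j\<in>UNIV. s (d $ (i, j)) (f (dbas H i) (bas H j)))"

definition D_mul :: "('k::field, 'h::ring_1, 'n::finite) hopf \<Rightarrow> ('h \<Rightarrow> 'h \<Rightarrow> 'h \<Rightarrow> 'k)
    \<Rightarrow> 'k ^ ('n \<times> 'n) \<Rightarrow> 'k ^ ('n \<times> 'n) \<Rightarrow> 'k ^ ('n \<times> 'n)" where
  "D_mul H \<omega> d d' = hash_lift H (*s) d (\<lambda>\<phi> h. hash_lift H (*s) d' (\<lambda>\<phi>' h'.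
     sw4 H (*s) h (\<lambda>h1 h2 h3 h4. sw2 H (*s) h' (\<lambda>h1' h2'.
       hash H (dmul H (dmul H \<phi> (ract (lact h1 \<phi>') (anti H h2))) (sigma H \<omega> h3 h1')) (h4 * h2')))))"

definition D_assoc :: "('k::field, 'h::ring_1, 'n::finite) hopf \<Rightarrow> ('h \<Rightarrow> 'h \<Rightarrow> 'h \<Rightarrow> 'k)
    \<Rightarrow> 'k ^ (('n \<times> 'n) \<times> ('n \<times> 'n) \<times> ('n \<times> 'n))" where
  "D_assoc H \<omega> = dsw3 H (*s) (cinv3 H \<omega>) (\<lambda>w1 w2 w3. vtens3 (hash H w1 1) (hash H w2 1) (hash H w3 1))"

definition D_comul :: "('k::field, 'h::ring_1, 'n::finite) hopf \<Rightarrow> ('h \<Rightarrow> 'h \<Rightarrow> 'h \<Rightarrow> 'k)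
    \<Rightarrow> 'k ^ ('n \<times> 'n) \<Rightarrow> 'k ^ (('n \<times> 'n) \<times> ('n \<times> 'n))" where
  "D_comul H \<omega> d = hash_lift H (*s) d (\<lambda>\<phi> h. sw3 H (*s) h (\<lambda>h1 h2 h3.
     dsw2 H (*s) (kappa H \<omega> h1) (\<lambda>k1 k2. dsw2 H (*s) (dcomul \<phi>) (\<lambda>\<phi>1 \<phi>2.
       vtens2 (hash H (dmul H k1 \<phi>1) h2) (hash H (dmul H k2 \<phi>2) h3)))))"

definition D_cou :: "('k::field, 'h::ring_1, 'n::finite) hopf \<Rightarrow> 'k ^ ('n \<times> 'n) \<Rightarrow> 'k" where
  "D_cou H d = hash_lift H (*) d (\<lambda>\<phi> h. \<phi> 1 * cou H h)"

definition D_anti :: "('k::field, 'h::ring_1, 'n::finite) hopf \<Rightarrow> ('h \<Rightarrow> 'h \<Rightarrow> 'h \<Rightarrow> 'k)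
    \<Rightarrow> 'k ^ ('n \<times> 'n) \<Rightarrow> 'k ^ ('n \<times> 'n)" where
  "D_anti H \<omega> d = hash_lift H (*s) d (\<lambda>\<phi> h. sw4 H (*s) h (\<lambda>h1 h2 h3 h4.
     dsw2 H (*s) (kappa_inv H \<omega> h4) (\<lambda>k1 k2.
       D_mul H \<omega> (hash H (cou H) (anti H h1))
         (hash H (dmul H (dmul H (sigma_inv H \<omega> h2 (anti H h3)) (danti H (dmul H \<phi> k1))) k2) 1))))"

definition D_R :: "('k::field, 'h::ring_1, 'n::finite) hopf \<Rightarrow> 'k ^ (('n \<times> 'n) \<times> ('n \<times> 'n))" where
  "D_R H = (\<Sum>i\<in>UNIV. vtens2 (hash H (dbas H i) 1) (hash H (cou H) (bas H i)))"

definition D_omega :: "('k::field, 'h::ring_1, 'n::finite) hopf \<Rightarrow> ('h \<Rightarrow> 'h \<Rightarrow> 'h \<Rightarrow> 'k)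
    \<Rightarrow> ('k, 'n \<times> 'n) quasi_hopf" where
  "D_omega H \<omega> = \<lparr>
     qmul = D_mul H \<omega>,
     qone = hash H (cou H) 1,
     qcomul = D_comul H \<omega>,
     qcou = D_cou H,
     qassoc = D_assoc H \<omega>,
     qanti = D_anti H \<omega>,
     qalpha = hash H (cou H) 1,
     qbeta = hash H (beta H \<omega>) 1,
     qR = D_R H\<rparr>"

end

theory Submission
  imports Defs
begin

text \<open>
  For a commutative \<open>k\<close>-algebra \<open>R\<close>, the grouplike elements of \<open>H \<otimes> R\<close>, the \<open>R\<close>-points of \<open>H\<close>, form a group,
  because \<open>H\<close> is a cocommutative Hopf algebra.  An identity between multilinear Sweedler expressions
  holds as soon as it holds at generic points (\<open>transfer4\<close>), and at a point every Sweedler component of a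
  variable is a copy of that point.  So \<open>\<omega>\<close> may be treated as a 3-cocycle on a group with values in the
  units of a commutative ring, and there
  \<open>\<theta>(g;x,y) = \<omega>(g,x,y) \<omega>(x,y,g\<^sup>x\<^sup>y) / \<omega>(x,g\<^sup>x,y)\<close> and
  \<open>\<gamma>(g,h;x) = \<omega>(g,h,x) \<omega>(x,g\<^sup>x,h\<^sup>x) / \<omega>(g,x,h\<^sup>x)\<close> with \<open>g\<^sup>x = x\<inverse>gx\<close>.

  An element \<open>\<phi> # h\<close> is read as the function \<open>g \<mapsto> \<phi>(g) h\<close> from points to \<open>H\<close>.  If \<open>d(g) = f x\<close> and
  \<open>d'(g\<^sup>x) = f' y\<close> with scalars \<open>f, f'\<close> and points \<open>x, y\<close>, then \<open>(d d')(g) = f f' \<theta>(g;x,y) xy\<close>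
  (\<open>value_at_mul\<close>); similar rules hold for the other structure maps.

  The modular element comes in through sums over dual bases, in \<open>u\<close> through the \<open>R\<close>-matrix and in \<open>s\<close>
  through the expansion of its argument.  They are traces of operators like \<open>e \<mapsto> S(e\<^sub>1) y e\<^sub>2\<close>, and
  such a trace is the value at the fixed point of the operator times a value of \<open>\<mu>\<close> (\<open>trace_conj\<close>,
  \<open>trace_conj_inv\<close>), because left integrals are transported by right multiplication with the factor
  \<open>\<mu>\<close>.  This gives \<open>u(g) = \<mu>(g\<inverse>) \<beta>(g)\<^sup>-\<^sup>2 g\<inverse>\<close>, hence
  \<open>\<nu>(g) = \<mu>(g\<inverse>) \<zeta>(g) \<beta>(g)\<inverse> g\<inverse>\<close>, and \<open>s\<close> maps \<open>g \<mapsto> f(g) g\<inverse>\<close> to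
  \<open>g \<mapsto> \<mu>(g\<inverse>) f(g\<inverse>) \<beta>(g)\<^sup>-\<^sup>2 g\<inverse>\<close>.

  Since \<open>\<mu>\<inverse>\<zeta>\<close> is a character, the centrality of \<open>\<nu>\<close> and the formula for its comultiplication reduce to
  the cocycle identities \<open>th_central\<close> and \<open>th_gm_coproduct\<close>; they hold for every \<open>\<zeta>\<close>.  The condition
  \<open>s(\<nu>) = \<nu>\<close> reads \<open>\<zeta>(g\<inverse>) = \<mu>(g\<inverse>) \<zeta>(g)\<close>, that is \<open>\<zeta>\<^sup>2 = \<mu>\<close>, and then \<open>\<nu>\<^sup>2 = u s(u)\<close> follows
  since \<open>s(u)(g) = g\<inverse>\<close>.
\<close>

section \<open>Identities for 3-cocycles on a group\<close>

text \<open>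
  Cocycle identities are equalities of fractions.  With the denominators \<open>p\<close> and \<open>q\<close> cleared, they
  follow from instances of the cocycle condition only up to a common factor \<open>c\<close>, a unit.
\<close>

lemma fraction_eqI:
  fixes a b c p q :: "'a::comm_ring_1"
  assumes p: "p * p' = 1" and q: "q * q' = 1" and c: "c dvd 1" and eq: "a * q * c = b * p * c"
  shows "a * p' = b * q'"
proof -
  obtain d where d: "1 = c * d" using c by (elim dvdE)
  have "a * p' = a * p' * (q * q') * (c * d)" using q d by simp
  also have "\<dots> = (a * q * c) * (p' * q' * d)" by (simp only: ac_simps)
  also have "\<dots> = b * q' * (p * p') * (c * d)" unfolding eq by (simp only: ac_simps)
  finally show ?thesis using p d by simp
qed

lemma unit_mult: "a dvd 1 \<Longrightarrow> b dvd 1 \<Longrightarrow> a * b dvd (1::'a::comm_ring_1)"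
  using mult_dvd_mono[of a 1 b 1] by simp

lemma mult_inverses:
  fixes a b :: "'a::comm_ring_1"
  assumes "a * a' = 1" and "b * b' = 1"
  shows "a * b * (a' * b') = 1"
proof -
  have "a * b * (a' * b') = (a * a') * (b * b')" by (simp only: ac_simps)
  then show ?thesis using assms by simp
qed

text \<open>
  The values are units of a ring instead of elements of an abelian group, since this is the form in which
  a convolution invertible cocycle appears at points; \<open>w'\<close> is its inverse.
\<close>

locale group_cocycle =
  fixes G :: "'g set" and mul :: "'g \<Rightarrow> 'g \<Rightarrow> 'g" (infixl "\<cdot>" 70) and inv :: "'g \<Rightarrow> 'g" and e :: 'g
    and w w' :: "'g \<Rightarrow> 'g \<Rightarrow> 'g \<Rightarrow> 'r::comm_ring_1"
  assumes mul_closed [simp]: "x \<in> G \<Longrightarrow> y \<in> G \<Longrightarrow> x \<cdot> y \<in> G"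
    and inv_closed [simp]: "x \<in> G \<Longrightarrow> inv x \<in> G"
    and e_closed [simp]: "e \<in> G"
    and assoc [simp]: "x \<in> G \<Longrightarrow> y \<in> G \<Longrightarrow> z \<in> G \<Longrightarrow> x \<cdot> y \<cdot> z = x \<cdot> (y \<cdot> z)"
    and left_one [simp]: "x \<in> G \<Longrightarrow> e \<cdot> x = x"
    and right_one [simp]: "x \<in> G \<Longrightarrow> x \<cdot> e = x"
    and left_inv [simp]: "x \<in> G \<Longrightarrow> inv x \<cdot> x = e"
    and right_inv [simp]: "x \<in> G \<Longrightarrow> x \<cdot> inv x = e"
    and w_inverse: "x \<in> G \<Longrightarrow> y \<in> G \<Longrightarrow> z \<in> G \<Longrightarrow> w x y z * w' x y z = 1"
    and cocycle: "x \<in> G \<Longrightarrow> y \<in> G \<Longrightarrow> z \<in> G \<Longrightarrow> t \<in> G \<Longrightarrow>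
      w x y (z \<cdot> t) * w (x \<cdot> y) z t = w y z t * w x (y \<cdot> z) t * w x y z"
    and normalized [simp]: "x \<in> G \<Longrightarrow> y \<in> G \<Longrightarrow> w e x y = 1"
      "x \<in> G \<Longrightarrow> y \<in> G \<Longrightarrow> w x e y = 1" "x \<in> G \<Longrightarrow> y \<in> G \<Longrightarrow> w x y e = 1"
begin

lemma left_inv_assoc [simp]: "x \<in> G \<Longrightarrow> y \<in> G \<Longrightarrow> inv x \<cdot> (x \<cdot> y) = y"
  by (metis assoc inv_closed left_inv left_one)

lemma right_inv_assoc [simp]: "x \<in> G \<Longrightarrow> y \<in> G \<Longrightarrow> x \<cdot> (inv x \<cdot> y) = y"
  by (metis assoc inv_closed right_inv left_one)

lemma inv_eqI: "x \<in> G \<Longrightarrow> y \<in> G \<Longrightarrow> x \<cdot> y = e \<Longrightarrow> inv x = y"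
  by (metis inv_closed left_inv_assoc right_one)

lemma inv_inv [simp]: "x \<in> G \<Longrightarrow> inv (inv x) = x"
  by (rule inv_eqI) auto

lemma inv_one [simp]: "inv e = e"
  by (rule inv_eqI) auto

lemma inv_mul [simp]: "x \<in> G \<Longrightarrow> y \<in> G \<Longrightarrow> inv (x \<cdot> y) = inv y \<cdot> inv x"
  by (rule inv_eqI) auto

lemma w'_inverse: "x \<in> G \<Longrightarrow> y \<in> G \<Longrightarrow> z \<in> G \<Longrightarrow> w' x y z * w x y z = 1"
  using w_inverse by (simp add: mult.commute)

lemma w_unit [simp]: "x \<in> G \<Longrightarrow> y \<in> G \<Longrightarrow> z \<in> G \<Longrightarrow> w x y z dvd 1"
  using w_inverse by (metis dvd_triv_left)

lemma w'_normalized [simp]: "x \<in> G \<Longrightarrow> y \<in> G \<Longrightarrow> w' e x y = 1"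
  "x \<in> G \<Longrightarrow> y \<in> G \<Longrightarrow> w' x e y = 1" "x \<in> G \<Longrightarrow> y \<in> G \<Longrightarrow> w' x y e = 1"
  using w_inverse normalized by (metis e_closed mult_1)+

definition conj :: "'g \<Rightarrow> 'g \<Rightarrow> 'g" (infixl "\<triangleleft>" 70) where
  "g \<triangleleft> x = inv x \<cdot> g \<cdot> x"

text \<open>
  \<open>th\<close>, \<open>gm\<close> and \<open>bt\<close> are \<open>\<theta>\<close>, \<open>\<gamma>\<close> and \<open>\<beta>\<close> at group elements; a prime marks the inverse values.
\<close>

definition th :: "'g \<Rightarrow> 'g \<Rightarrow> 'g \<Rightarrow> 'r" where
  "th g x y = w g x y * w x y (g \<triangleleft> (x \<cdot> y)) * w' x (g \<triangleleft> x) y"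

definition th' :: "'g \<Rightarrow> 'g \<Rightarrow> 'g \<Rightarrow> 'r" where
  "th' g x y = w' g x y * w' x y (g \<triangleleft> (x \<cdot> y)) * w x (g \<triangleleft> x) y"

definition gm :: "'g \<Rightarrow> 'g \<Rightarrow> 'g \<Rightarrow> 'r" where
  "gm g h x = w g h x * w x (g \<triangleleft> x) (h \<triangleleft> x) * w' g x (h \<triangleleft> x)"

definition gm' :: "'g \<Rightarrow> 'g \<Rightarrow> 'g \<Rightarrow> 'r" where
  "gm' g h x = w' g h x * w' x (g \<triangleleft> x) (h \<triangleleft> x) * w g x (h \<triangleleft> x)"

definition bt :: "'g \<Rightarrow> 'r" where "bt g = w g (inv g) g"

definition bt' :: "'g \<Rightarrow> 'r" where "bt' g = w' g (inv g) g"

lemma conj_closed [simp]: "g \<in> G \<Longrightarrow> x \<in> G \<Longrightarrow> g \<triangleleft> x \<in> G"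
  by (simp add: conj_def)

lemma th_inverse: "g \<in> G \<Longrightarrow> x \<in> G \<Longrightarrow> y \<in> G \<Longrightarrow> th g x y * th' g x y = 1"
  unfolding th_def th'_def by (intro mult_inverses w_inverse w'_inverse) simp_all

lemma gm_inverse: "g \<in> G \<Longrightarrow> h \<in> G \<Longrightarrow> x \<in> G \<Longrightarrow> gm g h x * gm' g h x = 1"
  unfolding gm_def gm'_def by (intro mult_inverses w_inverse w'_inverse) simp_all

lemma bt_inverse: "g \<in> G \<Longrightarrow> bt g * bt' g = 1"
  by (simp add: bt_def bt'_def w_inverse)

lemma th_one [simp]: "g \<in> G \<Longrightarrow> x \<in> G \<Longrightarrow> th g e x = 1" "g \<in> G \<Longrightarrow> x \<in> G \<Longrightarrow> th g x e = 1"
  by (simp_all add: th_def conj_def)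

lemma th'_one [simp]: "g \<in> G \<Longrightarrow> x \<in> G \<Longrightarrow> th' g e x = 1" "g \<in> G \<Longrightarrow> x \<in> G \<Longrightarrow> th' g x e = 1"
  by (simp_all add: th'_def conj_def)

lemma gm'_one [simp]: "g \<in> G \<Longrightarrow> h \<in> G \<Longrightarrow> gm' g h e = 1"
  by (simp_all add: gm'_def conj_def)

text \<open>
  This identity makes the product of \<open>D\<^sup>\<omega>(H)\<close> associative.  Inserting \<open>g\<close> into \<open>(x, y, z)\<close>, and
  conjugating it by what it passes, gives four quadruples; the identity is the alternating product of
  the cocycle conditions at them.
\<close>

lemma th_cocycle:
  assumes G: "g \<in> G" "x \<in> G" "y \<in> G" "z \<in> G"
  shows "th g x y * th g (x \<cdot> y) z = th (g \<triangleleft> x) y z * th g x (y \<cdot> z)"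
proof -
  define h k l where "h = g \<triangleleft> x" and "k = g \<triangleleft> (x \<cdot> y)" and "l = g \<triangleleft> (x \<cdot> y \<cdot> z)"
  have [simp]: "h \<in> G" "k \<in> G" "l \<in> G" using G by (simp_all add: h_def k_def l_def)
  have m: "x \<cdot> h = g \<cdot> x" "h \<cdot> y = y \<cdot> k" "k \<cdot> z = z \<cdot> l"
    using G by (simp_all add: h_def k_def l_def conj_def)
  have c: "h \<triangleleft> y = k" "h \<triangleleft> (y \<cdot> z) = l" "g \<triangleleft> (x \<cdot> (y \<cdot> z)) = l" "g \<triangleleft> x = h" "g \<triangleleft> (x \<cdot> y) = k" "g \<triangleleft> (x \<cdot> y \<cdot> z) = l"
    using G by (simp_all add: h_def k_def l_def conj_def)
  have I1: "w g x (y \<cdot> z) * w (g \<cdot> x) y z = w x y z * w g (x \<cdot> y) z * w g x y"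
    and I2: "w x h (y \<cdot> z) * w (g \<cdot> x) y z = w h y z * w x (y \<cdot> k) z * w x h y"
    and I3: "w x y (z \<cdot> l) * w (x \<cdot> y) k z = w y k z * w x (y \<cdot> k) z * w x y k"
    and I4: "w x y (z \<cdot> l) * w (x \<cdot> y) z l = w y z l * w x (y \<cdot> z) l * w x y z"
    using G cocycle[of g x y z] cocycle[of x h y z] cocycle[of x y k z] cocycle[of x y z l]
    by (simp_all add: m del: assoc)
  have "(w g x y * w x y k * (w g (x \<cdot> y) z * w (x \<cdot> y) z l)) * (w' x h y * w' (x \<cdot> y) k z) =
        (w h y z * w y z l * (w g x (y \<cdot> z) * w x (y \<cdot> z) l)) * (w' y k z * w' x h (y \<cdot> z))"
  proof (rule fraction_eqI)
    show "w x h y * w (x \<cdot> y) k z * (w' x h y * w' (x \<cdot> y) k z) = 1"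
      by (intro mult_inverses w_inverse) (use G in simp_all)
    show "w y k z * w x h (y \<cdot> z) * (w' y k z * w' x h (y \<cdot> z)) = 1"
      by (intro mult_inverses w_inverse) (use G in simp_all)
    show "(w x y z * w (g \<cdot> x) y z * w x y (z \<cdot> l) * w x (y \<cdot> k) z) dvd 1"
      using G by (intro unit_mult) simp_all
    have "(w x y z * w g (x \<cdot> y) z * w g x y) * (w y k z * w x (y \<cdot> k) z * w x y k) *
          (w x y (z \<cdot> l) * w (x \<cdot> y) z l) * (w x h (y \<cdot> z) * w (g \<cdot> x) y z) =
          (w g x (y \<cdot> z) * w (g \<cdot> x) y z) * (w x y (z \<cdot> l) * w (x \<cdot> y) k z) *
          (w y z l * w x (y \<cdot> z) l * w x y z) * (w h y z * w x (y \<cdot> k) z * w x h y)"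
      by (simp only: I1 I2 I3 I4)
    then show "w g x y * w x y k * (w g (x \<cdot> y) z * w (x \<cdot> y) z l) * (w y k z * w x h (y \<cdot> z)) *
      (w x y z * w (g \<cdot> x) y z * w x y (z \<cdot> l) * w x (y \<cdot> k) z) =
      w h y z * w y z l * (w g x (y \<cdot> z) * w x (y \<cdot> z) l) * (w x h y * w (x \<cdot> y) k z) *
      (w x y z * w (g \<cdot> x) y z * w x y (z \<cdot> l) * w x (y \<cdot> k) z)"
      by (simp only: ac_simps)
  qed
  then show ?thesis unfolding th_def h_def[symmetric] c by (simp only: ac_simps c)
qed

text \<open>
  The cocycle condition at \<open>(g, g\<inverse>, g, g\<inverse>)\<close>, where normalization leaves two factors.
\<close>

lemma bt_inv: "g \<in> G \<Longrightarrow> bt (inv g) = bt' g"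
proof -
  assume g: "g \<in> G"
  have "bt g * bt (inv g) = 1"
    using g cocycle[of g "inv g" g "inv g"] by (simp add: bt_def mult.commute)
  then have "bt' g * (bt g * bt (inv g)) = bt' g" by simp
  then show ?thesis using bt_inverse[OF g] by (simp add: mult.assoc[symmetric] mult.commute)
qed

lemma th'_self_inv:
  assumes g: "g \<in> G"
  shows "th' g g (inv g) = bt' g"
proof -
  have "th' g g (inv g) = bt' g * (w g g (inv g) * w' g g (inv g))"
    using g by (simp add: th'_def bt'_def conj_def ac_simps)
  then show ?thesis using g by (simp add: w_inverse)
qed

lemma gm'_inv_self: "g \<in> G \<Longrightarrow> gm' (inv g) g g = bt' g"
  using w'_inverse[of "inv g" g g] by (simp add: gm'_def bt'_def conj_def mult.assoc mult.left_commute)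

lemma th_inv_right:
  assumes "g \<in> G" "x \<in> G"
  shows "th (g \<triangleleft> x) (inv x) x = th g x (inv x)"
  using th_cocycle[of g x "inv x" x] assms by simp

text \<open>
  With \<open>f = 1/\<beta>\<close>, this says that \<open>g \<mapsto> f(g) g\<inverse>\<close> commutes with the elements \<open>\<phi> # x\<close>: both products send
  \<open>g\<close> to a multiple of \<open>g\<inverse>x\<close>.  It is a combination of the cocycle conditions at
  \<open>(g, g\<inverse>, x, h)\<close>, \<open>(g, g\<inverse>, g, x)\<close>, \<open>(g, x, h\<inverse>, h)\<close> and \<open>(x, h, h\<inverse>, h)\<close> for \<open>h = g \<triangleleft> x\<close>.
\<close>

lemma th_central:
  assumes G: "g \<in> G" "x \<in> G"
  shows "bt' g * th g (inv g) x = bt' (g \<triangleleft> x) * th g x (inv (g \<triangleleft> x))"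
proof -
  define h n m where "h = g \<triangleleft> x" and "n = g \<cdot> x" and "m = inv g \<cdot> x"
  have [simp]: "h \<in> G" "n \<in> G" "m \<in> G" using G by (simp_all add: h_def n_def m_def)
  have r: "x \<cdot> h = n" "x \<cdot> inv h = m" "g \<cdot> x = n" "inv g \<cdot> x = m" "n \<cdot> inv h = x" "h \<cdot> inv h = e"
    using G by (simp_all add: h_def n_def m_def conj_def)
  have c: "g \<triangleleft> m = h" "g \<triangleleft> inv g = g"
    using G by (simp_all add: h_def m_def conj_def)
  have J: "w g (inv g) n = w (inv g) x h * w g m h * w g (inv g) x"
    "w g (inv g) n = w (inv g) g x * w g (inv g) g"
    "w n (inv h) h = w x (inv h) h * w g m h * w g x (inv h)"
    "w n (inv h) h = w h (inv h) h * w x h (inv h)"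
    using G cocycle[of g "inv g" x h] cocycle[of g "inv g" g x] cocycle[of g x "inv h" h] cocycle[of x h "inv h" h]
    by (simp_all add: r)
  have "(w g (inv g) x * w (inv g) x h) * (w' g (inv g) g * w' (inv g) g x) =
        (w g x (inv h) * w x (inv h) h) * (w' h (inv h) h * w' x h (inv h))"
  proof (rule fraction_eqI)
    show "w g (inv g) g * w (inv g) g x * (w' g (inv g) g * w' (inv g) g x) = 1"
      by (intro mult_inverses w_inverse) (use G in simp_all)
    show "w h (inv h) h * w x h (inv h) * (w' h (inv h) h * w' x h (inv h)) = 1"
      by (intro mult_inverses w_inverse) (use G in simp_all)
    show "w g m h dvd 1" using G by simp
    have "(w (inv g) x h * w g m h * w g (inv g) x) * (w h (inv h) h * w x h (inv h)) =
          (w x (inv h) h * w g m h * w g x (inv h)) * (w (inv g) g x * w g (inv g) g)"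
      unfolding J(1)[symmetric] J(4)[symmetric] unfolding J(2) J(3) by (simp only: ac_simps)
    then show "w g (inv g) x * w (inv g) x h * (w h (inv h) h * w x h (inv h)) * w g m h =
      w g x (inv h) * w x (inv h) h * (w g (inv g) g * w (inv g) g x) * w g m h"
      by (simp only: ac_simps)
  qed
  then show ?thesis
    unfolding th_def bt'_def h_def[symmetric] r c by (simp only: ac_simps)
qed

text \<open>
  With \<open>f = 1/\<beta>\<close> and \<open>\<nu>(g) = f(g) g\<inverse>\<close>, this is \<open>\<Delta>(\<nu>) R\<^sub>2\<^sub>1 R = \<nu> \<otimes> \<nu>\<close> at the pair \<open>(a, b)\<close>.  The factors of
  \<open>\<gamma>\<close> and \<open>\<theta>\<close> that contain a conjugate of \<open>a\<close> or \<open>b\<close> cancel, and what is left is a combination of three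
  cocycle conditions.
\<close>

lemma th_gm_coproduct:
  assumes G: "a \<in> G" "b \<in> G"
  defines "c \<equiv> inv (a \<cdot> b)"
  shows "bt' (a \<cdot> b) * gm a b c * th a c (a \<cdot> b \<cdot> inv a) * th b c a = bt' a * bt' b"
proof -
  define A B N where "A = a \<triangleleft> c" and "B = a \<cdot> b \<cdot> inv a" and "N = w a b c * w b c a * w c a b"
  have [simp]: "A \<in> G" "B \<in> G" "c \<in> G" using G by (simp_all add: A_def B_def c_def)
  have r: "b \<cdot> c = inv a" "c \<cdot> a = inv b" "c \<cdot> (a \<cdot> b) = e" "c \<cdot> B = inv a" "inv (a \<cdot> b) = c"
    using G by (simp_all add: B_def c_def)
  have conj: "b \<triangleleft> c = B" "a \<triangleleft> inv a = a" "b \<triangleleft> inv b = b"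
    using G by (simp_all add: B_def c_def conj_def)
  have K: "w b c (a \<cdot> b) * w (inv a) a b = w c a b * w b (inv b) b * w b c a"
    "w a (inv a) (a \<cdot> b) = w (inv a) a b * w a (inv a) a"
    "w (a \<cdot> b) c (a \<cdot> b) = w b c (a \<cdot> b) * w a (inv a) (a \<cdot> b) * w a b c"
    using G cocycle[of b c a b] cocycle[of a "inv a" a b] cocycle[of a b c "a \<cdot> b"] by (simp_all add: r del: inv_mul)
  have "bt (a \<cdot> b) = w b c (a \<cdot> b) * w (inv a) a b * (w a (inv a) a * w a b c)"
    unfolding bt_def r K(3) K(2) by (simp only: ac_simps)
  also have "\<dots> = N * (bt a * bt b)"
    unfolding K(1) N_def bt_def by (simp only: ac_simps)
  finally have bt: "bt (a \<cdot> b) = N * (bt a * bt b)" .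
  have "gm a b c * th a c B * th b c a =
      N * (w c A B * w' c A B) * (w a c B * w' a c B) * (w c B a * w' c B a)"
    unfolding gm_def th_def A_def[symmetric] conj r N_def by (simp only: ac_simps)
  also have "\<dots> = N" using G by (simp add: w_inverse)
  finally have N: "gm a b c * th a c B * th b c a = N" .
  have "bt' (a \<cdot> b) * (gm a b c * th a c B * th b c a) = bt' (a \<cdot> b) * N * (bt a * bt' a) * (bt b * bt' b)"
    using G by (simp add: N bt_inverse)
  also have "\<dots> = (bt (a \<cdot> b) * bt' (a \<cdot> b)) * (bt' a * bt' b)"
    unfolding bt by (simp only: ac_simps)
  finally show ?thesis using G by (simp add: B_def mult.assoc bt_inverse del: assoc)
qed

end

section \<open>Evaluation maps and algebras given by structure constants\<close>

text \<open>
  \<open>E P f\<close> is the value at the vector with coordinates \<open>P\<close> of the linear map that is \<open>f\<close> on the basis.  The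
  function \<open>f\<close> is indexed by the basis because Sweedler sums are sums over basis elements, too.
\<close>

definition E :: "('n::finite \<Rightarrow> 'r::comm_ring_1) \<Rightarrow> ('n \<Rightarrow> 'r) \<Rightarrow> 'r" where
  "E P f = (\<Sum>i\<in>UNIV. P i * f i)"

definition EV :: "('n::finite \<Rightarrow> 'r::comm_ring_1) \<Rightarrow> ('n \<Rightarrow> 'm \<Rightarrow> 'r) \<Rightarrow> 'm \<Rightarrow> 'r" where
  "EV P f = (\<lambda>j. E P (\<lambda>i. f i j))"

lemma E_swap: "E P (\<lambda>i. E Q (\<lambda>j. f i j)) = E Q (\<lambda>j. E P (\<lambda>i. f i j))"
  unfolding E_def sum_distrib_left by (subst sum.swap) (simp add: ac_simps)

lemma E_mult_left: "E P (\<lambda>i. c * f i) = c * E P f"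
  unfolding E_def sum_distrib_left by (simp add: ac_simps)

lemma E_mult_right: "E P (\<lambda>i. f i * c) = E P f * c"
  unfolding E_def sum_distrib_right by (simp add: ac_simps)

lemma E_sum: "E P (\<lambda>i. \<Sum>a\<in>A. f i a) = (\<Sum>a\<in>A. E P (\<lambda>i. f i a))"
  unfolding E_def sum_distrib_left by (rule sum.swap)

lemma E_smult: "E (\<lambda>j. c * P j) f = c * E P f"
  unfolding E_def sum_distrib_left by (simp add: ac_simps)

lemma E_EV: "E (EV P f) g = E P (\<lambda>i. E (f i) g)"
  unfolding EV_def E_def sum_distrib_left sum_distrib_right
  by (subst sum.swap) (simp add: ac_simps)

lemma sum_pair: "(\<Sum>q\<in>UNIV. f q) = (\<Sum>i\<in>(UNIV::'a::finite set). \<Sum>j\<in>(UNIV::'b::finite set). f (i, j))"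
  by (simp add: sum.cartesian_product UNIV_Times_UNIV[symmetric] del: UNIV_Times_UNIV)

text \<open>
  The evaluation map is also used for vectors indexed by pairs, where it serves as a bilinear pairing.
\<close>

lemma E_pair: "E d F = (\<Sum>i\<in>UNIV. \<Sum>j\<in>UNIV. d (i, j) * F (i, j))"
  by (simp add: E_def sum_pair)

text \<open>
  The product of the algebra with structure constants \<open>m\<close>: the coefficient of \<open>e\<^sub>t\<close> in \<open>e\<^sub>p e\<^sub>q\<close> is \<open>m p q t\<close>.  The
  tensor powers of \<open>D\<^sup>\<omega>(H)\<close> inherit associativity and unit in this form, which makes inverses in them unique.
\<close>

definition sc_mul :: "('a::finite \<Rightarrow> 'a \<Rightarrow> 'a \<Rightarrow> 'r::comm_ring_1) \<Rightarrow> ('a \<Rightarrow> 'r) \<Rightarrow> ('a \<Rightarrow> 'r) \<Rightarrow> 'a \<Rightarrow> 'r" where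
  "sc_mul m x y = EV x (\<lambda>p. EV y (m p))"

lemma sc_mul_apply: "sc_mul m x y t = E x (\<lambda>p. E y (\<lambda>q. m p q t))"
  by (simp add: sc_mul_def EV_def)

lemma E_sc_mul: "E (sc_mul m x y) F = E x (\<lambda>p. E y (\<lambda>q. E (m p q) F))"
  by (simp add: sc_mul_def E_EV)

definition sc_assoc :: "('a::finite \<Rightarrow> 'a \<Rightarrow> 'a \<Rightarrow> 'r::comm_ring_1) \<Rightarrow> bool" where
  "sc_assoc m \<longleftrightarrow> (\<forall>p q r t. E (m p q) (\<lambda>s. m s r t) = E (m q r) (\<lambda>s. m p s t))"

definition sc_unit :: "('a::finite \<Rightarrow> 'a \<Rightarrow> 'a \<Rightarrow> 'r::comm_ring_1) \<Rightarrow> ('a \<Rightarrow> 'r) \<Rightarrow> bool" where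
  "sc_unit m u \<longleftrightarrow> (\<forall>q t. E u (\<lambda>p. m p q t) = of_bool (q = t) \<and> E u (\<lambda>p. m q p t) = of_bool (q = t))"

lemma sc_mul_assoc:
  assumes "sc_assoc m"
  shows "sc_mul m (sc_mul m x y) z = sc_mul m x (sc_mul m y z)"
proof
  fix t
  have "sc_mul m (sc_mul m x y) z t = E x (\<lambda>p. E y (\<lambda>q. E z (\<lambda>r. E (m p q) (\<lambda>s. m s r t))))"
    unfolding sc_mul_apply[of _ "sc_mul m x y"] E_sc_mul
    by (subst E_swap[of "m _ _" z]) (rule refl)
  also have "\<dots> = sc_mul m x (sc_mul m y z) t"
    using assms unfolding sc_assoc_def by (simp add: sc_mul_apply[of _ x] E_sc_mul)
  finally show "sc_mul m (sc_mul m x y) z t = sc_mul m x (sc_mul m y z) t" .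
qed

lemma E_of_bool: "E x (\<lambda>p. of_bool (p = t)) = x t"
proof -
  have "x p * of_bool (p = t) = (if p = t then x p else 0)" for p by simp
  then show ?thesis by (simp add: E_def)
qed

lemma sc_mul_unit:
  assumes "sc_unit m u"
  shows "sc_mul m u x = x" "sc_mul m x u = x"
proof -
  show "sc_mul m u x = x"
    using assms by (subst fun_eq_iff) (subst sc_mul_apply, subst E_swap, simp add: sc_unit_def E_of_bool)
  show "sc_mul m x u = x"
    using assms by (subst fun_eq_iff) (simp add: sc_mul_apply sc_unit_def E_of_bool)
qed

definition sc_tensor :: "('a \<Rightarrow> 'a \<Rightarrow> 'a \<Rightarrow> 'r::comm_ring_1) \<Rightarrow> ('b \<Rightarrow> 'b \<Rightarrow> 'b \<Rightarrow> 'r) \<Rightarrow> 'a \<times> 'b \<Rightarrow> 'a \<times> 'b \<Rightarrow> 'a \<times> 'b \<Rightarrow> 'r" where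
  "sc_tensor m m' p q t = m (fst p) (fst q) (fst t) * m' (snd p) (snd q) (snd t)"

lemma E_product: "E (\<lambda>p. f (fst p) * g (snd p)) (\<lambda>p. F (fst p) * G (snd p)) = E f F * E g G"
  unfolding E_pair by (simp add: E_def sum_product ac_simps)

lemma sc_assoc_tensor:
  assumes "sc_assoc m" "sc_assoc m'"
  shows "sc_assoc (sc_tensor m m')"
  unfolding sc_assoc_def
proof (intro allI)
  fix p q r t
  show "E (sc_tensor m m' p q) (\<lambda>s. sc_tensor m m' s r t) = E (sc_tensor m m' q r) (\<lambda>s. sc_tensor m m' p s t)"
    using assms E_product[of "m (fst p) (fst q)" "m' (snd p) (snd q)" "\<lambda>s. m s (fst r) (fst t)" "\<lambda>s. m' s (snd r) (snd t)"]
      E_product[of "m (fst q) (fst r)" "m' (snd q) (snd r)" "\<lambda>s. m (fst p) s (fst t)" "\<lambda>s. m' (snd p) s (snd t)"]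
    by (simp add: sc_assoc_def sc_tensor_def[abs_def])
qed

lemma sc_unit_tensor:
  assumes "sc_unit m u" "sc_unit m' u'"
  shows "sc_unit (sc_tensor m m') (\<lambda>p. u (fst p) * u' (snd p))"
  unfolding sc_unit_def
proof (intro allI conjI)
  fix q t
  show "E (\<lambda>p. u (fst p) * u' (snd p)) (\<lambda>p. sc_tensor m m' p q t) = of_bool (q = t)"
    "E (\<lambda>p. u (fst p) * u' (snd p)) (\<lambda>p. sc_tensor m m' q p t) = of_bool (q = t)"
    using assms E_product[of u u' "\<lambda>p. m p (fst q) (fst t)" "\<lambda>p. m' p (snd q) (snd t)"]
      E_product[of u u' "\<lambda>p. m (fst q) p (fst t)" "\<lambda>p. m' (snd q) p (snd t)"]
    by (simp_all add: sc_unit_def sc_tensor_def prod_eq_iff of_bool_conj)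
qed

section \<open>Points of a cocommutative Hopf algebra with values in a commutative ring\<close>

text \<open>
  The coordinate vector of a grouplike element of \<open>H \<otimes> R\<close>, where \<open>\<iota>\<close> is the structure map of the
  \<open>k\<close>-algebra \<open>R\<close>.
\<close>

definition pt :: "('k::field, 'h::ring_1, 'n::finite) hopf \<Rightarrow> ('k \<Rightarrow> 'r::comm_ring_1) \<Rightarrow> ('n \<Rightarrow> 'r) \<Rightarrow> bool" where
  "pt H \<iota> P \<longleftrightarrow> (\<forall>i j. E P (\<lambda>l. \<iota> (comul H (bas H l) $ (i, j))) = P i * P j) \<and>
                   E P (\<lambda>l. \<iota> (cou H (bas H l))) = 1"

lemmas sw_defs = sw3_def sw4_def sw5_def sw6_def

definition klin :: "('k::field, 'h::ring_1, 'n::finite) hopf \<Rightarrow> ('h \<Rightarrow> 'k) \<Rightarrow> bool" where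
  "klin H f \<longleftrightarrow> (\<forall>x y. f (x + y) = f x + f y) \<and> (\<forall>c x. f (scl H c x) = c * f x)"

locale cocommutative_hopf =
  fixes H :: "('k::field, 'h::ring_1, 'n::finite) hopf"
  assumes hopf: "fd_hopf_algebra H" and cocomm: "cocommutative H"
begin

abbreviation "b \<equiv> bas H"

sublocale fdvs: finite_dimensional_vector_space "scl H" "range (bas H)"
  using hopf by (simp add: fd_hopf_algebra_def)

lemma inj_bas: "inj (bas H)"
  using hopf by (simp add: fd_hopf_algebra_def)

lemma scl_mult: "scl H c x * y = scl H c (x * y)" "x * scl H c y = scl H c (x * y)"
  using hopf unfolding fd_hopf_algebra_def by metis+

lemma dbas_bas: "dbas H i (b j) = (if i = j then 1 else 0)"
  using fdvs.representation_basis[OF fdvs.independent_Basis, of "b j"] inj_bas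
  by (simp add: dbas_def fun_eq_iff inj_eq)

lemma klin_dbas [simp]: "klin H (dbas H i)"
  using fdvs.representation_add[OF fdvs.independent_Basis] fdvs.representation_scale[OF fdvs.independent_Basis]
  by (simp add: klin_def dbas_def fdvs.span_Basis)

lemma klin_sum: "klin H f \<Longrightarrow> f (\<Sum>i\<in>A. g i) = (\<Sum>i\<in>A. f (g i))"
proof -
  assume f: "klin H f"
  then have "f 0 = 0" using fdvs.scale_zero_left[of 0] by (metis klin_def mult_zero_left)
  with f show ?thesis by (induction A rule: infinite_finite_induct) (auto simp: klin_def)
qed

lemma klin_scl: "klin H f \<Longrightarrow> f (scl H c x) = c * f x"
  by (simp add: klin_def)

lemma expand: "x = (\<Sum>i\<in>UNIV. scl H (dbas H i x) (b i))"
proof -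
  have "(\<Sum>v\<in>range b. scl H (fdvs.representation (range b) x v) v) = x"
    by (rule fdvs.sum_representation_eq) (auto simp: fdvs.independent_Basis fdvs.span_Basis)
  then show ?thesis by (simp add: sum.reindex[OF inj_bas] dbas_def)
qed

lemma klin_expand: "klin H f \<Longrightarrow> f x = (\<Sum>i\<in>UNIV. dbas H i x * f (b i))"
proof -
  assume f: "klin H f"
  have "f x = f (\<Sum>i\<in>UNIV. scl H (dbas H i x) (b i))"
    by (rule arg_cong[OF expand])
  also have "\<dots> = (\<Sum>i\<in>UNIV. dbas H i x * f (b i))"
    using f by (simp only: klin_sum klin_scl)
  finally show ?thesis .
qed

lemma klin_eqI: "klin H f \<Longrightarrow> klin H g \<Longrightarrow> (\<And>i. f (b i) = g (b i)) \<Longrightarrow> f = g"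
proof
  fix x
  assume f: "klin H f" "klin H g" and eq: "\<And>i. f (b i) = g (b i)"
  show "f x = g x"
    unfolding klin_expand[OF f(1), of x] klin_expand[OF f(2), of x] eq ..
qed

lemma eq_if_dbas: "(\<And>l. dbas H l x = dbas H l y) \<Longrightarrow> x = y"
proof -
  assume "\<And>l. dbas H l x = dbas H l y"
  then have "(\<Sum>i\<in>UNIV. scl H (dbas H i x) (b i)) = (\<Sum>i\<in>UNIV. scl H (dbas H i y) (b i))" by simp
  then show ?thesis unfolding expand[symmetric] .
qed

lemma comul_add: "comul H (x + y) = comul H x + comul H y"
  and comul_scl: "comul H (scl H c x) = c *s comul H x"
  using hopf unfolding fd_hopf_algebra_def Vector_Spaces.linear_def module_hom_def module_hom_axioms_def by auto

lemma klin_cou [simp]: "klin H (cou H)"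
  using hopf unfolding fd_hopf_algebra_def Vector_Spaces.linear_def module_hom_def module_hom_axioms_def klin_def by auto

lemma anti_add: "anti H (x + y) = anti H x + anti H y"
  and anti_scl: "anti H (scl H c x) = scl H c (anti H x)"
  using hopf unfolding fd_hopf_algebra_def Vector_Spaces.linear_def module_hom_def module_hom_axioms_def by auto

lemma klin_sw2: "klin H (\<lambda>x. sw2 H (*) x B)"
  by (simp add: klin_def sw2_def comul_add comul_scl algebra_simps sum.distrib sum_distrib_left)

lemma klin_dmul [simp]: "klin H (dmul H f g)"
  unfolding dmul_def[abs_def] by (rule klin_sw2)

lemma klin_mult: "klin H f \<Longrightarrow> klin H (\<lambda>x. f (x * y))" "klin H f \<Longrightarrow> klin H (\<lambda>x. f (y * x))"
  "klin H f \<Longrightarrow> klin H (\<lambda>x. f (y * x * z))"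
  by (simp_all add: klin_def algebra_simps scl_mult)

lemma klin_anti: "klin H f \<Longrightarrow> klin H (\<lambda>x. f (anti H x))"
  by (simp add: klin_def anti_add anti_scl)

lemma klin_cmult: "klin H f \<Longrightarrow> klin H (\<lambda>x. c * f x)" "klin H f \<Longrightarrow> klin H (\<lambda>x. f x * c)"
  by (simp_all add: klin_def algebra_simps)

lemma sw2_sum: "sw2 H (*) x (\<lambda>p q. \<Sum>i\<in>A. B p q i) = (\<Sum>i\<in>A. sw2 H (*) x (\<lambda>p q. B p q i :: 'k))"
  unfolding sw2_def sum_distrib_left
  by (subst sum.swap[of _ A], subst sum.swap[of _ A]) simp

lemma sw2_cmult: "sw2 H (*) x (\<lambda>p q. c * B p q) = c * sw2 H (*) x (\<lambda>p q. B p q :: 'k)"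
  "sw2 H (*) x (\<lambda>p q. B p q * c) = sw2 H (*) x (\<lambda>p q. B p q :: 'k) * c"
  unfolding sw2_def sum_distrib_left sum_distrib_right by (simp_all add: ac_simps)

lemma comul_sw2: "comul H x $ (i, j) = sw2 H (*) x (\<lambda>p q. dbas H i p * dbas H j q)"
proof -
  have *: "comul H x $ (p, q) * (dbas H i (b p) * dbas H j (b q)) =
      (if j = q then if i = p then comul H x $ (p, q) else 0 else 0)" for p q by (simp add: dbas_bas)
  show ?thesis unfolding sw2_def * by simp
qed

lemma klin_sw2_arg: "(\<And>p q. klin H (\<lambda>x. f x p q)) \<Longrightarrow> klin H (\<lambda>x. sw2 H (*) h (\<lambda>p q. f x p q))"
  by (simp add: klin_def sw2_def algebra_simps sum.distrib sum_distrib_left)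

lemma comul_mult: "comul H (x * y) $ (i, j) =
   sw2 H (*) x (\<lambda>a c. sw2 H (*) y (\<lambda>d e. dbas H i (a * d) * dbas H j (c * e)))"
proof -
  have "comul H (x * y) = sw2 H (*s) x (\<lambda>a b. sw2 H (*s) y (\<lambda>c d. tens2 H (a * c) (b * d)))"
    using hopf by (simp add: fd_hopf_algebra_def)
  then show ?thesis by (simp add: sw2_def tens2_def)
qed

lemma comul_one: "comul H 1 $ (i, j) = dbas H i 1 * dbas H j 1"
  using hopf by (simp add: fd_hopf_algebra_def tens2_def)

lemma bilinear_expand:
  assumes "\<And>y. klin H (\<lambda>x. f x y)" "\<And>x. klin H (\<lambda>y. f x y)"
  shows "f x y = (\<Sum>i\<in>UNIV. \<Sum>j\<in>UNIV. dbas H i x * dbas H j y * f (b i) (b j))"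
  unfolding klin_expand[OF assms(1), of x y] sum_distrib_left
  by (intro sum.cong refl) (simp only: klin_expand[OF assms(2), of _ y] sum_distrib_left mult.assoc)

lemma sw2_mult:
  assumes B: "\<And>y. klin H (\<lambda>x. B x y)" "\<And>x. klin H (\<lambda>y. B x y)"
  shows "sw2 H (*) (x * y) B = sw2 H (*) x (\<lambda>a c. sw2 H (*) y (\<lambda>d e. B (a * d) (c * e)))"
proof -
  have "sw2 H (*) (x * y) B = (\<Sum>i\<in>UNIV. \<Sum>j\<in>UNIV. sw2 H (*) x (\<lambda>a c. sw2 H (*) y (\<lambda>d e. dbas H i (a * d) * dbas H j (c * e) * B (b i) (b j))))"
    by (simp add: sw2_def[of _ _ "x * y"] comul_mult sw2_cmult)
  also have "\<dots> = sw2 H (*) x (\<lambda>a c. sw2 H (*) y (\<lambda>d e. \<Sum>i\<in>UNIV. \<Sum>j\<in>UNIV. dbas H i (a * d) * dbas H j (c * e) * B (b i) (b j)))"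
    by (simp add: sw2_sum)
  finally show ?thesis by (simp add: bilinear_expand[of B, OF B, symmetric])
qed

lemma sw2_one:
  assumes B: "\<And>y. klin H (\<lambda>x. B x y)" "\<And>x. klin H (\<lambda>y. B x y)"
  shows "sw2 H (*) 1 B = B 1 1"
  by (simp add: sw2_def comul_one bilinear_expand[of B, OF B, symmetric])

lemma counit_mult: "cou H (x * y) = cou H x * cou H y" and counit_one [simp]: "cou H 1 = 1"
  using hopf by (simp_all add: fd_hopf_algebra_def)

lemma klin_sw2_scl: "klin H f \<Longrightarrow> f (sw2 H (scl H) x B) = sw2 H (*) x (\<lambda>p q. f (B p q))"
  by (simp add: sw2_def klin_sum[of f] klin_scl[of f])

lemma antipode:
  assumes "klin H f"
  shows "sw2 H (*) x (\<lambda>p q. f (anti H p * q)) = cou H x * f 1"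
    "sw2 H (*) x (\<lambda>p q. f (p * anti H q)) = cou H x * f 1"
  using hopf by (simp_all add: klin_sw2_scl[OF assms, symmetric] fd_hopf_algebra_def klin_scl[OF assms])

lemma counit:
  assumes "klin H f"
  shows "sw2 H (*) x (\<lambda>p q. cou H p * f q) = f x" "sw2 H (*) x (\<lambda>p q. cou H q * f p) = f x"
  using hopf klin_sw2_scl[OF assms, symmetric]
  by (simp_all add: klin_scl[OF assms, symmetric] fd_hopf_algebra_def)

end

locale points = cocommutative_hopf H for H :: "('k::field, 'h::ring_1, 'n::finite) hopf" +
  fixes \<iota> :: "'k \<Rightarrow> 'r::comm_ring_1"
  assumes \<iota>_add: "\<iota> (x + y) = \<iota> x + \<iota> y" and \<iota>_mult: "\<iota> (x * y) = \<iota> x * \<iota> y" and \<iota>_one: "\<iota> 1 = 1"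
begin

abbreviation "P \<equiv> pt H \<iota>"

text \<open>
  The action of \<open>k\<close> on \<open>R\<close>, with which Sweedler sums take values in \<open>R\<close>.
\<close>

definition sr :: "'k \<Rightarrow> 'r \<Rightarrow> 'r" where "sr c r = \<iota> c * r"

lemma \<iota>_zero: "\<iota> 0 = 0"
  using \<iota>_add[of 0 0] by simp

lemma \<iota>_sum: "\<iota> (\<Sum>i\<in>A. f i) = (\<Sum>i\<in>A. \<iota> (f i))"
  by (induction A rule: infinite_finite_induct) (simp_all add: \<iota>_zero \<iota>_add)

definition crd :: "'h \<Rightarrow> 'n \<Rightarrow> 'r" where "crd x = (\<lambda>i. \<iota> (dbas H i x))"

text \<open>
  The \<open>R\<close>-multilinear extensions of forms on \<open>H\<close> to \<open>H \<otimes> R\<close>.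
\<close>

definition ext1 :: "('h \<Rightarrow> 'k) \<Rightarrow> ('n \<Rightarrow> 'r) \<Rightarrow> 'r" where
  "ext1 f X = E X (\<lambda>i. \<iota> (f (b i)))"

definition ext2 :: "('h \<Rightarrow> 'h \<Rightarrow> 'k) \<Rightarrow> ('n \<Rightarrow> 'r) \<Rightarrow> ('n \<Rightarrow> 'r) \<Rightarrow> 'r" where
  "ext2 f X Y = E X (\<lambda>i. E Y (\<lambda>j. \<iota> (f (b i) (b j))))"

definition ext3 :: "('h \<Rightarrow> 'h \<Rightarrow> 'h \<Rightarrow> 'k) \<Rightarrow> ('n \<Rightarrow> 'r) \<Rightarrow> ('n \<Rightarrow> 'r) \<Rightarrow> ('n \<Rightarrow> 'r) \<Rightarrow> 'r" where
  "ext3 f X Y Z = E X (\<lambda>i. E Y (\<lambda>j. E Z (\<lambda>l. \<iota> (f (b i) (b j) (b l)))))"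

lemma E_crd: "E (crd x) F = (\<Sum>i\<in>UNIV. \<iota> (dbas H i x) * F i)"
  by (simp add: E_def crd_def)

lemma ext1_crd: "klin H f \<Longrightarrow> \<iota> (f x) = ext1 f (crd x)"
proof -
  assume f: "klin H f"
  show ?thesis unfolding ext1_def E_crd klin_expand[OF f, of x] \<iota>_sum \<iota>_mult ..
qed

lemma ext2_crd:
  assumes "\<And>y. klin H (\<lambda>x. f x y)" "\<And>x. klin H (\<lambda>y. f x y)"
  shows "\<iota> (f x y) = ext2 f (crd x) (crd y)"
proof -
  have "\<iota> (f x y) = E (crd x) (\<lambda>i. \<iota> (f (b i) y))"
    by (rule ext1_crd[OF assms(1), unfolded ext1_def])
  also have "\<dots> = ext2 f (crd x) (crd y)"
    unfolding ext2_def by (rule arg_cong[where f = "E (crd x)"], rule ext, rule ext1_crd[OF assms(2), unfolded ext1_def])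
  finally show ?thesis .
qed

lemma ext3_crd:
  assumes "\<And>y z. klin H (\<lambda>x. f x y z)" "\<And>x z. klin H (\<lambda>y. f x y z)" "\<And>x y. klin H (\<lambda>z. f x y z)"
  shows "\<iota> (f x y z) = ext3 f (crd x) (crd y) (crd z)"
proof -
  have "\<iota> (f x y z) = E (crd x) (\<lambda>i. \<iota> (f (b i) y z))"
    by (rule ext1_crd[OF assms(1), unfolded ext1_def])
  also have "\<dots> = ext3 f (crd x) (crd y) (crd z)"
    unfolding ext3_def by (rule arg_cong[where f = "E (crd x)"], rule ext, rule ext2_crd[OF assms(2,3), unfolded ext2_def])
  finally show ?thesis .
qed

lemma E_ext1: "E X (\<lambda>i. ext1 f (F i)) = ext1 f (EV X F)"
  by (simp add: ext1_def E_EV)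

lemma E_ext2:
  "E X (\<lambda>i. ext2 f (F i) T) = ext2 f (EV X F) T"
  "E X (\<lambda>i. ext2 f T (F i)) = ext2 f T (EV X F)"
   apply (simp add: ext2_def E_EV)
  apply (simp add: ext2_def E_EV)
  apply (subst E_swap) apply (simp add: E_EV)
  done

lemma E_ext3:
  "E X (\<lambda>i. ext3 f (F i) T U) = ext3 f (EV X F) T U"
  "E X (\<lambda>i. ext3 f T (F i) U) = ext3 f T (EV X F) U"
  "E X (\<lambda>i. ext3 f T U (F i)) = ext3 f T U (EV X F)"
    apply (simp add: ext3_def E_EV)
   apply (simp add: ext3_def E_EV)
   apply (subst E_swap) apply (simp add: E_EV)
  apply (simp add: ext3_def E_EV)
  apply (subst E_swap) apply (subst E_swap[of X]) apply (simp add: E_EV)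
  done

text \<open>
  Product, antipode, unit and the action \<open>\<triangleleft>\<close> of \<open>H \<otimes> R\<close> in coordinates.
\<close>

definition pmul :: "('n \<Rightarrow> 'r) \<Rightarrow> ('n \<Rightarrow> 'r) \<Rightarrow> 'n \<Rightarrow> 'r" (infixl "\<odot>" 70) where
  "pmul X Y = (\<lambda>l. ext2 (\<lambda>x y. dbas H l (x * y)) X Y)"

definition pinv :: "('n \<Rightarrow> 'r) \<Rightarrow> 'n \<Rightarrow> 'r" where
  "pinv X = (\<lambda>l. ext1 (\<lambda>x. dbas H l (anti H x)) X)"

definition pone :: "'n \<Rightarrow> 'r" where "pone = crd 1"

definition hc :: "('n \<Rightarrow> 'r) \<Rightarrow> ('n \<Rightarrow> 'r) \<Rightarrow> 'n \<Rightarrow> 'r" where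
  "hc X Y = (\<lambda>l. ext2 (\<lambda>x y. dbas H l (hact H x y)) X Y)"

lemma EV_apply: "EV X F l = E X (\<lambda>i. F i l)"
  by (simp add: EV_def)

lemma EV_pmul: "EV X (\<lambda>i. pmul (F i) T) = pmul (EV X F) T" "EV X (\<lambda>i. pmul T (F i)) = pmul T (EV X F)"
  by (simp_all add: pmul_def fun_eq_iff EV_apply E_ext2)

lemma EV_hc: "EV X (\<lambda>i. hc (F i) T) = hc (EV X F) T" "EV X (\<lambda>i. hc T (F i)) = hc T (EV X F)"
  by (simp_all add: hc_def fun_eq_iff EV_apply E_ext2)

lemma EV_pinv: "EV X (\<lambda>i. pinv (F i)) = pinv (EV X F)"
  by (simp add: pinv_def fun_eq_iff EV_apply E_ext1)

lemma EV_crd: "EV X (\<lambda>i. crd (b i)) = X"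
proof
  fix j
  have "X i * \<iota> (if j = i then 1 else 0) = (if j = i then X i else 0)" for i
    by (simp add: \<iota>_one \<iota>_zero)
  then show "EV X (\<lambda>i. crd (b i)) j = X j"
    by (simp add: EV_def E_def crd_def dbas_bas)
qed

lemma ext1_dbas: "ext1 (dbas H l) X = X l"
  using EV_crd[of X] by (simp add: ext1_def EV_def crd_def fun_eq_iff)

lemma klin_hact: "klin H f \<Longrightarrow> klin H (\<lambda>x. f (hact H x y))" "klin H f \<Longrightarrow> klin H (\<lambda>y. f (hact H x y))"
  unfolding hact_def
  by (simp_all add: klin_sw2_scl[of f] klin_sw2 klin_sw2_arg klin_mult)

lemma crd_mult: "crd (x * y) = crd x \<odot> crd y"
  using ext2_crd[of "\<lambda>x y. dbas H l (x * y)" for l] by (simp add: crd_def pmul_def klin_mult fun_eq_iff)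

lemma crd_anti: "crd (anti H x) = pinv (crd x)"
  using ext1_crd[of "\<lambda>x. dbas H l (anti H x)" for l] by (simp add: crd_def pinv_def klin_anti fun_eq_iff)

lemma crd_hact: "crd (hact H x y) = hc (crd x) (crd y)"
  using ext2_crd[of "\<lambda>x y. dbas H l (hact H x y)" for l] by (simp add: crd_def hc_def klin_hact fun_eq_iff)

lemma crd_one: "crd 1 = pone"
  by (simp add: pone_def)

lemma ext1_pone: "klin H f \<Longrightarrow> ext1 f pone = \<iota> (f 1)"
  using ext1_crd[of f 1] by (simp add: pone_def)

subsection \<open>Sweedler sums at points\<close>

lemma \<iota>_sw2: "\<iota> (sw2 H (*) x B) = sw2 H sr x (\<lambda>p q. \<iota> (B p q))"
  by (simp add: sw2_def \<iota>_sum \<iota>_mult sr_def)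

lemma \<iota>_sw3: "\<iota> (sw3 H (*) x B) = sw3 H sr x (\<lambda>p q r. \<iota> (B p q r))"
  by (simp add: sw3_def \<iota>_sw2)


lemma sw2_comm: "E Y (\<lambda>i. sw2 H sr x (\<lambda>p q. F i p q)) = sw2 H sr x (\<lambda>p q. E Y (\<lambda>i. F i p q))"
  unfolding sw2_def sr_def E_sum E_mult_left ..

lemma sw3_comm: "E Y (\<lambda>i. sw3 H sr x (\<lambda>p q r. F i p q r)) = sw3 H sr x (\<lambda>p q r. E Y (\<lambda>i. F i p q r))"
  unfolding sw3_def sw2_comm ..

text \<open>
  A point is grouplike, so its Sweedler components are copies of it.
\<close>

lemma E_sw2:
  assumes "P X"
  shows "E X (\<lambda>i. sw2 H sr (b i) (\<lambda>p q. F p q)) = E X (\<lambda>i. E X (\<lambda>j. F (b i) (b j)))"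
proof -
  have *: "E X (\<lambda>l. \<iota> (comul H (b l) $ (i, j))) = X i * X j" for i j
    using assms by (simp add: pt_def)
  have "E X (\<lambda>i. sw2 H sr (b i) F) = (\<Sum>i\<in>UNIV. \<Sum>j\<in>UNIV. E X (\<lambda>l. \<iota> (comul H (b l) $ (i, j))) * F (b i) (b j))"
    by (simp add: sw2_def sr_def E_sum E_mult_right)
  then show ?thesis unfolding * by (simp add: E_def sum_distrib_left mult.assoc)
qed

lemma ext1_cou [simp]: "P X \<Longrightarrow> ext1 (cou H) X = 1"
  by (simp add: ext1_def pt_def)

lemma \<iota>_dbas: "\<iota> (dbas H l x) = ext1 (dbas H l) (crd x)"
  by (simp add: ext1_crd)

lemma \<iota>_cou: "\<iota> (cou H x) = ext1 (cou H) (crd x)"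
  by (simp add: ext1_crd)

text \<open>
  Rewriting with these rules evaluates a Sweedler expression at points: the Sweedler sums become evaluations
  at separate copies of the points, the factors of a product are separated, and each evaluation moves into
  the argument that contains its variable until it meets the variable itself (\<open>EV_crd\<close>).
\<close>

lemmas calc = sw_defs \<iota>_sw2 \<iota>_mult sw2_comm E_sw2 E_mult_left E_mult_right E_ext1 E_ext2 E_ext3
  EV_pmul EV_hc EV_pinv EV_crd crd_mult crd_anti crd_hact crd_one \<iota>_dbas \<iota>_cou

lemma ext1_dmul: "P X \<Longrightarrow> ext1 (dmul H f g) X = ext1 f X * ext1 g X"
  by (simp add: ext1_def dmul_def calc)

subsection \<open>The group of points\<close>

lemma pmul_assoc: "(X \<odot> Y) \<odot> Z = X \<odot> (Y \<odot> Z)"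
proof -
  have "EV X (\<lambda>x. EV Y (\<lambda>y. EV Z (\<lambda>z. crd (b x * b y * b z)))) =
        EV X (\<lambda>x. EV Y (\<lambda>y. EV Z (\<lambda>z. crd (b x * (b y * b z)))))"
    by (simp only: mult.assoc)
  then show ?thesis by (simp add: calc)
qed

lemma pmul_one: "X \<odot> pone = X" "pone \<odot> X = X"
proof -
  have "EV X (\<lambda>x. crd (b x * 1)) = EV X (\<lambda>x. crd (b x))" "EV X (\<lambda>x. crd (1 * b x)) = EV X (\<lambda>x. crd (b x))"
    by simp_all
  then show "X \<odot> pone = X" "pone \<odot> X = X" by (simp_all add: calc del: mult_1 mult_1_right)
qed

lemma ext1_pinv_eq: "klin H f \<Longrightarrow> ext1 (\<lambda>x. f (anti H x)) X = ext1 f (pinv X)"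
  by (simp add: ext1_def[of "\<lambda>x. f (anti H x)"] ext1_crd calc)

lemma pinv_left: assumes "P X" shows "pinv X \<odot> X = pone"
proof
  fix l
  have "E X (\<lambda>i. \<iota> (sw2 H (*) (b i) (\<lambda>p q. dbas H l (anti H p * q)))) = E X (\<lambda>i. \<iota> (cou H (b i) * dbas H l 1))"
    by (simp add: antipode)
  then show "(pinv X \<odot> X) l = pone l" using assms by (simp add: calc) (simp add: ext1_dbas)
qed

lemma pinv_right: assumes "P X" shows "X \<odot> pinv X = pone"
proof
  fix l
  have "E X (\<lambda>i. \<iota> (sw2 H (*) (b i) (\<lambda>p q. dbas H l (p * anti H q)))) = E X (\<lambda>i. \<iota> (cou H (b i) * dbas H l 1))"
    by (simp add: antipode)
  then show "(X \<odot> pinv X) l = pone l" using assms by (simp add: calc) (simp add: ext1_dbas)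
qed

lemma klin_comul: "klin H (\<lambda>x. comul H x $ (i, j))"
  by (simp add: klin_def comul_add comul_scl)

lemma ptI: "(\<And>i j. ext1 (\<lambda>x. comul H x $ (i, j)) X = X i * X j) \<Longrightarrow> ext1 (cou H) X = 1 \<Longrightarrow> P X"
  by (simp add: pt_def ext1_def)

lemma pt_one [simp]: "P pone"
  by (rule ptI) (simp_all add: ext1_pone klin_comul comul_one \<iota>_mult \<iota>_one, simp add: pone_def crd_def)

lemma ext1_pmul: "klin H f \<Longrightarrow> ext1 f (X \<odot> Y) = E X (\<lambda>i. E Y (\<lambda>j. \<iota> (f (b i * b j))))"
  by (simp add: ext1_crd calc)

lemma pt_mul [simp]: assumes "P X" "P Y" shows "P (X \<odot> Y)"
proof (rule ptI)
  show "ext1 (\<lambda>x. comul H x $ (i, j)) (X \<odot> Y) = (X \<odot> Y) i * (X \<odot> Y) j" for i j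
    using assms by (simp add: ext1_pmul[OF klin_comul] comul_mult) (simp add: calc, simp add: ext1_dbas)
  show "ext1 (cou H) (X \<odot> Y) = 1"
    using assms by (simp add: ext1_pmul[OF klin_cou] counit_mult) (simp add: calc)
qed

text \<open>
  The inverse \<open>Q\<close> of a point \<open>X\<close> is grouplike since \<open>\<Delta>(Q)\<close> and \<open>Q \<otimes> Q\<close> are both inverse to \<open>X \<otimes> X = \<Delta>(X)\<close>:
  insert \<open>(X \<otimes> X)(Q \<otimes> Q) = 1\<close> behind \<open>\<Delta>(Q)\<close> and use \<open>\<Delta>(Q)\<Delta>(X) = \<Delta>(1)\<close>.
\<close>

lemma pt_inv [simp]: assumes X: "P X" shows "P (pinv X)"
proof (rule ptI)
  let ?Q = "pinv X"
  have "ext1 (cou H) (pinv X \<odot> X) = ext1 (cou H) (pinv X)"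
    using X by (simp add: ext1_pmul[OF klin_cou] counit_mult) (simp add: calc)
  then show "ext1 (cou H) ?Q = 1" using X by (simp add: pinv_left)
  fix i j
  let ?B = "\<lambda>x y q q'. \<iota> (sw2 H (*) (b x) (\<lambda>c d. sw2 H (*) (b y) (\<lambda>c' d'. dbas H i (c * c' * q) * dbas H j (d * d' * q'))))"
  have 1: "klin H (\<lambda>z. sw2 H (*) z (\<lambda>c d. dbas H i (c * q) * dbas H j (d * q')))" for q q'
    by (rule klin_sw2)
  have 2: "sw2 H (*) (x * y) (\<lambda>c d. dbas H i (c * q) * dbas H j (d * q')) =
      sw2 H (*) x (\<lambda>c d. sw2 H (*) y (\<lambda>c' d'. dbas H i (c * c' * q) * dbas H j (d * d' * q')))" for x y q q'
    by (rule sw2_mult) (simp_all add: klin_mult klin_cmult)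
  have 3: "sw2 H (*) 1 (\<lambda>c d. dbas H i (c * q) * dbas H j (d * q')) = dbas H i q * dbas H j q'" for q q'
    by (subst sw2_one) (simp_all add: klin_mult klin_cmult)
  have 4: "E ?Q (\<lambda>x. E X (\<lambda>y. ?B x y q q')) =
    \<iota> (dbas H i q) * \<iota> (dbas H j q')" for q q'
    using ext1_pmul[OF 1, of q q' ?Q X] X by (simp add: pinv_left ext1_pone 1 2 3 \<iota>_mult)
  have "ext1 (\<lambda>x. comul H x $ (i, j)) ?Q = E ?Q (\<lambda>x. \<iota> (sw2 H (*) (b x) (\<lambda>c d. dbas H i c * dbas H j d)))"
    by (simp add: ext1_def comul_sw2)
  \<comment> \<open>the factor \<open>(X \<otimes> X)(Q \<otimes> Q)\<close> is inserted\<close>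
  also have "\<dots> = E ?Q (\<lambda>x. E ?Q (\<lambda>q. E ?Q (\<lambda>q'. E X (\<lambda>y. ?B x y (b q) (b q')))))"
    using X by (simp add: calc pmul_assoc pinv_right pmul_one)
  also have "\<dots> = E ?Q (\<lambda>q. E ?Q (\<lambda>q'. E ?Q (\<lambda>x. E X (\<lambda>y. ?B x y (b q) (b q')))))"
    by (subst E_swap, rule arg_cong[where f = "E ?Q"], rule ext, rule E_swap)
  also have "\<dots> = ?Q i * ?Q j"
    unfolding 4 by (simp add: calc) (simp add: ext1_dbas)
  finally show "ext1 (\<lambda>x. comul H x $ (i, j)) ?Q = ?Q i * ?Q j" .
qed

lemma hc_pt: assumes "P X" shows "hc G X = pinv X \<odot> G \<odot> X"
proof
  fix l
  have "hc G X l = E G (\<lambda>i. E X (\<lambda>j. \<iota> (sw2 H (*) (b j) (\<lambda>p q. dbas H l (anti H p * b i * q)))))"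
    by (simp add: hc_def ext2_def hact_def klin_sw2_scl)
  also have "\<dots> = (pinv X \<odot> G \<odot> X) l"
    using assms by (simp add: calc) (simp add: ext1_dbas)
  finally show "hc G X l = (pinv X \<odot> G \<odot> X) l" .
qed

end

section \<open>Generic points\<close>

text \<open>
  A generic point of \<open>H\<close> lives in the convolution algebra \<open>Hom(H, R)\<close>, whose product depends on \<open>H\<close>.  To have
  a type of class \<^class>\<open>comm_ring_1\<close>, which cannot depend on a term, take the product of these algebras over all
  cocommutative coalgebra structures with a given finite basis.  Here \<open>c i j l\<close> is the
  coefficient of \<open>e\<^sub>j \<otimes> e\<^sub>l\<close> in \<open>\<Delta>(e\<^sub>i)\<close> and \<open>e i\<close> is \<open>\<epsilon>(e\<^sub>i)\<close>.
\<close>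

typedef (overloaded) ('r::comm_ring_1, 'n::finite) coalg =
  "{(c :: 'n \<Rightarrow> 'n \<Rightarrow> 'n \<Rightarrow> 'r, e :: 'n \<Rightarrow> 'r).
     (\<forall>i j l m. (\<Sum>p\<in>UNIV. c i p m * c p j l) = (\<Sum>p\<in>UNIV. c i j p * c p l m)) \<and>
     (\<forall>i j l. c i j l = c i l j) \<and>
     (\<forall>i j. (\<Sum>p\<in>UNIV. e p * c i p j) = (if i = j then 1 else 0))}"
  morphisms rep_coalg abs_coalg
proof -
  let ?c = "\<lambda>i j l :: 'n. if i = j then if i = l then 1 else 0 else (0::'r)"
  have 1: "?c i p m * ?c p j l = (if i = p then if i = m then ?c i j l else 0 else 0)"
    "?c i j p * ?c p l m = (if i = p then if i = j then ?c i l m else 0 else 0)"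
    "1 * ?c i p j = (if i = p then if i = j then 1 else 0 else 0)" for i j l m p
    by simp_all
  have "(\<Sum>p\<in>UNIV. ?c i p m * ?c p j l) = (\<Sum>p\<in>UNIV. ?c i j p * ?c p l m)"
    "(\<Sum>p\<in>UNIV. 1 * ?c i p j) = (if i = j then 1 else 0)" for i j l m
    unfolding 1 by simp_all
  then show ?thesis
    by (intro exI[of _ "(?c, \<lambda>_. 1)"]) simp
qed

definition cc :: "('r::comm_ring_1, 'n::finite) coalg \<Rightarrow> 'n \<Rightarrow> 'n \<Rightarrow> 'n \<Rightarrow> 'r" where
  "cc s = fst (rep_coalg s)"

definition ce :: "('r::comm_ring_1, 'n::finite) coalg \<Rightarrow> 'n \<Rightarrow> 'r" where
  "ce s = snd (rep_coalg s)"

lemma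
  shows coalg_assoc: "(\<Sum>p\<in>UNIV. cc s i p m * cc s p j l) = (\<Sum>p\<in>UNIV. cc s i j p * cc s p l m)"
    and coalg_comm: "cc s i j l = cc s i l j"
    and coalg_counit: "(\<Sum>p\<in>UNIV. ce s p * cc s i p j) = (if i = j then 1 else 0)"
proof -
  obtain c e where s: "rep_coalg s = (c, e)" by fastforce
  show "(\<Sum>p\<in>UNIV. cc s i p m * cc s p j l) = (\<Sum>p\<in>UNIV. cc s i j p * cc s p l m)"
    "cc s i j l = cc s i l j" "(\<Sum>p\<in>UNIV. ce s p * cc s i p j) = (if i = j then 1 else 0)"
    using rep_coalg[of s] unfolding cc_def ce_def s mem_Collect_eq case_prod_conv fst_conv snd_conv
    by blast+
qed

typedef (overloaded) ('r::comm_ring_1, 'n::finite) conv = "UNIV :: (('r, 'n) coalg \<Rightarrow> 'n \<Rightarrow> 'r) set"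
  morphisms cval Conv ..

lemma cval_Conv [simp]: "cval (Conv f) = f"
  by (simp add: Conv_inverse)

lemma conv_eqI: "(\<And>s i. cval F s i = cval G s i) \<Longrightarrow> F = G"
  by (metis cval_inject ext)

instantiation conv :: (comm_ring_1, finite) comm_ring_1
begin

definition zero_conv_def: "0 = Conv (\<lambda>s i. 0)"
definition one_conv_def: "1 = Conv ce"
definition plus_conv_def: "F + G = Conv (\<lambda>s i. cval F s i + cval G s i)"
definition minus_conv_def: "F - G = Conv (\<lambda>s i. cval F s i - cval G s i)"
definition uminus_conv_def: "- F = Conv (\<lambda>s i. - cval F s i)"
definition times_conv_def: "F * G = Conv (\<lambda>s. sc_mul (\<lambda>j l i. cc s i j l) (cval F s) (cval G s))"

lemma cval_times: "cval (F * G) s i = (\<Sum>j\<in>UNIV. \<Sum>l\<in>UNIV. cc s i j l * (cval F s j * cval G s l))"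
  by (simp add: times_conv_def sc_mul_apply E_def sum_distrib_left ac_simps)

instance
proof
  fix F G K :: "('a, 'b) conv"
  have "sc_assoc (\<lambda>j l i. cc s i j l)" for s :: "('a, 'b) coalg"
    unfolding sc_assoc_def E_def using coalg_assoc[of s] by (simp add: mult.commute)
  then show "F * G * K = F * (G * K)"
    by (simp add: times_conv_def sc_mul_assoc)
  have "cval (F * G) s i = cval (G * F) s i" for s i
    unfolding times_conv_def cval_Conv sc_mul_apply by (subst E_swap) (simp add: coalg_comm[of s i])
  then show "F * G = G * F" by (rule conv_eqI)
  have "sc_unit (\<lambda>j l i. cc s i j l) (ce s)" for s :: "('a, 'b) coalg"
  proof -
    have "(\<Sum>p\<in>UNIV. ce s p * cc s i p j) = of_bool (j = i)" for i j
      unfolding coalg_counit by auto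
    then show ?thesis
      unfolding sc_unit_def E_def by (metis (no_types, lifting) coalg_comm sum.cong)
  qed
  then show "1 * F = F"
    by (simp add: times_conv_def one_conv_def sc_mul_unit cval_inverse)
  show "(0::('a, 'b) conv) \<noteq> 1"
  proof
    assume "(0::('a, 'b) conv) = 1"
    then have "cval (0::('a, 'b) conv) = cval 1" by simp
    then have "ce s i = (0 :: 'a)" for s :: "('a, 'b) coalg" and i
      by (simp add: zero_conv_def one_conv_def fun_eq_iff)
    then have "(if i = i then 1 else 0) = (0::'a)" for i :: 'b
      using coalg_counit[of "undefined :: ('a, 'b) coalg" i i] by simp
    then show False by simp
  qed
  show "(F + G) * K = F * K + G * K"
    by (rule conv_eqI) (simp add: cval_times plus_conv_def algebra_simps sum.distrib)
qed (simp_all add: zero_conv_def plus_conv_def minus_conv_def uminus_conv_def cval_inject[symmetric] fun_eq_iff cval_inverse add.assoc)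

end

definition emb :: "'r::comm_ring_1 \<Rightarrow> ('r, 'n::finite) conv" where
  "emb r = Conv (\<lambda>s i. r * ce s i)"

lemma mult_emb: "cval (F * emb r) s i = cval F s i * r"
proof -
  have "F * emb r = emb r * F" by (rule mult.commute)
  also have "cval (emb r * F) s i = (\<Sum>l\<in>UNIV. \<Sum>j\<in>UNIV. cc s i j l * (r * ce s j * cval F s l))"
    by (simp add: cval_times emb_def) (rule sum.swap)
  also have "\<dots> = (\<Sum>l\<in>UNIV. (\<Sum>j\<in>UNIV. ce s j * cc s i j l) * (r * cval F s l))"
    by (simp add: sum_distrib_right sum_distrib_left ac_simps)
  also have "\<dots> = cval F s i * r"
    unfolding coalg_counit by (simp add: if_distrib if_distribR mult.commute cong: if_cong)
  finally show ?thesis .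
qed

lemma emb_add: "emb (x + y) = emb x + emb y"
  by (simp add: emb_def plus_conv_def distrib_right)

lemma emb_zero: "emb 0 = 0"
  by (simp add: emb_def zero_conv_def)

lemma emb_one: "emb 1 = 1"
  by (simp add: emb_def one_conv_def)

lemma emb_mult: "emb (x * y) = emb x * emb y"
  by (rule conv_eqI) (simp add: mult_emb, simp add: emb_def ac_simps)

lemma emb_sum: "emb (\<Sum>i\<in>A. f i) = (\<Sum>i\<in>A. emb (f i))"
  by (induction A rule: infinite_finite_induct) (simp_all add: emb_zero emb_add)

lemma emb_E: "emb (E X F) = E (\<lambda>i. emb (X i)) (\<lambda>i. emb (F i))"
  by (simp add: E_def emb_sum emb_mult)

lemma pt_emb: "pt H \<iota> X \<Longrightarrow> pt H (\<lambda>c. emb (\<iota> c)) (\<lambda>i. emb (X i))"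
  by (simp add: pt_def emb_E[symmetric] emb_mult emb_one)

lemma cval_sum: "cval (\<Sum>i\<in>A. f i) s j = (\<Sum>i\<in>A. cval (f i) s j)"
  by (induction A rule: infinite_finite_induct) (simp_all add: zero_conv_def plus_conv_def)

lemma points_emb: "points H \<iota> \<Longrightarrow> points H (\<lambda>c. emb (\<iota> c))"
  unfolding points_def points_axioms_def by (simp add: emb_add emb_mult emb_one)

context cocommutative_hopf
begin

lemma coassoc_coeff:
  "(\<Sum>p\<in>UNIV. comul H (b i) $ (p, m) * comul H (b p) $ (j, l)) =
   (\<Sum>p\<in>UNIV. comul H (b i) $ (j, p) * comul H (b p) $ (l, m))"
proof -
  have "sw2 H (*s) (b i) (\<lambda>a b. sw2 H (*s) a (\<lambda>c d. tens3 H c d b)) $ (j, l, m)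
        = sw2 H (*s) (b i) (\<lambda>a b. sw2 H (*s) b (\<lambda>c d. tens3 H a c d)) $ (j, l, m)"
    using hopf by (simp add: fd_hopf_algebra_def)
  then have "sw2 H (*) (b i) (\<lambda>p q. sw2 H (*) p (\<lambda>r s. dbas H j r * dbas H l s) * dbas H m q) =
             sw2 H (*) (b i) (\<lambda>p q. dbas H j p * sw2 H (*) q (\<lambda>r s. dbas H l r * dbas H m s))"
    by (simp add: sw2_def tens3_def sum_distrib_left sum_distrib_right ac_simps)
  then have *: "sw2 H (*) (b i) (\<lambda>p q. comul H p $ (j, l) * dbas H m q) =
             sw2 H (*) (b i) (\<lambda>p q. dbas H j p * comul H q $ (l, m))"
    unfolding comul_sw2 .
  have 1: "comul H (b i) $ (p, q) * (comul H (b p) $ (j, l) * dbas H m (b q)) =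
      (if m = q then comul H (b i) $ (p, q) * comul H (b p) $ (j, l) else 0)" for p q
    by (simp add: dbas_bas)
  have 2: "comul H (b i) $ (p, q) * (dbas H j (b p) * comul H (b q) $ (l, m)) =
      (if j = p then comul H (b i) $ (p, q) * comul H (b q) $ (l, m) else 0)" for p q
    by (simp add: dbas_bas)
  have "(\<Sum>p\<in>UNIV. \<Sum>q\<in>UNIV. if j = p then comul H (b i) $ (p, q) * comul H (b q) $ (l, m) else 0) =
        (\<Sum>q\<in>UNIV. \<Sum>p\<in>UNIV. if j = p then comul H (b i) $ (p, q) * comul H (b q) $ (l, m) else 0)"
    by (rule sum.swap)
  then show ?thesis using * unfolding sw2_def 1 2 by simp
qed

lemma counit_coeff: "(\<Sum>p\<in>UNIV. cou H (b p) * comul H (b i) $ (p, j)) = (if i = j then 1 else 0)"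
proof -
  have 1: "comul H (b i) $ (p, q) * (cou H (b p) * dbas H j (b q)) =
      (if j = q then cou H (b p) * comul H (b i) $ (p, q) else 0)" for p q
    by (simp add: dbas_bas)
  have "sw2 H (*) (b i) (\<lambda>p q. cou H p * dbas H j q) = dbas H j (b i)"
    by (rule counit) simp
  then show ?thesis unfolding sw2_def 1 by (simp add: dbas_bas eq_commute)
qed

lemma cocomm_coeff: "comul H x $ (i, j) = comul H x $ (j, i)"
  using cocomm by (simp add: cocommutative_def)

end

context points
begin

definition own_coalg :: "('r, 'n) coalg" where
  "own_coalg = abs_coalg (\<lambda>i j l. \<iota> (comul H (b i) $ (j, l)), \<lambda>i. \<iota> (cou H (b i)))"

lemma own_coalg: "cc own_coalg i j l = \<iota> (comul H (b i) $ (j, l))" "ce own_coalg i = \<iota> (cou H (b i))"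
proof -
  have "\<iota> (if i = j then 1 else 0) = (if i = j then 1 else 0)" for i j :: 'n
    by (simp add: \<iota>_one \<iota>_zero)
  then have "rep_coalg own_coalg = (\<lambda>i j l. \<iota> (comul H (b i) $ (j, l)), \<lambda>i. \<iota> (cou H (b i)))"
    unfolding own_coalg_def
    by (intro abs_coalg_inverse) (simp add: \<iota>_mult[symmetric] \<iota>_sum[symmetric] coassoc_coeff counit_coeff, simp add: cocomm_coeff)
  then show "cc own_coalg i j l = \<iota> (comul H (b i) $ (j, l))" "ce own_coalg i = \<iota> (cou H (b i))"
    by (simp_all add: cc_def ce_def)
qed

text \<open>
  In the factor belonging to \<open>H\<close> this is the identity of \<open>H\<close>, the generic point; in the other factors it
  is the unit, since a point has to be a point in each of them.
\<close>

definition generic :: "'n \<Rightarrow> ('r, 'n) conv" where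
  "generic l = Conv (\<lambda>s i. if s = own_coalg then (if i = l then 1 else 0) else \<iota> (dbas H l 1) * ce s i)"

lemma generic_own_coalg: "cval (generic l) own_coalg i = (if i = l then 1 else 0)"
  and generic_other: "s \<noteq> own_coalg \<Longrightarrow> cval (generic l) s i = \<iota> (dbas H l 1) * ce s i"
  by (simp_all add: generic_def)

lemma E_generic: "cval (E generic (\<lambda>i. emb (F i))) own_coalg j = F j"
proof -
  have "(if j = i then 1 else 0) * F i = (if j = i then F i else 0)" for i by simp
  then show ?thesis by (simp add: E_def cval_sum mult_emb generic_own_coalg)
qed

lemma pt_generic: "pt H (\<lambda>c. emb (\<iota> c)) generic"
proof -
  have s: "cval (E generic (\<lambda>i. emb (\<iota> (f (b i))))) s j = \<iota> (f 1) * ce s j"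
    if f: "klin H f" and s: "s \<noteq> own_coalg" for f s j
  proof -
    have "cval (E generic (\<lambda>i. emb (\<iota> (f (b i))))) s j = (\<Sum>i\<in>UNIV. \<iota> (dbas H i 1) * \<iota> (f (b i))) * ce s j"
      using s by (simp add: E_def cval_sum mult_emb generic_other sum_distrib_right sum_distrib_left ac_simps)
    then show ?thesis by (simp only: klin_expand[OF f, of 1] \<iota>_sum \<iota>_mult)
  qed
  have m: "cval (generic i * generic j) own_coalg k = cc own_coalg k i j" for i j k
  proof -
    have "cc own_coalg k p q * ((if p = i then 1 else 0) * (if q = j then 1 else 0)) =
      (if q = j then if p = i then cc own_coalg k p q else 0 else 0)" for p q by simp
    then show ?thesis by (simp add: cval_times generic_own_coalg)
  qed
  have g: "cval (generic i * generic j) s k = \<iota> (dbas H i 1 * dbas H j 1) * ce s k" if "s \<noteq> own_coalg" for i j s k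
  proof -
    have "cval (generic i * generic j) s k =
       (\<Sum>p\<in>UNIV. \<Sum>q\<in>UNIV. cc s k p q * (\<iota> (dbas H i 1) * ce s p * (\<iota> (dbas H j 1) * ce s q)))"
      using that by (simp add: cval_times generic_other)
    also have "\<dots> = cval (emb (\<iota> (dbas H i 1)) * emb (\<iota> (dbas H j 1))) s k"
      by (simp add: cval_times emb_def)
    finally show ?thesis by (simp add: emb_mult[symmetric] \<iota>_mult) (simp add: emb_def)
  qed
  show ?thesis unfolding pt_def
  proof (intro conjI allI conv_eqI)
    fix i j s k
    show "cval (E generic (\<lambda>l. emb (\<iota> (comul H (b l) $ (i, j))))) s k = cval (generic i * generic j) s k"
      by (cases "s = own_coalg") (simp_all add: E_generic m own_coalg s[OF klin_comul] g comul_one)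
    show "cval (E generic (\<lambda>l. emb (\<iota> (cou H (b l))))) s k = cval 1 s k"
      by (cases "s = own_coalg") (simp_all add: E_generic own_coalg s[OF klin_cou] one_conv_def \<iota>_one)
  qed
qed

text \<open>
  In the factor belonging to \<open>H\<close>, evaluation at the generic point returns the function itself.
\<close>

lemma generic_step:
  assumes "\<And>X :: 'n \<Rightarrow> ('r, 'n) conv. pt H (\<lambda>c. emb (\<iota> c)) X \<Longrightarrow> E X (\<lambda>i. emb (L1 i)) = E X (\<lambda>i. emb (L2 i))"
  shows "L1 i = L2 i"
  using assms[OF pt_generic] E_generic by metis

end

text \<open>
  Four generic points, each adjoined to the ring that contains the previous ones.
\<close>

type_synonym ('k, 'n) conv4 = "(((('k, 'n) conv, 'n) conv, 'n) conv, 'n) conv"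

definition emb4 :: "'k::comm_ring_1 \<Rightarrow> ('k, 'n::finite) conv4" where
  "emb4 c = emb (emb (emb (emb c)))"

lemma (in cocommutative_hopf) transfer4:
  fixes K1 K2 :: "'n \<Rightarrow> 'n \<Rightarrow> 'n \<Rightarrow> 'n \<Rightarrow> 'k"
  assumes "\<And>X Y Z W :: 'n \<Rightarrow> ('k, 'n) conv4. pt H emb4 X \<Longrightarrow> pt H emb4 Y \<Longrightarrow> pt H emb4 Z \<Longrightarrow> pt H emb4 W \<Longrightarrow>
    E X (\<lambda>i. E Y (\<lambda>j. E Z (\<lambda>l. E W (\<lambda>m. emb4 (K1 i j l m))))) =
    E X (\<lambda>i. E Y (\<lambda>j. E Z (\<lambda>l. E W (\<lambda>m. emb4 (K2 i j l m)))))"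
  shows "K1 i j l m = K2 i j l m"
proof -
  interpret p0: points H "\<lambda>c. c" by unfold_locales simp_all
  have P1: "points H (\<lambda>c. emb c :: ('k, 'n) conv)" by (rule points_emb[OF p0.points_axioms])
  interpret p1: points H "\<lambda>c. emb c :: ('k, 'n) conv" by (rule P1)
  have P2: "points H (\<lambda>c. emb (emb c) :: (('k, 'n) conv, 'n) conv)" by (rule points_emb[OF P1])
  interpret p2: points H "\<lambda>c. emb (emb c) :: (('k, 'n) conv, 'n) conv" by (rule P2)
  have P3: "points H (\<lambda>c. emb (emb (emb c)) :: ((('k, 'n) conv, 'n) conv, 'n) conv)" by (rule points_emb[OF P2])
  interpret p3: points H "\<lambda>c. emb (emb (emb c)) :: ((('k, 'n) conv, 'n) conv, 'n) conv" by (rule P3)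
  let ?W = "\<lambda>K W i j l. E W (\<lambda>m. emb (K i j l m))"
  let ?Z = "\<lambda>K W Z i j. E Z (\<lambda>l. emb (?W K W i j l))"
  let ?Y = "\<lambda>K W Z Y i. E Y (\<lambda>j. emb (?Z K W Z i j))"
  show ?thesis
  proof (rule p0.generic_step[of "K1 i j l" "K2 i j l"])
    fix W :: "'n \<Rightarrow> ('k, 'n) conv" assume W: "pt H emb W"
    show "?W K1 W i j l = ?W K2 W i j l"
    proof (rule p1.generic_step[of "?W K1 W i j" "?W K2 W i j"])
      fix Z :: "'n \<Rightarrow> (('k, 'n) conv, 'n) conv" assume Z: "pt H (\<lambda>c. emb (emb c)) Z"
      show "?Z K1 W Z i j = ?Z K2 W Z i j"
      proof (rule p2.generic_step[of "?Z K1 W Z i" "?Z K2 W Z i"])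
        fix Y :: "'n \<Rightarrow> ((('k, 'n) conv, 'n) conv, 'n) conv" assume Y: "pt H (\<lambda>c. emb (emb (emb c))) Y"
        show "?Y K1 W Z Y i = ?Y K2 W Z Y i"
        proof (rule p3.generic_step[of "?Y K1 W Z Y" "?Y K2 W Z Y"])
          fix X :: "'n \<Rightarrow> ('k, 'n) conv4" assume X: "pt H (\<lambda>c. emb (emb (emb (emb c)))) X"
          show "E X (\<lambda>i. emb (?Y K1 W Z Y i)) = E X (\<lambda>i. emb (?Y K2 W Z Y i))"
            using assms[unfolded emb4_def, OF X pt_emb[OF Y] pt_emb[OF pt_emb[OF Z]] pt_emb[OF pt_emb[OF pt_emb[OF W]]]]
            by (simp only: emb_E)
        qed
      qed
    qed
  qed
qed

locale generic_points = points H \<iota>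
  for H :: "('k::field, 'h::ring_1, 'n::finite) hopf" and \<iota> :: "'k \<Rightarrow> 'r::comm_ring_1" +
  assumes transfer4: "(\<And>X Y Z W. P X \<Longrightarrow> P Y \<Longrightarrow> P Z \<Longrightarrow> P W \<Longrightarrow>
    E X (\<lambda>i. E Y (\<lambda>j. E Z (\<lambda>l. E W (\<lambda>m. \<iota> (K1 i j l m))))) =
    E X (\<lambda>i. E Y (\<lambda>j. E Z (\<lambda>l. E W (\<lambda>m. \<iota> (K2 i j l m)))))) \<Longrightarrow> K1 i j l m = K2 i j l m"

lemma (in cocommutative_hopf) generic_points_emb4: "generic_points H (emb4 :: 'k \<Rightarrow> ('k, 'n) conv4)"
proof -
  interpret points H "emb4 :: 'k \<Rightarrow> ('k, 'n) conv4"
    unfolding emb4_def[abs_def] by (intro points_emb) (unfold_locales, simp_all)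
  show ?thesis
  proof unfold_locales
    fix K1 K2 :: "'n \<Rightarrow> 'n \<Rightarrow> 'n \<Rightarrow> 'n \<Rightarrow> 'k" and i j l m
    assume *: "\<And>X Y Z W :: 'n \<Rightarrow> ('k, 'n) conv4. P X \<Longrightarrow> P Y \<Longrightarrow> P Z \<Longrightarrow> P W \<Longrightarrow>
      E X (\<lambda>i. E Y (\<lambda>j. E Z (\<lambda>l. E W (\<lambda>m. emb4 (K1 i j l m))))) =
      E X (\<lambda>i. E Y (\<lambda>j. E Z (\<lambda>l. E W (\<lambda>m. emb4 (K2 i j l m)))))"
    show "K1 i j l m = K2 i j l m"
      by (rule transfer4) (rule *)
  qed
qed

context generic_points
begin

lemma ex_counit: "\<exists>c. cou H (b c) \<noteq> 0"
proof (rule ccontr)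
  assume "\<not> ?thesis"
  then have "cou H (b i) = 0" for i by simp
  then have "cou H 1 = 0" unfolding klin_expand[OF klin_cou, of 1] by simp
  then show False by simp
qed

text \<open>
  Fewer variables are reduced to four by multiplying with counits, which are \<open>1\<close> at points; the dummy
  variable takes as value a basis element on which the counit does not vanish.
\<close>

lemma transfer3:
  assumes "\<And>X Y Z. P X \<Longrightarrow> P Y \<Longrightarrow> P Z \<Longrightarrow>
    E X (\<lambda>i. E Y (\<lambda>j. E Z (\<lambda>l. \<iota> (K1 i j l)))) = E X (\<lambda>i. E Y (\<lambda>j. E Z (\<lambda>l. \<iota> (K2 i j l))))"
  shows "K1 i j l = K2 i j l"
proof -
  obtain c where c: "cou H (b c) \<noteq> 0" using ex_counit ..
  have "K1 i j l * cou H (b c) = K2 i j l * cou H (b c)"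
    by (rule transfer4[of "\<lambda>i j l m. K1 i j l * cou H (b m)" "\<lambda>i j l m. K2 i j l * cou H (b m)"])
      (simp add: \<iota>_mult E_mult_left E_mult_right assms)
  with c show ?thesis by simp
qed

lemma transfer2:
  assumes "\<And>X Y. P X \<Longrightarrow> P Y \<Longrightarrow> E X (\<lambda>i. E Y (\<lambda>j. \<iota> (K1 i j))) = E X (\<lambda>i. E Y (\<lambda>j. \<iota> (K2 i j)))"
  shows "K1 i j = K2 i j"
proof -
  obtain c where c: "cou H (b c) \<noteq> 0" using ex_counit ..
  have "K1 i j * cou H (b c) = K2 i j * cou H (b c)"
    by (rule transfer3[of "\<lambda>i j m. K1 i j * cou H (b m)" "\<lambda>i j m. K2 i j * cou H (b m)"])
      (simp add: \<iota>_mult E_mult_left E_mult_right assms)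
  with c show ?thesis by simp
qed

lemma transfer1:
  assumes "\<And>X. P X \<Longrightarrow> E X (\<lambda>i. \<iota> (K1 i)) = E X (\<lambda>i. \<iota> (K2 i))"
  shows "K1 i = K2 i"
proof -
  obtain c where c: "cou H (b c) \<noteq> 0" using ex_counit ..
  have "K1 i * cou H (b c) = K2 i * cou H (b c)"
    by (rule transfer2[of "\<lambda>i m. K1 i * cou H (b m)" "\<lambda>i m. K2 i * cou H (b m)"])
      (simp add: \<iota>_mult E_mult_left E_mult_right assms)
  with c show ?thesis by simp
qed

end

section \<open>Integrals and traces\<close>

context cocommutative_hopf
begin

lemmas klin_sw = klin_sw2 klin_sw2_arg

lemma klin_sw3: "klin H (\<lambda>x. sw3 H (*) x B)"
  unfolding sw3_def by (rule klin_sw2)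

lemma klin_comp_sum: "(\<And>j. klin H (\<lambda>x. f x j)) \<Longrightarrow> klin H (\<lambda>x. \<Sum>j\<in>A. f x j)"
  by (simp add: klin_def sum.distrib sum_distrib_left)

lemma dmul_commute: "dmul H f g = dmul H g f"
proof
  fix h
  have "dmul H f g h = (\<Sum>j\<in>UNIV. \<Sum>i\<in>UNIV. comul H h $ (i, j) * (f (b i) * g (b j)))"
    unfolding dmul_def sw2_def by (rule sum.swap)
  also have "\<dots> = dmul H g f h"
    unfolding dmul_def sw2_def by (intro sum.cong refl) (simp add: mult.commute[of "f _"] cocomm_coeff[of h])
  finally show "dmul H f g h = dmul H g f h" .
qed

lemma dmul_mult:
  assumes "klin H f" "klin H g"
  shows "dmul H f g (x * y) = sw2 H (*) x (\<lambda>a c. sw2 H (*) y (\<lambda>d e. f (a * d) * g (c * e)))"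
  unfolding dmul_def by (rule sw2_mult) (simp_all add: klin_cmult assms)

lemma dmul_sum: "dmul H (\<lambda>y. \<Sum>j\<in>A. f j y) g h = (\<Sum>j\<in>A. dmul H (f j) g h)"
  unfolding dmul_def sum_distrib_right by (rule sw2_sum)

lemma sw2_swap: "sw2 H (*) x (\<lambda>p q. sw2 H (*) y (\<lambda>r s. B p q r s)) =
    sw2 H (*) y (\<lambda>r s. sw2 H (*) x (\<lambda>p q. B p q r s :: 'k))"
  by (simp add: sw2_def[of _ _ y] sw2_sum sw2_cmult)

lemma sw3_sum: "sw3 H (*) x (\<lambda>p q r. \<Sum>i\<in>A. B p q r i) = (\<Sum>i\<in>A. sw3 H (*) x (\<lambda>p q r. B p q r i :: 'k))"
  unfolding sw3_def by (simp add: sw2_sum)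

lemma sw3_cmult: "sw3 H (*) x (\<lambda>p q r. c * B p q r) = c * sw3 H (*) x (\<lambda>p q r. B p q r :: 'k)"
  unfolding sw3_def by (simp add: sw2_cmult)

end

context generic_points
begin

lemma klin_transfer:
  assumes "klin H f" "klin H g" "\<And>X. P X \<Longrightarrow> E X (\<lambda>i. \<iota> (f (b i))) = E X (\<lambda>i. \<iota> (g (b i)))"
  shows "f x = g x"
proof -
  have "f = g" by (rule klin_eqI[OF assms(1,2)], rule transfer1, rule assms(3))
  then show ?thesis by simp
qed

lemma bilinear_transfer:
  assumes "\<And>y. klin H (\<lambda>x. f x y)" "\<And>x. klin H (\<lambda>y. f x y)" "\<And>y. klin H (\<lambda>x. g x y)" "\<And>x. klin H (\<lambda>y. g x y)"
    and "\<And>X Y. P X \<Longrightarrow> P Y \<Longrightarrow> E X (\<lambda>i. E Y (\<lambda>j. \<iota> (f (b i) (b j)))) = E X (\<lambda>i. E Y (\<lambda>j. \<iota> (g (b i) (b j))))"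
  shows "f x y = g x y"
proof -
  have *: "f (b i) (b j) = g (b i) (b j)" for i j
    by (rule transfer2[of "\<lambda>i j. f (b i) (b j)" "\<lambda>i j. g (b i) (b j)"], rule assms(5))
  show ?thesis
    unfolding bilinear_expand[of f x y, OF assms(1,2)] bilinear_expand[of g x y, OF assms(3,4)] * ..
qed

lemma pinv_pinv: assumes "P X" shows "pinv (pinv X) = X"
proof -
  have "pinv (pinv X) = pinv (pinv X) \<odot> (pinv X \<odot> X)"
    using assms by (simp add: pinv_left pmul_one)
  also have "\<dots> = pinv (pinv X) \<odot> pinv X \<odot> X" by (rule pmul_assoc[symmetric])
  also have "\<dots> = X" using assms by (simp add: pinv_left[of "pinv X"] pmul_one)
  finally show ?thesis .
qed

lemma anti_anti [simp]: "anti H (anti H x) = x"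
proof (rule eq_if_dbas)
  show "dbas H l (anti H (anti H x)) = dbas H l x" for l
    by (rule klin_transfer[of "\<lambda>x. dbas H l (anti H (anti H x))"])
      (simp_all add: klin_anti[OF klin_anti[OF klin_dbas]] calc pinv_pinv)
qed

lemma pinv_pmul_cancel [simp]: "P X \<Longrightarrow> pinv X \<odot> (X \<odot> Y) = Y" "P X \<Longrightarrow> X \<odot> (pinv X \<odot> Y) = Y"
  by (simp_all add: pmul_assoc[symmetric] pinv_left pinv_right pmul_one)

lemma pinv_pmul: assumes "P X" "P Y" shows "pinv (X \<odot> Y) = pinv Y \<odot> pinv X"
proof -
  have "pinv (X \<odot> Y) = pinv (X \<odot> Y) \<odot> ((X \<odot> Y) \<odot> (pinv Y \<odot> pinv X))"
    using assms by (simp add: pmul_assoc pinv_right pmul_one)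
  also have "\<dots> = pinv Y \<odot> pinv X" using assms by (simp only: pinv_pmul_cancel pt_mul)
  finally show ?thesis .
qed

lemma character_pmul:
  assumes "klin H f" "\<And>x y. f (x * y) = f x * f y"
  shows "ext1 f (X \<odot> Y) = ext1 f X * ext1 f Y"
  unfolding ext1_pmul[OF assms(1)] by (simp add: assms(2) \<iota>_mult E_mult_left E_mult_right ext1_def)

lemma pmul_pone_cancel: "pinv pone = pone"
  using pinv_right[OF pt_one] by (simp add: pmul_one)

end

locale integral_points = generic_points H \<iota>
  for H :: "('k::field, 'h::ring_1, 'n::finite) hopf" and \<iota> :: "'k \<Rightarrow> 'r::comm_ring_1" +
  fixes t :: 'h and \<mu> :: "'h \<Rightarrow> 'k"
  assumes t_nonzero: "t \<noteq> 0" and t_left: "h * t = scl H (cou H h) t" and t_right: "t * h = scl H (\<mu> h) t"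
begin

lemma scl_t: "scl H c t = scl H d t \<Longrightarrow> c = d"
  using t_nonzero by (simp add: fdvs.scale_cancel_right)

lemma klin_\<mu> [simp]: "klin H \<mu>"
  unfolding klin_def
proof (intro conjI allI; rule scl_t)
  show "scl H (\<mu> (x + y)) t = scl H (\<mu> x + \<mu> y) t" for x y
    by (simp add: t_right[symmetric] fdvs.scale_left_distrib distrib_left)
  show "scl H (\<mu> (scl H c x)) t = scl H (c * \<mu> x) t" for c x
    unfolding t_right[symmetric] scl_mult fdvs.scale_scale[symmetric] ..
qed

lemma \<mu>_mult: "\<mu> (x * y) = \<mu> x * \<mu> y"
proof (rule scl_t)
  have "scl H (\<mu> (x * y)) t = t * x * y" by (simp add: t_right[symmetric] mult.assoc)
  also have "\<dots> = scl H (\<mu> x * \<mu> y) t" by (simp add: t_right scl_mult fdvs.scale_scale)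
  finally show "scl H (\<mu> (x * y)) t = scl H (\<mu> x * \<mu> y) t" .
qed

lemma \<mu>_one: "\<mu> 1 = 1"
  by (rule scl_t) (simp add: t_right[symmetric])

text \<open>
  \<open>f(t\<^sub>1) g(h t\<^sub>2) = f(S(h\<^sub>1) h\<^sub>2 t\<^sub>1) g(h\<^sub>3 t\<^sub>2)\<close>, and on the right \<open>h\<^sub>2 t\<close> is \<open>\<epsilon>(h\<^sub>2) t\<close>.
\<close>

lemma integral_shift:
  assumes f: "klin H f" and g: "klin H g"
  shows "dmul H f (\<lambda>y. g (h * y)) t = dmul H (\<lambda>y. f (anti H h * y)) g t"
proof -
  note fg = ext1_crd[OF f] ext1_crd[OF g] f g
  have "dmul H f (\<lambda>y. g (h * y)) s =
      sw2 H (*) h (\<lambda>p q. dmul H (\<lambda>y. f (anti H q * y)) g (p * s))" (is "?l h s = ?r h s") for s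
  proof (rule bilinear_transfer[of ?l ?r])
    show "klin H (\<lambda>x. ?l x y)" "klin H (?l y)" for y
      unfolding dmul_def by (simp_all add: klin_sw klin_cmult klin_mult fg)
    show "klin H (\<lambda>x. ?r x y)" "klin H (?r y)" for y
      by (intro klin_sw klin_mult klin_dmul)+
    show "E X (\<lambda>i. E Y (\<lambda>j. \<iota> (?l (b i) (b j)))) = E X (\<lambda>i. E Y (\<lambda>j. \<iota> (?r (b i) (b j))))"
      if "P X" "P Y" for X Y
      using that by (simp add: dmul_mult klin_mult fg) (simp add: dmul_def calc fg)
  qed
  also have "sw2 H (*) h (\<lambda>p q. dmul H (\<lambda>y. f (anti H q * y)) g (p * t)) =
      sw2 H (*) h (\<lambda>p q. cou H p * dmul H (\<lambda>y. f (anti H q * y)) g t)"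
    by (simp add: t_left klin_scl[OF klin_dmul])
  also have "\<dots> = dmul H (\<lambda>y. f (anti H h * y)) g t"
  proof (rule counit)
    show "klin H (\<lambda>h. dmul H (\<lambda>y. f (anti H h * y)) g t)"
      unfolding dmul_def using klin_anti[OF klin_mult(1)[OF f]] by (intro klin_sw klin_cmult) simp
  qed
  finally show ?thesis .
qed

text \<open>
  A form \<open>l\<close> with \<open>l(t\<^sub>1) t\<^sub>2 = 1\<close>.  If \<open>f(t) = 1\<close>, then \<open>f(t\<^sub>1) S(t\<^sub>2) t\<^sub>3 = 1\<close>.  Expanding the middle factor in the
  basis and moving it into the first factor by \<open>integral_shift\<close> brings this into the required form.
\<close>

lemma dual_integral_exists: "\<exists>l. klin H l \<and> (\<forall>g. klin H g \<longrightarrow> dmul H l g t = g 1)"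
proof -
  obtain c where c: "dbas H c t \<noteq> 0"
    using t_nonzero expand[of t] by fastforce
  define f where "f = (\<lambda>x. inverse (dbas H c t) * dbas H c x)"
  have f: "klin H f" and ft: "f t = 1"
    using c by (simp_all add: f_def klin_cmult)
  define l where "l = (\<lambda>y. \<Sum>j\<in>UNIV. dmul H f (dbas H j) (b j * y))"
  have l: "klin H l"
    unfolding l_def by (intro klin_comp_sum klin_mult klin_dmul)
  have "dmul H l g t = g 1" if g: "klin H g" for g
  proof -
    note fg = ext1_crd[OF f] ext1_crd[OF g] f g
    have "dmul H l g t = (\<Sum>j\<in>UNIV. dmul H (\<lambda>y. dmul H f (dbas H j) (anti H (anti H (b j)) * y)) g t)"
      unfolding l_def dmul_sum by simp
    also have "\<dots> = (\<Sum>j\<in>UNIV. dmul H (dmul H f (dbas H j)) (\<lambda>y. g (anti H (b j) * y)) t)"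
      by (intro sum.cong refl integral_shift[symmetric] klin_dmul g)
    also have "\<dots> = f t * g 1" (is "?l t = ?r t")
    proof (rule klin_transfer[of ?l ?r])
      show "klin H ?l" "klin H ?r"
        by (intro klin_comp_sum klin_dmul klin_cmult f)+
      fix X assume X: "P X"
      have "E X (\<lambda>i. \<iota> (?l (b i))) = (\<Sum>j\<in>UNIV. ext1 (dmul H (dmul H f (dbas H j)) (\<lambda>y. g (anti H (b j) * y))) X)"
        by (simp add: \<iota>_sum E_sum ext1_def)
      also have "\<dots> = ext1 f X * (\<Sum>j\<in>UNIV. X j * ext1 (\<lambda>y. g (anti H (b j) * y)) X)"
        using X by (simp add: ext1_dmul ext1_dbas sum_distrib_left mult.assoc)
      also have "(\<Sum>j\<in>UNIV. X j * ext1 (\<lambda>y. g (anti H (b j) * y)) X) = E X (\<lambda>j. E X (\<lambda>i. \<iota> (g (anti H (b j) * b i))))"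
        by (simp add: E_def ext1_def)
      also have "\<dots> = \<iota> (g 1)"
        using X by (simp add: fg calc pinv_left)
      finally show "E X (\<lambda>i. \<iota> (?l (b i))) = E X (\<lambda>i. \<iota> (?r (b i)))"
        by (simp add: \<iota>_mult E_mult_right ext1_def)
    qed
    finally show ?thesis using ft by simp
  qed
  with l show ?thesis by blast
qed

definition dual_int :: "'h \<Rightarrow> 'k" where
  "dual_int = (SOME l. klin H l \<and> (\<forall>g. klin H g \<longrightarrow> dmul H l g t = g 1))"

lemma klin_dual_int [simp]: "klin H dual_int" and dual_int_t: "klin H g \<Longrightarrow> dmul H dual_int g t = g 1"
  using someI_ex[OF dual_integral_exists] unfolding dual_int_def by blast+

lemma klin_dual_int': "klin H (\<lambda>x. dual_int (anti H x * p))"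
  by (rule klin_anti[OF klin_mult(1)[OF klin_dual_int]])

text \<open>
  So \<open>t\<^sub>2\<close> and the forms \<open>h \<mapsto> dual_int(S(h) t\<^sub>1)\<close> are dual bases of \<open>H\<close>.
\<close>

lemma dual_int_shift:
  assumes "klin H g"
  shows "dmul H (\<lambda>y. dual_int (anti H h * y)) g t = g h"
  using integral_shift[OF klin_dual_int assms, of h] dual_int_t[OF klin_mult(2)[OF assms]] by simp

lemma eq_if_integrals_eq:
  assumes f: "klin H f" "klin H f'" and eq: "\<And>g. klin H g \<Longrightarrow> dmul H f g t = dmul H f' g t"
  shows "f h = f' h"
proof -
  have "f h = dmul H f (\<lambda>y. dual_int (anti H h * y)) t"
    using dual_int_shift[OF f(1)] by (simp add: dmul_commute)
  also have "\<dots> = dmul H f' (\<lambda>y. dual_int (anti H h * y)) t"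
    by (rule eq) (simp add: klin_mult)
  also have "\<dots> = f' h"
    using dual_int_shift[OF f(2)] by (simp add: dmul_commute)
  finally show ?thesis .
qed

text \<open>
  The failure of \<open>dual_int\<close> to be a trace is measured by \<open>\<mu>\<close>.  Both sides, as forms in \<open>y\<close>, can be compared on the
  integral: \<open>dual_int(t\<^sub>1 x) t\<^sub>2 = dual_int(t\<^sub>1 x\<^sub>1) t\<^sub>2 x\<^sub>2 S(x\<^sub>3)\<close>, and \<open>t x\<^sub>1 = \<mu>(x\<^sub>1) t\<close>.
\<close>

lemma dual_int_mult_commute: "dual_int (y * x) = sw2 H (*) x (\<lambda>p q. \<mu> p * dual_int (q * y))"
proof (rule eq_if_integrals_eq[of "\<lambda>y. dual_int (y * x)" "\<lambda>y. sw2 H (*) x (\<lambda>p q. \<mu> p * dual_int (q * y))"])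
  show "klin H (\<lambda>y. dual_int (y * x))" "klin H (\<lambda>y. sw2 H (*) x (\<lambda>p q. \<mu> p * dual_int (q * y)))"
    by (simp_all add: klin_mult klin_sw2_arg klin_cmult)
  fix g assume g: "klin H g"
  note fg = ext1_crd[OF klin_dual_int] ext1_crd[OF g] g
  have "dmul H (\<lambda>y. dual_int (y * x)) g s =
      sw2 H (*) x (\<lambda>p q. dmul H dual_int (\<lambda>y. g (y * anti H q)) (s * p))" (is "?l x s = ?r x s") for s
  proof (rule bilinear_transfer[of ?l ?r])
    show "klin H (\<lambda>x. ?l x y)" "klin H (?l y)" for y
      unfolding dmul_def by (simp_all add: klin_sw klin_cmult klin_mult)
    show "klin H (\<lambda>x. ?r x y)" "klin H (?r y)" for y
      by (intro klin_sw klin_mult klin_dmul)+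
    show "E X (\<lambda>i. E Y (\<lambda>j. \<iota> (?l (b i) (b j)))) = E X (\<lambda>i. E Y (\<lambda>j. \<iota> (?r (b i) (b j))))"
      if "P X" "P Y" for X Y
      using that by (simp add: dmul_mult klin_mult fg) (simp add: dmul_def calc fg pmul_assoc pinv_right pmul_one)
  qed
  also have "sw2 H (*) x (\<lambda>p q. dmul H dual_int (\<lambda>y. g (y * anti H q)) (t * p)) = sw2 H (*) x (\<lambda>p q. \<mu> p * g (anti H q))"
    using g by (simp add: t_right klin_scl[OF klin_dmul] dual_int_t klin_mult)
  also have "\<dots> = sw2 H (*) x (\<lambda>p q. \<mu> p * dmul H (\<lambda>y. dual_int (q * y)) g t)"
    using dual_int_shift[OF g, of "anti H q" for q] by simp
  also have "\<dots> = dmul H (\<lambda>y. sw2 H (*) x (\<lambda>p q. \<mu> p * dual_int (q * y))) g t"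
    by (simp only: dmul_def sw2_cmult[symmetric] sw2_swap[of x] mult.assoc)
  finally show "dmul H (\<lambda>y. dual_int (y * x)) g t = dmul H (\<lambda>y. sw2 H (*) x (\<lambda>p q. \<mu> p * dual_int (q * y))) g t" .
qed

lemma ext1_dual_int_commute: "P X \<Longrightarrow> P Y \<Longrightarrow> ext1 dual_int (Y \<odot> X) = ext1 \<mu> X * ext1 dual_int (X \<odot> Y)"
proof -
  assume XY: "P X" "P Y"
  have eq: "dual_int (b j * b i) = sw2 H (*) (b i) (\<lambda>p q. \<mu> p * dual_int (q * b j))" for i j
    by (rule dual_int_mult_commute)
  have "ext1 dual_int (Y \<odot> X) = E Y (\<lambda>j. E X (\<lambda>i. \<iota> (dual_int (b j * b i))))"
    by (rule ext1_pmul) simp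
  also have "\<dots> = E Y (\<lambda>j. E X (\<lambda>i. \<iota> (sw2 H (*) (b i) (\<lambda>p q. \<mu> p * dual_int (q * b j)))))"
    by (simp only: eq)
  also have "\<dots> = ext1 \<mu> X * ext1 dual_int (X \<odot> Y)"
    using XY by (simp add: calc ext1_crd[OF klin_dual_int] ext1_crd[OF klin_\<mu>])
  finally show ?thesis .
qed

lemma trace_by_integral:
  assumes F: "\<And>f. klin H f \<Longrightarrow> klin H (\<lambda>h. F h f)"
  assumes F2: "\<And>h p. (\<Sum>i\<in>UNIV. dual_int (anti H (b i) * p) * F h (dbas H i)) = F h (\<lambda>z. dual_int (anti H z * p))"
  shows "(\<Sum>i\<in>UNIV. F (b i) (dbas H i)) = sw2 H (*) t (\<lambda>p q. F q (\<lambda>z. dual_int (anti H z * p)))"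
proof -
  have "F (b i) (dbas H i) = sw2 H (*) t (\<lambda>p q. dual_int (anti H (b i) * p) * F q (dbas H i))" for i
    using dual_int_shift[OF F[OF klin_dbas], of "b i"] by (simp add: dmul_def)
  then have "(\<Sum>i\<in>UNIV. F (b i) (dbas H i)) = sw2 H (*) t (\<lambda>p q. \<Sum>i\<in>UNIV. dual_int (anti H (b i) * p) * F q (dbas H i))"
    by (simp add: sw2_sum)
  then show ?thesis by (simp only: F2)
qed

lemma dual_int_expand: "(\<Sum>i\<in>UNIV. dual_int (anti H (b i) * p) * dbas H i z) = dual_int (anti H z * p)"
  using klin_expand[OF klin_anti[OF klin_mult(1)[OF klin_dual_int]], of z p] by (simp add: mult.commute)

text \<open>
  At points \<open>T, G\<close> for \<open>t, g\<close>, the trace is \<open>dual_int((T G T\<inverse>)\<inverse> T) B(T) = dual_int(T G\<inverse>) B(T)\<close>; moving \<open>G\<inverse>\<close> to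
  the front gives the factor \<open>\<mu>(G\<inverse>)\<close>, and the dual bases then replace \<open>T\<close> by \<open>G\<close>, the fixed point of
  \<open>T \<mapsto> T G T\<inverse>\<close>.
\<close>

lemma trace_conj:
  assumes B: "klin H B"
  shows "(\<Sum>i\<in>UNIV. sw3 H (*) (b i) (\<lambda>a c d. dbas H i (a * g * anti H c) * B d)) = sw2 H (*) g (\<lambda>p q. \<mu> (anti H p) * B q)"
proof -
  have "(\<Sum>i\<in>UNIV. sw3 H (*) (b i) (\<lambda>a c d. dbas H i (a * g * anti H c) * B d)) =
     sw2 H (*) t (\<lambda>p q. sw3 H (*) q (\<lambda>a c d. dual_int (anti H (a * g * anti H c) * p) * B d))"
    by (rule trace_by_integral[of "\<lambda>h f. sw3 H (*) h (\<lambda>a c d. f (a * g * anti H c) * B d)"])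
      (simp_all add: klin_sw3 sw3_cmult[symmetric] sw3_sum[symmetric] mult.assoc[symmetric] sum_distrib_right[symmetric] dual_int_expand)
  also have "sw2 H (*) s (\<lambda>p q. sw3 H (*) q (\<lambda>a c d. dual_int (anti H (a * g * anti H c) * p) * B d)) =
     sw2 H (*) g (\<lambda>p q. \<mu> (anti H p) * dmul H (\<lambda>y. dual_int (anti H q * y)) B s)" (is "?l g s = ?r g s") for s
  proof (rule bilinear_transfer[of ?l ?r])
    show "klin H (\<lambda>x. ?l x y)" for y
      unfolding sw_defs by (intro klin_sw klin_cmult klin_mult(3) klin_dual_int')
    show "klin H (?l y)" for y by (rule klin_sw2)
    show "klin H (\<lambda>x. ?r x y)" "klin H (?r y)" for y
      by (intro klin_sw klin_cmult klin_mult klin_dmul)+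
    fix X Y assume XY: "P X" "P Y"
    show "E X (\<lambda>i. E Y (\<lambda>j. \<iota> (?l (b i) (b j)))) = E X (\<lambda>i. E Y (\<lambda>j. \<iota> (?r (b i) (b j))))"
      using XY ext1_dual_int_commute[of "pinv X" Y]
      by (simp add: dmul_def calc ext1_crd[OF klin_dual_int] ext1_crd[OF klin_\<mu>] ext1_crd[OF B] pinv_pmul pinv_pinv pmul_assoc pinv_left pmul_one)
  qed
  finally show ?thesis by (simp add: dual_int_shift[OF B])
qed

text \<open>
  At points \<open>T, G\<close> for \<open>t, g\<close>, the trace is \<open>dual_int(T\<inverse> G\<inverse> T T) B(T)\<close>, and moving the last \<open>T\<close> to the front leaves
  \<open>\<mu>(T) dual_int(G\<inverse> T) B(T)\<close>.
\<close>

lemma trace_conj_inv: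
  assumes B: "klin H B"
  shows "(\<Sum>i\<in>UNIV. sw3 H (*) (b i) (\<lambda>a c d. dbas H i (anti H a * g * c) * B d)) = sw2 H (*) g (\<lambda>p q. \<mu> p * B q)"
proof -
  have "(\<Sum>i\<in>UNIV. sw3 H (*) (b i) (\<lambda>a c d. dbas H i (anti H a * g * c) * B d)) =
     sw2 H (*) t (\<lambda>p q. sw3 H (*) q (\<lambda>a c d. dual_int (anti H (anti H a * g * c) * p) * B d))"
    by (rule trace_by_integral[of "\<lambda>h f. sw3 H (*) h (\<lambda>a c d. f (anti H a * g * c) * B d)"])
      (simp_all add: klin_sw3 sw3_cmult[symmetric] sw3_sum[symmetric] mult.assoc[symmetric] sum_distrib_right[symmetric] dual_int_expand)
  also have "sw2 H (*) s (\<lambda>p q. sw3 H (*) q (\<lambda>a c d. dual_int (anti H (anti H a * g * c) * p) * B d)) =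
     dmul H (\<lambda>y. dual_int (anti H g * y)) (dmul H \<mu> B) s" (is "?l g s = ?r g s") for s
  proof (rule bilinear_transfer[of ?l ?r])
    show "klin H (\<lambda>x. ?l x y)" for y
      unfolding sw_defs by (intro klin_sw klin_cmult klin_mult(3) klin_dual_int')
    show "klin H (?l y)" for y by (rule klin_sw2)
    show "klin H (\<lambda>x. ?r x y)" for y
      unfolding dmul_def by (intro klin_sw klin_cmult klin_dual_int')
    show "klin H (?r y)" for y by (rule klin_dmul)
    fix X Y assume XY: "P X" "P Y"
    show "E X (\<lambda>i. E Y (\<lambda>j. \<iota> (?l (b i) (b j)))) = E X (\<lambda>i. E Y (\<lambda>j. \<iota> (?r (b i) (b j))))"
      using XY ext1_dual_int_commute[of Y "pinv Y \<odot> pinv X \<odot> Y"]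
      by (simp add: dmul_def calc ext1_crd[OF klin_dual_int] ext1_crd[OF klin_\<mu>] ext1_crd[OF B] pinv_pmul pinv_pinv pmul_assoc pinv_left pmul_one)
  qed
  also have "dmul H (\<lambda>y. dual_int (anti H g * y)) (dmul H \<mu> B) t = sw2 H (*) g (\<lambda>p q. \<mu> p * B q)"
    by (simp add: dual_int_shift) (simp add: dmul_def)
  finally show ?thesis .
qed

end

section \<open>Convolution invertible trilinear forms\<close>

lemma (in cocommutative_hopf) linear_iff_klin: "Vector_Spaces.linear (scl H) (*) f \<longleftrightarrow> klin H f"
proof -
  have "vector_space ((*) :: 'k \<Rightarrow> 'k \<Rightarrow> 'k)" by unfold_locales (simp_all add: algebra_simps)
  moreover have "vector_space (scl H)" by unfold_locales
  ultimately show ?thesis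
    unfolding Vector_Spaces.linear_def module_hom_def module_hom_axioms_def module_iff_vector_space klin_def
    by auto
qed

lemma (in cocommutative_hopf) trilinear_iff:
  "trilinear H F \<longleftrightarrow> (\<forall>y z. klin H (\<lambda>x. F x y z)) \<and> (\<forall>x z. klin H (\<lambda>y. F x y z)) \<and> (\<forall>x y. klin H (\<lambda>z. F x y z))"
  unfolding trilinear_def linear_iff_klin ..

context generic_points
begin

lemma tri_crd: "trilinear H F \<Longrightarrow> \<iota> (F x y z) = ext3 F (crd x) (crd y) (crd z)"
  by (rule ext3_crd) (simp_all add: trilinear_iff)

lemma trilinear_expand:
  assumes "trilinear H F"
  shows "F x y z = (\<Sum>i\<in>UNIV. \<Sum>j\<in>UNIV. \<Sum>l\<in>UNIV. dbas H i x * dbas H j y * dbas H l z * F (b i) (b j) (b l))"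
proof -
  have 1: "klin H (\<lambda>x. F x y z)" "klin H (\<lambda>y. F x y z)" "klin H (\<lambda>z. F x y z)" for x y z
    using assms by (simp_all add: trilinear_iff)
  have "F x y z = (\<Sum>i\<in>UNIV. dbas H i x * F (b i) y z)" by (rule klin_expand[OF 1(1)])
  also have "\<dots> = (\<Sum>i\<in>UNIV. dbas H i x * (\<Sum>j\<in>UNIV. \<Sum>l\<in>UNIV. dbas H j y * dbas H l z * F (b i) (b j) (b l)))"
    using bilinear_expand[of "F (b i)" y z for i, OF 1(2,3)] by simp
  finally show ?thesis by (simp add: sum_distrib_left mult.assoc)
qed

lemma tri_transfer:
  assumes F: "trilinear H F" and G: "trilinear H G"
    and eq: "\<And>X Y Z. P X \<Longrightarrow> P Y \<Longrightarrow> P Z \<Longrightarrow> ext3 F X Y Z = ext3 G X Y Z"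
  shows "F = G"
proof (intro ext)
  fix x y z
  have *: "F (b i) (b j) (b l) = G (b i) (b j) (b l)" for i j l
    by (rule transfer3[of "\<lambda>i j l. F (b i) (b j) (b l)" "\<lambda>i j l. G (b i) (b j) (b l)"])
      (use eq in \<open>simp add: ext3_def\<close>)
  show "F x y z = G x y z"
    unfolding trilinear_expand[OF F, of x y z] trilinear_expand[OF G, of x y z] * ..
qed

lemma ext3_conv3:
  assumes "P X" "P Y" "P Z"
  shows "ext3 (conv3 H F G) X Y Z = ext3 F X Y Z * ext3 G X Y Z"
  using assms by (simp add: ext3_def conv3_def sw_defs \<iota>_sw2 \<iota>_mult sw2_comm E_sw2 E_mult_left E_mult_right)

lemma ext3_counit:
  assumes "P X" "P Y" "P Z"
  shows "ext3 (\<lambda>x y z. cou H x * cou H y * cou H z) X Y Z = 1"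
  using assms unfolding ext3_def by (simp add: calc)

lemma trilinear_counit: "trilinear H (\<lambda>x y z. cou H x * cou H y * cou H z)"
  by (simp add: trilinear_iff klin_cmult)

lemma trilinear_conv3: "trilinear H (conv3 H F G)"
  unfolding trilinear_iff conv3_def by (intro conjI allI klin_sw)

lemma conv_inverse_points:
  assumes "conv_inverse3 H F G" "P X" "P Y" "P Z"
  shows "ext3 F X Y Z * ext3 G X Y Z = 1"
  using assms by (simp add: conv_inverse3_def ext3_conv3[symmetric] ext3_counit)

lemma conv_inverse3I:
  assumes "trilinear H G" "\<And>X Y Z. P X \<Longrightarrow> P Y \<Longrightarrow> P Z \<Longrightarrow> ext3 F X Y Z * ext3 G X Y Z = 1"
  shows "conv_inverse3 H F G"
  unfolding conv_inverse3_def
proof (intro conjI)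
  show "conv3 H F G = (\<lambda>x y z. cou H x * cou H y * cou H z)" "conv3 H G F = (\<lambda>x y z. cou H x * cou H y * cou H z)"
    by (rule tri_transfer[OF trilinear_conv3 trilinear_counit],
        simp add: ext3_conv3 ext3_counit assms(2) mult.commute[of "ext3 G _ _ _"])+
qed (rule assms)

lemma cinv3_eq: "conv_inverse3 H F G \<Longrightarrow> cinv3 H F = G"
  unfolding cinv3_def
proof (rule the_equality)
  fix G' assume G: "conv_inverse3 H F G" and G': "conv_inverse3 H F G'"
  show "G' = G"
  proof (rule tri_transfer)
    show "trilinear H G'" "trilinear H G" using G G' by (simp_all add: conv_inverse3_def)
    fix X Y Z assume *: "P X" "P Y" "P Z"
    have "ext3 G' X Y Z = (ext3 F X Y Z * ext3 G X Y Z) * ext3 G' X Y Z"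
      using conv_inverse_points[OF G *] by simp
    also have "\<dots> = (ext3 F X Y Z * ext3 G' X Y Z) * ext3 G X Y Z" by (simp only: ac_simps)
    finally show "ext3 G' X Y Z = ext3 G X Y Z" using conv_inverse_points[OF G' *] by simp
  qed
qed

lemma trilinear_theta: "trilinear H (\<lambda>g x y. theta H w g x y)"
  unfolding trilinear_iff theta_def sw_defs by (intro conjI allI klin_sw)

lemma trilinear_gamma3: "trilinear H (\<lambda>g h x. gamma3 H w g h x)"
  unfolding trilinear_iff gamma3_def sw_defs by (intro conjI allI klin_sw)

lemma theta_points:
  assumes "trilinear H w" "trilinear H (cinv3 H w)" and "P G" "P X" "P Y"
  shows "ext3 (theta H w) G X Y = ext3 w G X Y * ext3 w X Y (hc G (X \<odot> Y)) * ext3 (cinv3 H w) X (hc G X) Y"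
  unfolding ext3_def[of "theta H w"] theta_def using assms(3-5)
  by (simp add: calc tri_crd[OF assms(1)] tri_crd[OF assms(2)])

lemma gamma3_points:
  assumes "trilinear H w" "trilinear H (cinv3 H w)" and "P G" "P K" "P X"
  shows "ext3 (gamma3 H w) G K X = ext3 w G K X * ext3 w X (hc G X) (hc K X) * ext3 (cinv3 H w) G X (hc K X)"
  unfolding ext3_def[of "gamma3 H w"] gamma3_def using assms(3-5)
  by (simp add: calc tri_crd[OF assms(1)] tri_crd[OF assms(2)])

lemma beta_points:
  assumes "trilinear H w" and "P G"
  shows "ext1 (beta H w) G = ext3 w G (pinv G) G"
  unfolding ext1_def beta_def using assms(2) by (simp add: calc tri_crd[OF assms(1)])

lemma klin_beta [simp]: "klin H (beta H w)"
  unfolding beta_def sw_defs by (rule klin_sw)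

lemma ext3_sigma: "ext3 (sigma H w) X Y G = ext3 (theta H w) G X Y"
  unfolding ext3_def sigma_def by (subst E_swap[of Y]) (subst E_swap[of X], rule refl)

lemma ext3_kappa: "ext3 (kappa H w) X G K = ext3 (gamma3 H w) G K X"
  unfolding ext3_def kappa_def by (subst E_swap[of X]) (subst E_swap[of X], rule refl)

lemma trilinear_sigma: "trilinear H (sigma H w)"
  using trilinear_theta[of w] by (simp add: trilinear_iff sigma_def)

lemma trilinear_kappa: "trilinear H (kappa H w)"
  using trilinear_gamma3[of w] by (simp add: trilinear_iff kappa_def)

end

locale cocycle_points = generic_points H \<iota>
  for H :: "('k::field, 'h::ring_1, 'n::finite) hopf" and \<iota> :: "'k \<Rightarrow> 'r::comm_ring_1" +
  fixes \<omega> :: "'h \<Rightarrow> 'h \<Rightarrow> 'h \<Rightarrow> 'k"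
  assumes normalized_3cocycle: "normalized_3cocycle H \<omega>"
begin

abbreviation "\<omega>' \<equiv> cinv3 H \<omega>"
abbreviation "\<theta> \<equiv> theta H \<omega>"
abbreviation "\<sigma>' \<equiv> sigma_inv H \<omega>"
abbreviation "\<kappa>' \<equiv> kappa_inv H \<omega>"
abbreviation "\<beta> \<equiv> beta H \<omega>"
abbreviation "\<beta>' \<equiv> beta H \<omega>'"

lemma conv_inverse: "conv_inverse3 H \<omega> \<omega>'"
  using normalized_3cocycle cinv3_eq unfolding normalized_3cocycle_def by metis

lemma tri_\<omega>: "trilinear H \<omega>" and tri_\<omega>': "trilinear H \<omega>'"
  using normalized_3cocycle conv_inverse by (simp_all add: normalized_3cocycle_def conv_inverse3_def)

lemma cinv3_\<omega>': "cinv3 H \<omega>' = \<omega>"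
  by (rule cinv3_eq) (use conv_inverse tri_\<omega> in \<open>simp add: conv_inverse3_def\<close>)

lemma points_cocycle:
  assumes "P X" "P Y" "P Z" "P T"
  shows "ext3 \<omega> X Y (Z \<odot> T) * ext3 \<omega> (X \<odot> Y) Z T = ext3 \<omega> Y Z T * ext3 \<omega> X (Y \<odot> Z) T * ext3 \<omega> X Y Z"
proof -
  have "sw2 H (*) x (\<lambda>x1 x2. sw2 H (*) y (\<lambda>y1 y2. sw2 H (*) z (\<lambda>z1 z2. sw2 H (*) t (\<lambda>t1 t2.
          \<omega> x1 y1 (z1 * t1) * \<omega> (x2 * y2) z2 t2))))
      = sw2 H (*) x (\<lambda>x1 x2. sw3 H (*) y (\<lambda>y1 y2 y3. sw3 H (*) z (\<lambda>z1 z2 z3. sw2 H (*) t (\<lambda>t1 t2.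
          \<omega> y1 z1 t1 * \<omega> x1 (y2 * z2) t2 * \<omega> x2 y3 z3))))" for x y z t
    using normalized_3cocycle unfolding normalized_3cocycle_def by blast
  then have "E X (\<lambda>i. E Y (\<lambda>j. E Z (\<lambda>l. E T (\<lambda>m. \<iota> (sw2 H (*) (b i) (\<lambda>x1 x2. sw2 H (*) (b j) (\<lambda>y1 y2. sw2 H (*) (b l) (\<lambda>z1 z2. sw2 H (*) (b m) (\<lambda>t1 t2.
          \<omega> x1 y1 (z1 * t1) * \<omega> (x2 * y2) z2 t2)))))))))
      = E X (\<lambda>i. E Y (\<lambda>j. E Z (\<lambda>l. E T (\<lambda>m. \<iota> (sw2 H (*) (b i) (\<lambda>x1 x2. sw3 H (*) (b j) (\<lambda>y1 y2 y3. sw3 H (*) (b l) (\<lambda>z1 z2 z3. sw2 H (*) (b m) (\<lambda>t1 t2.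
          \<omega> y1 z1 t1 * \<omega> x1 (y2 * z2) t2 * \<omega> x2 y3 z3)))))))))" by simp
  then show ?thesis
    using assms by (simp add: calc tri_crd[OF tri_\<omega>])
qed

lemma points_normalized:
  assumes "P X" "P Y"
  shows "ext3 \<omega> pone X Y = 1" "ext3 \<omega> X pone Y = 1" "ext3 \<omega> X Y pone = 1"
proof -
  have n: "\<omega> 1 x y = cou H x * cou H y" "\<omega> x 1 y = cou H x * cou H y" "\<omega> x y 1 = cou H x * cou H y" for x y
    using normalized_3cocycle by (simp_all add: normalized_3cocycle_def)
  have "E X (\<lambda>i. E Y (\<lambda>j. \<iota> (\<omega> 1 (b i) (b j)))) = 1" "E X (\<lambda>i. E Y (\<lambda>j. \<iota> (\<omega> (b i) 1 (b j)))) = 1"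
    "E X (\<lambda>i. E Y (\<lambda>j. \<iota> (\<omega> (b i) (b j) 1))) = 1"
    unfolding n using assms by (simp_all add: calc)
  then show "ext3 \<omega> pone X Y = 1" "ext3 \<omega> X pone Y = 1" "ext3 \<omega> X Y pone = 1"
    by (simp_all add: calc tri_crd[OF tri_\<omega>])
qed

sublocale gc: group_cocycle "Collect P" "(\<odot>)" pinv pone "ext3 \<omega>" "ext3 \<omega>'"
  by unfold_locales
    (simp_all add: pmul_assoc pmul_one pinv_left pinv_right points_cocycle points_normalized conv_inverse_points[OF conv_inverse])

lemma hc_conj: "P X \<Longrightarrow> hc G X = gc.conj G X"
  by (simp add: hc_pt gc.conj_def)

lemma th_points: "P G \<Longrightarrow> P X \<Longrightarrow> P Y \<Longrightarrow> ext3 \<theta> G X Y = gc.th G X Y"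
  by (simp add: theta_points tri_\<omega> tri_\<omega>' gc.th_def hc_conj)

lemma gm_points: "P G \<Longrightarrow> P K \<Longrightarrow> P X \<Longrightarrow> ext3 (gamma3 H \<omega>) G K X = gc.gm G K X"
  by (simp add: gamma3_points tri_\<omega> tri_\<omega>' gc.gm_def hc_conj)

lemma sigma_inv_eq: "\<sigma>' = sigma H \<omega>'"
  unfolding sigma_inv_def
proof (rule cinv3_eq, rule conv_inverse3I[OF trilinear_sigma])
  fix X Y G assume "P X" "P Y" "P G"
  then show "ext3 (sigma H \<omega>) X Y G * ext3 (sigma H \<omega>') X Y G = 1"
    using gc.th_inverse[of G X Y]
    by (simp add: ext3_sigma th_points) (simp add: theta_points tri_\<omega> tri_\<omega>' cinv3_\<omega>' hc_conj gc.th'_def)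
qed

lemma kappa_inv_eq: "\<kappa>' = kappa H \<omega>'"
  unfolding kappa_inv_def
proof (rule cinv3_eq, rule conv_inverse3I[OF trilinear_kappa])
  fix X G K assume "P X" "P G" "P K"
  then show "ext3 (kappa H \<omega>) X G K * ext3 (kappa H \<omega>') X G K = 1"
    using gc.gm_inverse[of G K X]
    by (simp add: ext3_kappa gm_points) (simp add: gamma3_points tri_\<omega> tri_\<omega>' cinv3_\<omega>' hc_conj gc.gm'_def)
qed

lemma tri_sigma_inv: "trilinear H \<sigma>'" and tri_kappa_inv: "trilinear H \<kappa>'"
  by (simp_all add: sigma_inv_eq trilinear_sigma kappa_inv_eq trilinear_kappa)

lemma th'_points: "P X \<Longrightarrow> P Y \<Longrightarrow> P G \<Longrightarrow> ext3 \<sigma>' X Y G = gc.th' G X Y"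
  by (simp add: sigma_inv_eq ext3_sigma theta_points tri_\<omega> tri_\<omega>' cinv3_\<omega>' hc_conj gc.th'_def)

lemma gm'_points: "P X \<Longrightarrow> P G \<Longrightarrow> P K \<Longrightarrow> ext3 \<kappa>' X G K = gc.gm' G K X"
  by (simp add: kappa_inv_eq ext3_kappa gamma3_points tri_\<omega> tri_\<omega>' cinv3_\<omega>' hc_conj gc.gm'_def)

lemma bt_points: "P G \<Longrightarrow> ext1 \<beta> G = gc.bt G"
  by (simp add: beta_points tri_\<omega> gc.bt_def)

lemma bt'_points: "P G \<Longrightarrow> ext1 \<beta>' G = gc.bt' G"
  by (simp add: beta_points tri_\<omega>' gc.bt'_def)

end

section \<open>The product of \<open>D\<^sup>\<omega>(H)\<close>\<close>

context cocycle_points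
begin

definition mulc :: "'n \<times> 'n \<Rightarrow> 'n \<times> 'n \<Rightarrow> 'n \<times> 'n \<Rightarrow> 'k" where
  "mulc p q t = sw4 H (*) (b (snd p)) (\<lambda>h1 h2 h3 h4. sw2 H (*) (b (snd q)) (\<lambda>y1 y2.
     dmul H (dmul H (dbas H (fst p)) (ract (lact h1 (dbas H (fst q))) (anti H h2))) (sigma H \<omega> h3 y1) (b (fst t)) *
     dbas H (snd t) (h4 * y2)))"

lemma sw2_nth: "sw2 H (*s) h F $ t = sw2 H (*) h (\<lambda>p q. F p q $ t)"
  by (simp add: sw2_def)

lemma sw3_nth: "sw3 H (*s) h F $ t = sw3 H (*) h (\<lambda>p q r. F p q r $ t)"
  by (simp add: sw3_def sw2_nth)

lemma sw4_nth: "sw4 H (*s) h F $ t = sw4 H (*) h (\<lambda>p q r s. F p q r s $ t)"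
  by (simp add: sw4_def sw2_nth sw3_nth)

lemma dsw2_nth: "dsw2 H (*s) B F $ t = dsw2 H (*) B (\<lambda>p q. F p q $ t)"
  by (simp add: dsw2_def)

lemma hash_nth: "hash H f h $ t = f (b (fst t)) * dbas H (snd t) h"
  by (simp add: hash_def case_prod_beta)

lemma hash_lift_nth: "hash_lift H (*s) d F $ t = E (($) d) (\<lambda>p. F (dbas H (fst p)) (b (snd p)) $ t)"
  by (simp add: hash_lift_def E_pair)

lemma D_mul_nth: "D_mul H \<omega> d d' $ t = sc_mul mulc (($) d) (($) d') t"
  by (simp add: D_mul_def hash_lift_nth sc_mul_apply mulc_def sw4_nth sw2_nth hash_nth)

definition lift :: "'k ^ 'a::finite \<Rightarrow> 'a \<Rightarrow> 'r" where "lift d = (\<lambda>p. \<iota> (d $ p))"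

definition mulr :: "'n \<times> 'n \<Rightarrow> 'n \<times> 'n \<Rightarrow> 'n \<times> 'n \<Rightarrow> 'r" where "mulr p q t = \<iota> (mulc p q t)"

lemma \<iota>_E: "\<iota> (E x F) = E (\<lambda>p. \<iota> (x p)) (\<lambda>p. \<iota> (F p))"
  by (simp add: E_def \<iota>_sum \<iota>_mult)

lemma lift_D_mul: "lift (D_mul H \<omega> d d') = sc_mul mulr (lift d) (lift d')"
  by (rule ext) (simp add: lift_def D_mul_nth sc_mul_apply \<iota>_E mulr_def)

text \<open>
  \<open>value_at d A f X\<close>: as a function from points to \<open>H\<close>, the element \<open>d\<close> has the value \<open>f X\<close> at the point \<open>A\<close>.  The
  coefficients of \<open>d\<close> are in \<open>R\<close> so that \<open>d\<close> may depend on further points.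
\<close>

definition value_at :: "('n \<times> 'n \<Rightarrow> 'r) \<Rightarrow> ('n \<Rightarrow> 'r) \<Rightarrow> 'r \<Rightarrow> ('n \<Rightarrow> 'r) \<Rightarrow> bool" where
  "value_at d A f X \<longleftrightarrow> (\<forall>c. E A (\<lambda>a. d (a, c)) = f * X c)"

definition value_at2 :: "(('n \<times> 'n) \<times> ('n \<times> 'n) \<Rightarrow> 'r) \<Rightarrow> ('n \<Rightarrow> 'r) \<Rightarrow> ('n \<Rightarrow> 'r) \<Rightarrow> 'r \<Rightarrow> ('n \<Rightarrow> 'r) \<Rightarrow> ('n \<Rightarrow> 'r) \<Rightarrow> bool" where
  "value_at2 d A B f X Y \<longleftrightarrow> (\<forall>c c'. E A (\<lambda>a. E B (\<lambda>a'. d ((a, c), (a', c')))) = f * (X c * Y c'))"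

lemma value_at_contract:
  assumes "value_at d A f X"
  shows "E d (\<lambda>p. A (fst p) * F (snd p)) = f * E X F"
proof -
  have "E d (\<lambda>p. A (fst p) * F (snd p)) = (\<Sum>c\<in>UNIV. \<Sum>a\<in>UNIV. d (a, c) * (A a * F c))"
    unfolding E_pair by simp (rule sum.swap)
  also have "\<dots> = (\<Sum>c\<in>UNIV. E A (\<lambda>a. d (a, c)) * F c)"
    by (simp add: E_def sum_distrib_right sum_distrib_left ac_simps)
  also have "\<dots> = f * E X F"
    using assms by (simp add: value_at_def) (simp add: E_def sum_distrib_left ac_simps)
  finally show ?thesis .
qed

lemma value_at2_contract:
  assumes "value_at2 d A B f X Y"
  shows "E d (\<lambda>p. (A (fst (fst p)) * B (fst (snd p))) * F (snd (fst p)) (snd (snd p))) = f * E X (\<lambda>c. E Y (F c))"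
proof -
  have "E d (\<lambda>p. (A (fst (fst p)) * B (fst (snd p))) * F (snd (fst p)) (snd (snd p))) =
    (\<Sum>a\<in>UNIV. \<Sum>c\<in>UNIV. \<Sum>a'\<in>UNIV. \<Sum>c'\<in>UNIV. d ((a, c), (a', c')) * (A a * B a' * F c c'))"
    unfolding E_pair sum_pair by simp
  also have "\<dots> = (\<Sum>c\<in>UNIV. \<Sum>a\<in>UNIV. \<Sum>c'\<in>UNIV. \<Sum>a'\<in>UNIV. d ((a, c), (a', c')) * (A a * B a' * F c c'))"
    by (subst sum.swap) (intro sum.cong refl sum.swap)
  also have "\<dots> = (\<Sum>c\<in>UNIV. \<Sum>c'\<in>UNIV. \<Sum>a\<in>UNIV. \<Sum>a'\<in>UNIV. d ((a, c), (a', c')) * (A a * B a' * F c c'))"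
    by (intro sum.cong refl sum.swap)
  also have "\<dots> = (\<Sum>c\<in>UNIV. \<Sum>c'\<in>UNIV. E A (\<lambda>a. E B (\<lambda>a'. d ((a, c), (a', c')))) * F c c')"
    by (simp add: E_def sum_distrib_right sum_distrib_left ac_simps)
  also have "\<dots> = f * E X (\<lambda>c. E Y (F c))"
    using assms by (simp add: value_at2_def) (simp add: E_def sum_distrib_left ac_simps)
  finally show ?thesis .
qed

text \<open>
  \<open>kern\<close> is what remains of the structure constants of the product when their first leg is evaluated at \<open>A\<close>
  (\<open>mulr_kern\<close>), and \<open>kern2\<close> is what remains when the second factor \<open>h\<close> of \<open>\<phi> # h\<close> is moreover evaluated at \<open>X\<close>.
\<close>

definition kern :: "('n \<Rightarrow> 'r) \<Rightarrow> 'n \<Rightarrow> 'n \<times> 'n \<Rightarrow> 'n \<Rightarrow> 'r" where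
  "kern A c q l = sw4 H sr (b c) (\<lambda>h1 h2 h3 h4. sw2 H sr (b (snd q)) (\<lambda>y1 y2.
     ext1 (dbas H (fst q)) (pinv (crd h2) \<odot> A \<odot> crd h1) * ext3 \<theta> A (crd h3) (crd y1) * ext1 (dbas H l) (crd h4 \<odot> crd y2)))"

definition kern2 :: "('n \<Rightarrow> 'r) \<Rightarrow> ('n \<Rightarrow> 'r) \<Rightarrow> 'n \<Rightarrow> 'n \<Rightarrow> 'r" where
  "kern2 A X l c = sw2 H sr (b c) (\<lambda>y1 y2. ext3 \<theta> A X (crd y1) * ext1 (dbas H l) (X \<odot> crd y2))"

lemma ext1_act: "klin H f \<Longrightarrow> ext1 (ract (lact h f) k) A = ext1 f (crd k \<odot> A \<odot> crd h)"
  unfolding ext1_def[of "ract _ _"] ract_def lact_def by (simp add: ext1_crd calc)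

lemma ext1_sigma: "ext1 (sigma H w h k) A = ext3 (theta H w) A (crd h) (crd k)"
  unfolding ext1_def sigma_def by (simp add: tri_crd[OF trilinear_theta] calc)

lemma mulr_kern:
  assumes "P A"
  shows "E A (\<lambda>i. mulr p q (i, l)) = A (fst p) * kern A (snd p) q l"
proof -
  have 1: "E A (\<lambda>i. \<iota> (dmul H (dmul H (dbas H (fst p)) (ract (lact h1 (dbas H (fst q))) (anti H h2))) (sigma H \<omega> h3 y1) (b i))) =
    A (fst p) * (ext1 (dbas H (fst q)) (pinv (crd h2) \<odot> A \<odot> crd h1) * ext3 \<theta> A (crd h3) (crd y1))" for h1 h2 h3 y1
    unfolding ext1_def[symmetric] using assms
    by (simp add: ext1_dmul ext1_act ext1_sigma crd_anti) (simp add: ext1_dbas mult.assoc)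
  have 2: "c * sw2 H sr x F = sw2 H sr x (\<lambda>p q. c * F p q)" for c x F
    by (simp add: sw2_def sr_def sum_distrib_left ac_simps)
  have 4: "c * sw4 H sr x F = sw4 H sr x (\<lambda>p q r s. c * F p q r s)" for c x F
    by (simp add: sw4_def sw3_def 2)
  show ?thesis
    unfolding mulr_def mulc_def kern_def 4 2
    by (simp add: sw_defs \<iota>_sw2 \<iota>_mult sw2_comm E_mult_right 1 mult.assoc) (simp add: calc)
qed

lemma kern_contract: "P X \<Longrightarrow> E X (\<lambda>c. kern A c q l) = hc A X (fst q) * kern2 A X l (snd q)"
  unfolding kern_def kern2_def
  by (simp add: calc hc_pt) (simp add: ext1_dbas mult.assoc sw2_def sr_def sum_distrib_left ac_simps)

lemma kern2_contract: "P A \<Longrightarrow> P X \<Longrightarrow> P Y \<Longrightarrow> E Y (kern2 A X l) = gc.th A X Y * (X \<odot> Y) l"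
  unfolding kern2_def by (simp add: calc th_points) (simp add: ext1_dbas)

lemma hc_closed [simp]: "P A \<Longrightarrow> P X \<Longrightarrow> P (hc A X)"
  by (simp add: hc_pt)

lemma E_sc_mul_kern:
  assumes A: "P A" and d: "value_at d A f X"
  shows "E A (\<lambda>i. sc_mul mulr d d' (i, l)) = f * E X (\<lambda>c. E d' (\<lambda>q. kern A c q l))"
proof -
  have "E A (\<lambda>i. sc_mul mulr d d' (i, l)) = E d (\<lambda>p. E d' (\<lambda>q. E A (\<lambda>i. mulr p q (i, l))))"
    unfolding sc_mul_apply by (subst E_swap) (subst E_swap[of A], rule refl)
  also have "\<dots> = E d (\<lambda>p. A (fst p) * E d' (\<lambda>q. kern A (snd p) q l))"
    using A by (simp add: mulr_kern E_mult_left)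
  also have "\<dots> = f * E X (\<lambda>c. E d' (\<lambda>q. kern A c q l))"
    by (rule value_at_contract[OF d])
  finally show ?thesis .
qed

text \<open>
  The multiplication rule of the twisted quantum double of a group.
\<close>

lemma value_at_mul:
  assumes d: "value_at d A f X" and d': "value_at d' (hc A X) f' Y" and A: "P A" "P X" "P Y"
  shows "value_at (sc_mul mulr d d') A (f * f' * gc.th A X Y) (X \<odot> Y)"
  unfolding value_at_def
proof
  fix l
  have "E A (\<lambda>i. sc_mul mulr d d' (i, l)) = f * E X (\<lambda>c. E d' (\<lambda>q. kern A c q l))"
    by (rule E_sc_mul_kern[OF A(1) d])
  also have "\<dots> = f * E d' (\<lambda>q. hc A X (fst q) * kern2 A X l (snd q))"
    using A by (subst E_swap) (simp add: kern_contract)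
  also have "\<dots> = f * (f' * E Y (kern2 A X l))"
    by (subst value_at_contract[OF d']) (rule refl)
  finally show "E A (\<lambda>i. sc_mul mulr d d' (i, l)) = f * f' * gc.th A X Y * (X \<odot> Y) l"
    using A by (simp add: kern2_contract mult.assoc)
qed

lemma value_at2_mul:
  assumes d: "value_at2 d A B f X Y" and d': "value_at2 d' (hc A X) (hc B Y) f' X' Y'"
    and P: "P A" "P B" "P X" "P Y" "P X'" "P Y'"
  shows "value_at2 (sc_mul (sc_tensor mulr mulr) d d') A B (f * f' * (gc.th A X X' * gc.th B Y Y')) (X \<odot> X') (Y \<odot> Y')"
  unfolding value_at2_def
proof (intro allI)
  fix l l'
  have "E A (\<lambda>i. E B (\<lambda>j. sc_mul (sc_tensor mulr mulr) d d' ((i, l), (j, l')))) =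
     E d (\<lambda>p. E d' (\<lambda>q. E A (\<lambda>i. E B (\<lambda>j. mulr (fst p) (fst q) (i, l) * mulr (snd p) (snd q) (j, l')))))"
    unfolding sc_mul_apply sc_tensor_def fst_conv snd_conv
    by (subst E_swap[of B d], subst E_swap[of A d], subst E_swap[of B d'], subst E_swap[of A d'], rule refl)
  also have "\<dots> = E d (\<lambda>p. (A (fst (fst p)) * B (fst (snd p))) *
       E d' (\<lambda>q. kern A (snd (fst p)) (fst q) l * kern B (snd (snd p)) (snd q) l'))"
    using P by (simp add: mulr_kern E_mult_left E_mult_right) (simp add: E_mult_left[symmetric] ac_simps)
  also have "\<dots> = f * E X (\<lambda>c. E Y (\<lambda>c'. E d' (\<lambda>q. kern A c (fst q) l * kern B c' (snd q) l')))"
    by (rule value_at2_contract[OF d])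
  also have "\<dots> = f * E d' (\<lambda>q. (hc A X (fst (fst q)) * hc B Y (fst (snd q))) * (kern2 A X l (snd (fst q)) * kern2 B Y l' (snd (snd q))))"
    using P by (subst E_swap[of Y], subst E_swap[of X]) (simp add: E_mult_left E_mult_right kern_contract ac_simps)
  also have "\<dots> = f * (f' * E X' (\<lambda>c. E Y' (\<lambda>c'. kern2 A X l c * kern2 B Y l' c')))"
    by (subst value_at2_contract[OF d']) (rule refl)
  also have "\<dots> = f * f' * (gc.th A X X' * gc.th B Y Y') * ((X \<odot> X') l * (Y \<odot> Y') l')"
    using P by (simp add: E_mult_left E_mult_right kern2_contract ac_simps)
  finally show "E A (\<lambda>i. E B (\<lambda>j. sc_mul (sc_tensor mulr mulr) d d' ((i, l), (j, l')))) =
    f * f' * (gc.th A X X' * gc.th B Y Y') * ((X \<odot> X') l * (Y \<odot> Y') l')" .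
qed

text \<open>
  Elements of \<open>D\<^sup>\<omega>(H)\<close> with the same values at all points are equal, by \<open>transfer1\<close> for each coordinate of the values.
\<close>

lemma D_eqI:
  assumes "\<And>A. P A \<Longrightarrow> \<exists>f X. value_at (lift d) A f X \<and> value_at (lift d') A f X"
  shows "d = d'"
proof -
  have "d $ (i, l) = d' $ (i, l)" for i l
    by (rule transfer1[of "\<lambda>i. d $ (i, l)" "\<lambda>i. d' $ (i, l)"])
      (use assms in \<open>force simp: value_at_def lift_def\<close>)
  then show ?thesis by (simp add: vec_eq_iff)
qed

lemma D2_eqI:
  assumes "\<And>A B. P A \<Longrightarrow> P B \<Longrightarrow> \<exists>f X Y. value_at2 (lift d) A B f X Y \<and> value_at2 (lift d') A B f X Y"
  shows "d = d'"
proof -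
  have "d $ ((i, l), (j, m)) = d' $ ((i, l), (j, m))" for i l j m
    by (rule transfer2[of "\<lambda>i j. d $ ((i, l), (j, m))" "\<lambda>i j. d' $ ((i, l), (j, m))"])
      (use assms in \<open>force simp: value_at2_def lift_def\<close>)
  then show ?thesis by (simp add: vec_eq_iff)
qed

text \<open>
  The element \<open>e\<^sup>a # X\<close> for a point \<open>X\<close>; with \<open>X\<close> generic, it stands for all \<open>e\<^sup>a # h\<close>.
\<close>

definition elem :: "'n \<Rightarrow> ('n \<Rightarrow> 'r) \<Rightarrow> 'n \<times> 'n \<Rightarrow> 'r" where
  "elem a X p = (if fst p = a then X (snd p) else 0)"

lemma E_elem: "E (elem a X) F = E X (\<lambda>c. F (a, c))"
proof -
  have "(\<Sum>c\<in>UNIV. elem a X (i, c) * F (i, c)) = (if i = a then E X (\<lambda>c. F (a, c)) else 0)" for i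
    by (simp add: elem_def E_def)
  then show ?thesis unfolding E_pair by simp
qed

lemma value_at_elem: "value_at (elem a X) A (A a) X"
proof -
  have "E A (\<lambda>i. elem a X (i, c)) = A a * X c" for c
  proof -
    have "A i * elem a X (i, c) = (if i = a then A a * X c else 0)" for i by (simp add: elem_def)
    then show ?thesis by (simp add: E_def)
  qed
  then show ?thesis by (simp add: value_at_def)
qed

lemma value_at_hash: "value_at (lift (hash H f h)) A (ext1 f A) (crd h)"
  unfolding value_at_def lift_def hash_nth by (simp add: \<iota>_mult E_mult_right ext1_def crd_def)

lemma value_at_hash_one: "value_at (lift (hash H f 1)) A (ext1 f A) pone"
  using value_at_hash[of f 1] by (simp add: crd_one)

lemma hc_hc: "P A \<Longrightarrow> P X \<Longrightarrow> P Y \<Longrightarrow> hc (hc A X) Y = hc A (X \<odot> Y)"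
  by (simp add: hc_pt pmul_assoc pinv_pmul)

lemma hc_pone [simp]: "hc A pone = A"
  by (simp add: hc_pt pmul_one pmul_pone_cancel)

text \<open>
  Associativity is tested on the products of \<open>e\<^sup>a # X\<close>, \<open>e\<^sup>a\<^sup>' # Y\<close> and \<open>e\<^sup>a\<^sup>'\<^sup>' # Z\<close> at \<open>A\<close> for generic points
  \<open>A, X, Y, Z\<close>, where it is \<open>th_cocycle\<close>.
\<close>

lemma mulc_assoc: "sc_assoc mulc"
  unfolding sc_assoc_def
proof (intro allI)
  fix p q r t :: "'n \<times> 'n"
  obtain a c where p: "p = (a, c)" by fastforce
  obtain a' c' where q: "q = (a', c')" by fastforce
  obtain a'' c'' where r: "r = (a'', c'')" by fastforce
  obtain i l where t: "t = (i, l)" by fastforce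
  have K: "E A (\<lambda>i. E X (\<lambda>c. E Y (\<lambda>c'. E Z (\<lambda>c''. \<iota> (E (mulc (a, c) (a', c')) (\<lambda>s. mulc s (a'', c'') (i, l))))))) =
      E A (\<lambda>i. E X (\<lambda>c. E Y (\<lambda>c'. E Z (\<lambda>c''. \<iota> (E (mulc (a', c') (a'', c'')) (\<lambda>s. mulc (a, c) s (i, l)))))))" (is "?l = ?r")
    if pt: "P A" "P X" "P Y" "P Z" for A X Y Z
  proof -
    have "?l = E A (\<lambda>i. sc_mul mulr (sc_mul mulr (elem a X) (elem a' Y)) (elem a'' Z) (i, l))"
      unfolding sc_mul_apply[of _ "sc_mul mulr _ _"] E_sc_mul E_elem
      by (subst (2) E_swap) (simp add: \<iota>_E mulr_def[abs_def])
    also have "\<dots> = A a * hc A X a' * gc.th A X Y * hc A (X \<odot> Y) a'' * gc.th A (X \<odot> Y) Z * (X \<odot> Y \<odot> Z) l"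
      using value_at_mul[OF value_at_mul[OF value_at_elem value_at_elem] value_at_elem, of A X Y Z a a' a''] pt
      by (simp add: value_at_def)
    also have "\<dots> = A a * (hc A X a' * hc (hc A X) Y a'' * gc.th (hc A X) Y Z) * gc.th A X (Y \<odot> Z) * (X \<odot> (Y \<odot> Z)) l"
      using pt gc.th_cocycle[of A X Y Z] by (simp add: hc_hc hc_conj[symmetric] ac_simps pmul_assoc)
    also have "\<dots> = E A (\<lambda>i. sc_mul mulr (elem a X) (sc_mul mulr (elem a' Y) (elem a'' Z)) (i, l))"
      using value_at_mul[OF value_at_elem value_at_mul[OF value_at_elem value_at_elem], of A X Y Z a a' a''] pt
      by (simp add: value_at_def)
    also have "\<dots> = ?r"
      unfolding sc_mul_apply[of _ "elem a X"] E_sc_mul E_elem by (simp add: \<iota>_E mulr_def[abs_def])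
    finally show ?thesis .
  qed
  show "E (mulc p q) (\<lambda>s. mulc s r t) = E (mulc q r) (\<lambda>s. mulc p s t)"
    unfolding p q r t by (rule transfer4[OF K])
qed

abbreviation "one \<equiv> hash H (cou H) 1"

lemma \<iota>_of_bool: "\<iota> (of_bool Q) = of_bool Q"
  by (simp add: \<iota>_one \<iota>_zero)

lemma mulc_unit: "sc_unit mulc (($) one)"
  unfolding sc_unit_def
proof (intro allI conjI)
  fix q t :: "'n \<times> 'n"
  obtain a c where q: "q = (a, c)" by fastforce
  obtain i l where t: "t = (i, l)" by fastforce
  have R: "E A (\<lambda>i. E X (\<lambda>c. \<iota> (of_bool ((a, c) = (i, l))))) = A a * X l" for A X
  proof -
    have "of_bool ((a, c) = (i, l)) = (of_bool (i = a) * of_bool (c = l) :: 'r)" for i c by auto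
    then show ?thesis by (simp only: \<iota>_of_bool E_mult_left E_mult_right E_of_bool)
  qed
  have 1: "E A (\<lambda>i. E X (\<lambda>c. \<iota> (E (($) one) (\<lambda>p. mulc p (a, c) (i, l))))) = E A (\<lambda>i. E X (\<lambda>c. \<iota> (of_bool ((a, c) = (i, l)))))"
    (is "?l = _") if pt: "P A" "P X" for A X
  proof -
    have "?l = E A (\<lambda>i. sc_mul mulr (lift one) (elem a X) (i, l))"
      unfolding sc_mul_apply E_elem by (subst (2) E_swap) (simp add: \<iota>_E mulr_def lift_def)
    also have "\<dots> = A a * X l"
      using value_at_mul[OF value_at_hash_one value_at_elem, of A X "cou H" a] pt by (simp add: value_at_def pmul_one)
    finally show ?thesis unfolding R .
  qed
  have 2: "E A (\<lambda>i. E X (\<lambda>c. \<iota> (E (($) one) (\<lambda>p. mulc (a, c) p (i, l))))) = E A (\<lambda>i. E X (\<lambda>c. \<iota> (of_bool ((a, c) = (i, l)))))"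
    (is "?l = _") if pt: "P A" "P X" for A X
  proof -
    have "?l = E A (\<lambda>i. sc_mul mulr (elem a X) (lift one) (i, l))"
      unfolding sc_mul_apply E_elem by (simp add: \<iota>_E mulr_def lift_def)
    also have "\<dots> = A a * X l"
      using value_at_mul[OF value_at_elem value_at_hash_one, of A X a "cou H"] pt by (simp add: value_at_def pmul_one)
    finally show ?thesis unfolding R .
  qed
  show "E (($) one) (\<lambda>p. mulc p q t) = of_bool (q = t)" "E (($) one) (\<lambda>p. mulc q p t) = of_bool (q = t)"
    unfolding q t by (rule transfer2[OF 1], assumption+) (rule transfer2[OF 2], assumption+)
qed

lemma D_mul_assoc: "D_mul H \<omega> (D_mul H \<omega> x y) z = D_mul H \<omega> x (D_mul H \<omega> y z)"
  using sc_mul_assoc[OF mulc_assoc] by (simp add: vec_eq_iff D_mul_nth[abs_def])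

lemma D_mul_one: "D_mul H \<omega> one x = x" "D_mul H \<omega> x one = x"
  using sc_mul_unit[OF mulc_unit] by (simp_all add: vec_eq_iff D_mul_nth[abs_def])

end

section \<open>Comultiplication and R-matrix\<close>

lemma E_rotate: "E X (\<lambda>i. E Y (\<lambda>j. E Z (\<lambda>l. E W (\<lambda>m. F i j l m)))) =
  E Y (\<lambda>j. E Z (\<lambda>l. E W (\<lambda>m. E X (\<lambda>i. F i j l m))))"
  by (simp only: E_swap[of X Y] E_swap[of X Z] E_swap[of X W])

lemma axis_E: "E (($) (axis p (1::'r::comm_ring_1))) F = F p"
proof -
  have "axis p (1::'r) $ q * F q = (if q = p then F q else 0)" for q
    by (simp add: axis_def)
  then show ?thesis by (simp add: E_def)
qed

lemma vsw2_nth: "vsw2 X F $ t = E (($) X) (\<lambda>p. F (axis (fst p) 1) (axis (snd p) 1) $ t)"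
  by (simp add: vsw2_def E_pair)

lemma vsw3_nth: "vsw3 X F $ t = E (($) X) (\<lambda>p. F (axis (fst p) 1) (axis (fst (snd p)) 1) (axis (snd (snd p)) 1) $ t)"
  by (simp add: vsw3_def E_pair sum_pair)

lemma vtens2_nth: "vtens2 x y $ p = x $ fst p * y $ snd p"
  by (simp add: vtens2_def case_prod_beta)

lemma vtens3_nth: "vtens3 x y z $ p = x $ fst p * (y $ fst (snd p) * z $ snd (snd p))"
  by (simp add: vtens3_def case_prod_beta mult.assoc)

lemma sc_inverse_unique:
  assumes m: "sc_assoc m" "sc_unit m u" and inv: "sc_mul m x y = u" "sc_mul m z x = u"
  shows "y = z"
proof -
  have "y = sc_mul m (sc_mul m z x) y" using inv sc_mul_unit[OF m(2)] by simp
  also have "\<dots> = sc_mul m z (sc_mul m x y)" by (rule sc_mul_assoc[OF m(1)])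
  also have "\<dots> = z" using inv sc_mul_unit[OF m(2)] by simp
  finally show ?thesis .
qed

context cocycle_points
begin

abbreviation "D \<equiv> D_omega H \<omega>"

lemma D_omega_simps [simp]:
  "qmul D = D_mul H \<omega>" "qone D = one" "qcomul D = D_comul H \<omega>" "qassoc D = D_assoc H \<omega>"
  "qanti D = D_anti H \<omega>" "qalpha D = one" "qbeta D = hash H \<beta> 1" "qR D = D_R H"
  by (simp_all add: D_omega_def)

lemma D_mul_axis: "D_mul H \<omega> (axis p 1) (axis q 1) $ t = mulc p q t"
  by (simp add: D_mul_nth sc_mul_apply axis_E)

abbreviation "mulc2 \<equiv> sc_tensor mulc mulc"

abbreviation "mulc3 \<equiv> sc_tensor mulc mulc2"

lemma qmul2_nth: "($) (qmul2 D X Y) = sc_mul mulc2 (($) X) (($) Y)"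
  by (rule ext) (simp add: qmul2_def vsw2_nth sc_mul_apply sc_tensor_def vtens2_nth D_mul_axis)

lemma qmul3_nth: "($) (qmul3 D X Y) = sc_mul mulc3 (($) X) (($) Y)"
  by (rule ext) (simp add: qmul3_def vsw3_nth sc_mul_apply sc_tensor_def vtens3_nth D_mul_axis)

lemma mulc2_assoc: "sc_assoc mulc2" and mulc3_assoc: "sc_assoc mulc3"
  by (simp_all add: sc_assoc_tensor mulc_assoc)

lemma mulc2_unit: "sc_unit mulc2 (($) (vtens2 one one))"
  using sc_unit_tensor[OF mulc_unit mulc_unit] by (simp add: vtens2_nth[abs_def])

lemma mulc3_unit: "sc_unit mulc3 (($) (vtens3 one one one))"
  using sc_unit_tensor[OF mulc_unit mulc2_unit] by (simp add: vtens3_nth[abs_def] vtens2_nth)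

lemma nth_inject: "($) x = ($) y \<longleftrightarrow> x = y"
  by (simp add: vec_eq_iff fun_eq_iff)

lemma qmul2_assoc: "qmul2 D (qmul2 D X Y) Z = qmul2 D X (qmul2 D Y Z)"
  by (simp add: nth_inject[symmetric] qmul2_nth sc_mul_assoc[OF mulc2_assoc])

lemma qmul2_one: "qmul2 D (vtens2 one one) X = X" "qmul2 D X (vtens2 one one) = X"
  by (simp_all add: nth_inject[symmetric] qmul2_nth sc_mul_unit[OF mulc2_unit])

lemma qinv2_eq:
  assumes "qmul2 D X Y = vtens2 one one" "qmul2 D Y X = vtens2 one one"
  shows "qinv2 D X = Y"
  unfolding qinv2_def D_omega_simps
proof (rule the_equality)
  fix Z assume Z: "qmul2 D X Z = vtens2 one one \<and> qmul2 D Z X = vtens2 one one"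
  have "($) Z = ($) Y"
    by (rule sc_inverse_unique[OF mulc2_assoc mulc2_unit, of "($) X"]) (simp_all add: qmul2_nth[symmetric] Z assms)
  then show "Z = Y" by (simp add: nth_inject)
qed (use assms in simp)

lemma qinv3_eq:
  assumes "qmul3 D X Y = vtens3 one one one" "qmul3 D Y X = vtens3 one one one"
  shows "qinv3 D X = Y"
  unfolding qinv3_def D_omega_simps
proof (rule the_equality)
  fix Z assume Z: "qmul3 D X Z = vtens3 one one one \<and> qmul3 D Z X = vtens3 one one one"
  have "($) Z = ($) Y"
    by (rule sc_inverse_unique[OF mulc3_assoc mulc3_unit, of "($) X"]) (simp_all add: qmul3_nth[symmetric] Z assms)
  then show "Z = Y" by (simp add: nth_inject)
qed (use assms in simp)

lemma lift_qmul2: "lift (qmul2 D X Y) = sc_mul (sc_tensor mulr mulr) (lift X) (lift Y)"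
  by (rule ext) (simp add: lift_def qmul2_nth sc_mul_apply \<iota>_E sc_tensor_def mulr_def \<iota>_mult)

lemma value_at2_qmul2:
  assumes "value_at2 (lift d) A B f X Y" "value_at2 (lift d') (hc A X) (hc B Y) f' X' Y'"
    and "P A" "P B" "P X" "P Y" "P X'" "P Y'"
  shows "value_at2 (lift (qmul2 D d d')) A B (f * f' * (gc.th A X X' * gc.th B Y Y')) (X \<odot> X') (Y \<odot> Y')"
  unfolding lift_qmul2 by (rule value_at2_mul[OF assms])

lemma value_at_D_mul:
  assumes "value_at (lift d) A f X" "value_at (lift d') (hc A X) f' Y" and "P A" "P X" "P Y"
  shows "value_at (lift (D_mul H \<omega> d d')) A (f * f' * gc.th A X Y) (X \<odot> Y)"
  unfolding lift_D_mul by (rule value_at_mul[OF assms])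

lemma value_at2_vtens2:
  assumes "value_at (lift d) A f X" "value_at (lift d') B f' Y"
  shows "value_at2 (lift (vtens2 d d')) A B (f * f') X Y"
  using assms unfolding value_at2_def value_at_def lift_def vtens2_nth
  by (simp add: \<iota>_mult E_mult_left E_mult_right)

lemma value_at_one: "P A \<Longrightarrow> value_at (lift one) A 1 pone"
  using value_at_hash_one[of "cou H" A] by simp

lemma value_at2_one: "P A \<Longrightarrow> P B \<Longrightarrow> value_at2 (lift (vtens2 one one)) A B 1 pone pone"
  using value_at2_vtens2[OF value_at_one value_at_one] by simp

lemma D_R_nth: "D_R H $ ((i, l), (j, m)) = dbas H l 1 * (cou H (b j) * dbas H m (b i))"
proof -
  have "D_R H $ ((i, l), (j, m)) = (\<Sum>c\<in>UNIV. if c = i then dbas H l 1 * (cou H (b j) * dbas H m (b i)) else 0)"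
    unfolding D_R_def sum_component vtens2_nth hash_nth
    by (intro sum.cong refl) (simp add: dbas_bas)
  then show ?thesis by simp
qed

lemma value_at2_R: "P A \<Longrightarrow> P B \<Longrightarrow> value_at2 (lift (D_R H)) A B 1 pone A"
  unfolding value_at2_def lift_def D_R_nth by (simp add: calc) (simp add: ext1_dbas)

definition swap :: "'k ^ ('a \<times> 'a) \<Rightarrow> 'k ^ ('a::finite \<times> 'a)" where
  "swap X = (\<chi> p. X $ (snd p, fst p))"

lemma value_at2_swap: "value_at2 (lift X) B A f Y Z \<Longrightarrow> value_at2 (lift (swap X)) A B f Z Y"
  unfolding value_at2_def lift_def swap_def by (subst E_swap) (simp add: mult.commute)

lemma qR21_eq: "qR21 D = swap (D_R H)"
proof -
  have "qR21 D $ (p, q) = D_R H $ (q, p)" for p q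
  proof -
    have "axis (snd r) 1 $ p * axis (fst r) 1 $ q = (axis (q, p) 1 $ r :: 'k)" for r
      by (auto simp: axis_def prod_eq_iff)
    then have "qR21 D $ (p, q) = E (($) (D_R H)) (($) (axis (q, p) 1))"
      by (simp add: qR21_def vsw2_nth vtens2_nth)
    also have "\<dots> = E (($) (axis (q, p) 1)) (($) (D_R H))"
      by (simp add: E_def mult.commute)
    finally show ?thesis by (simp add: axis_E)
  qed
  then show ?thesis by (simp add: vec_eq_iff swap_def)
qed

text \<open>
  The function \<open>(a, b) \<mapsto> \<theta>(b; a\<inverse>, a)\<inverse> \<cdot> 1 \<otimes> a\<inverse>\<close>, the inverse of \<open>R(a, b) = 1 \<otimes> a\<close>.
\<close>

definition Rinv :: "'k ^ (('n \<times> 'n) \<times> ('n \<times> 'n))" where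
  "Rinv = (\<chi> t. dbas H (snd (fst t)) 1 * sw3 H (*) (b (fst (fst t))) (\<lambda>p q r.
     \<sigma>' (anti H p) q (b (fst (snd t))) * dbas H (snd (snd t)) (anti H r)))"

lemma value_at2_Rinv: "P A \<Longrightarrow> P B \<Longrightarrow> value_at2 (lift Rinv) A B (gc.th' B (pinv A) A) pone (pinv A)"
  unfolding value_at2_def lift_def Rinv_def
  by (simp add: calc tri_crd[OF tri_sigma_inv] th'_points) (simp add: ext1_dbas)

lemma pmul_cancel: "P X \<Longrightarrow> pinv X \<odot> X = pone" "P X \<Longrightarrow> X \<odot> pinv X = pone"
  by (simp_all add: pinv_left pinv_right)

lemma R_Rinv: "qmul2 D (D_R H) Rinv = vtens2 one one"
proof (rule D2_eqI)
  fix A B assume P: "P A" "P B"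
  have "gc.th' (hc B A) (pinv A) A * gc.th B A (pinv A) = 1"
    using hc_closed[OF P(2,1)] gc.th_inv_right[of B A] gc.th_inverse[of "hc B A" "pinv A" A] P
    by (simp add: hc_conj mult.commute)
  then have "value_at2 (lift (qmul2 D (D_R H) Rinv)) A B 1 pone pone"
    using value_at2_qmul2[OF value_at2_R value_at2_Rinv, of A B] P by (simp add: pmul_one pmul_cancel)
  then show "\<exists>f X Y. value_at2 (lift (qmul2 D (D_R H) Rinv)) A B f X Y \<and> value_at2 (lift (vtens2 one one)) A B f X Y"
    using value_at2_one[OF P] by blast
qed

lemma Rinv_R: "qmul2 D Rinv (D_R H) = vtens2 one one"
proof (rule D2_eqI)
  fix A B assume P: "P A" "P B"
  have "gc.th' B (pinv A) A * gc.th B (pinv A) A = 1"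
    using gc.th_inverse[of B "pinv A" A] P by (simp add: mult.commute)
  then have "value_at2 (lift (qmul2 D Rinv (D_R H))) A B 1 pone pone"
    using value_at2_qmul2[OF value_at2_Rinv value_at2_R, of A B] P by (simp add: pmul_one pmul_cancel)
  then show "\<exists>f X Y. value_at2 (lift (qmul2 D Rinv (D_R H))) A B f X Y \<and> value_at2 (lift (vtens2 one one)) A B f X Y"
    using value_at2_one[OF P] by blast
qed

lemma qmul2_swap: "qmul2 D (swap X) (swap Y) = swap (qmul2 D X Y)"
proof -
  have swap_E: "E (($) (swap Z)) F = E (($) Z) (\<lambda>p. F (snd p, fst p))" for Z F
    unfolding E_pair swap_def by simp (rule sum.swap)
  have "qmul2 D (swap X) (swap Y) $ t = swap (qmul2 D X Y) $ t" for t
    by (simp add: qmul2_nth sc_mul_apply swap_E sc_tensor_def mult.commute swap_def[of "qmul2 D X Y"])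
  then show ?thesis by (simp add: vec_eq_iff)
qed

lemma swap_one: "swap (vtens2 one one) = vtens2 one one"
  by (simp add: vec_eq_iff swap_def vtens2_nth mult.commute)

abbreviation "M \<equiv> qmul2 D (swap (D_R H)) (D_R H)"

lemma M_inverse: "qmul2 D M (qinv2 D M) = vtens2 one one"
proof -
  have 1: "qmul2 D M (qmul2 D Rinv (swap Rinv)) = vtens2 one one"
    by (metis qmul2_assoc R_Rinv qmul2_one(1) qmul2_swap swap_one)
  have 2: "qmul2 D (qmul2 D Rinv (swap Rinv)) M = vtens2 one one"
    by (metis qmul2_assoc Rinv_R qmul2_one(1) qmul2_swap swap_one)
  show ?thesis using qinv2_eq[OF 1 2] 1 by simp
qed

lemma value_at2_M:
  assumes "P A" "P B"
  shows "value_at2 (lift M) A B 1 B (hc A B)"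
  using value_at2_qmul2[OF value_at2_swap[OF value_at2_R] value_at2_R, of B A] assms by (simp add: pmul_one)

lemma \<iota>_dsw2: "\<iota> (dsw2 H (*) B F) = (\<Sum>i\<in>UNIV. \<Sum>j\<in>UNIV. \<iota> (B (b i) (b j)) * \<iota> (F (dbas H i) (dbas H j)))"
  by (simp add: dsw2_def \<iota>_sum \<iota>_mult)

lemma dsw2_points:
  "(\<Sum>i\<in>UNIV. \<Sum>j\<in>UNIV. \<iota> (B (b i) (b j)) * (X i * Y j)) = ext2 B X Y"
  by (simp add: ext2_def E_def sum_distrib_left ac_simps)

lemma value_at2_D_comul:
  assumes d: "value_at (lift d) (A \<odot> B) f X" and P: "P A" "P B" "P X"
  shows "value_at2 (lift (D_comul H \<omega> d)) A B (f * gc.gm A B X) X X"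
  unfolding value_at2_def
proof (intro allI)
  fix l l'
  let ?C = "\<lambda>a c i i'. sw3 H (*) (b c) (\<lambda>h1 h2 h3. dsw2 H (*) (kappa H \<omega> h1) (\<lambda>k1 k2. dsw2 H (*) (dcomul (dbas H a)) (\<lambda>f1 f2.
       (dmul H k1 f1 (b i) * dbas H l h2) * (dmul H k2 f2 (b i') * dbas H l' h3))))"
  have d_nth: "D_comul H \<omega> d $ ((i, l), (i', l')) = E (($) d) (\<lambda>p. ?C (fst p) (snd p) i i')" for i i'
    by (simp add: D_comul_def hash_lift_nth sw3_nth dsw2_nth vtens2_nth hash_nth)
  have dm: "E A (\<lambda>i. \<iota> (dmul H f g (b i))) = ext1 f A * ext1 g A" if "P A" for f g A
    using ext1_dmul[OF that] by (simp add: ext1_def)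
  have inner: "E A (\<lambda>i. E B (\<lambda>i'. \<iota> (dsw2 H (*) (kappa H \<omega> h1) (\<lambda>k1 k2. dsw2 H (*) (dcomul (dbas H a)) (\<lambda>f1 f2.
       (dmul H k1 f1 (b i) * dbas H l h2) * (dmul H k2 f2 (b i') * dbas H l' h3)))))) =
       (A \<odot> B) a * (ext3 (kappa H \<omega>) (crd h1) A B * (crd h2 l * crd h3 l'))" (is "?i = _") for h1 h2 h3 a
  proof -
    have "?i =
      (\<Sum>p\<in>UNIV. \<Sum>q\<in>UNIV. \<iota> (kappa H \<omega> h1 (b p) (b q)) * (\<Sum>u\<in>UNIV. \<Sum>v\<in>UNIV. \<iota> (dcomul (dbas H a) (b u) (b v)) *
        ((A p * A u * crd h2 l) * (B q * B v * crd h3 l'))))"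
      using P by (simp add: \<iota>_dsw2 E_sum E_mult_left E_mult_right \<iota>_mult dm ext1_dbas crd_def)
    also have "\<dots> = (\<Sum>p\<in>UNIV. \<Sum>q\<in>UNIV. \<iota> (kappa H \<omega> h1 (b p) (b q)) * (A p * B q)) *
       (\<Sum>u\<in>UNIV. \<Sum>v\<in>UNIV. \<iota> (dcomul (dbas H a) (b u) (b v)) * (A u * B v)) * (crd h2 l * crd h3 l')"
    proof -
      let ?s = "\<Sum>u\<in>UNIV. \<Sum>v\<in>UNIV. \<iota> (dcomul (dbas H a) (b u) (b v)) * (A u * B v)"
      have "(\<Sum>u\<in>UNIV. \<Sum>v\<in>UNIV. \<iota> (dcomul (dbas H a) (b u) (b v)) *
        ((A p * A u * crd h2 l) * (B q * B v * crd h3 l'))) = (A p * B q) * (?s * (crd h2 l * crd h3 l'))" for p q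
        by (simp add: sum_distrib_left sum_distrib_right ac_simps)
      then show ?thesis by (simp only: sum_distrib_right mult.assoc)
    qed
    also have "\<dots> = ext2 (kappa H \<omega> h1) A B * (A \<odot> B) a * (crd h2 l * crd h3 l')"
      unfolding dsw2_points by (simp add: pmul_def dcomul_def[abs_def])
    also have "ext2 (kappa H \<omega> h1) A B = ext3 (kappa H \<omega>) (crd h1) A B"
      unfolding ext2_def by (simp add: tri_crd[OF trilinear_kappa] calc)
    finally show ?thesis by (simp only: ac_simps)
  qed
  have "E A (\<lambda>i. E B (\<lambda>i'. lift (D_comul H \<omega> d) ((i, l), (i', l')))) =
     E (lift d) (\<lambda>p. (A \<odot> B) (fst p) * sw3 H sr (b (snd p)) (\<lambda>h1 h2 h3. ext3 (kappa H \<omega>) (crd h1) A B * (crd h2 l * crd h3 l')))"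
  proof -
    have sw3c: "c * sw3 H sr x F = sw3 H sr x (\<lambda>p q r. c * F p q r)" for c x F
      by (simp add: sw3_def sw2_def sr_def sum_distrib_left ac_simps)
    have "E A (\<lambda>i. E B (\<lambda>i'. \<iota> (?C a c i i'))) =
      (A \<odot> B) a * sw3 H sr (b c) (\<lambda>h1 h2 h3. ext3 (kappa H \<omega>) (crd h1) A B * (crd h2 l * crd h3 l'))" for a c
      unfolding \<iota>_sw3 sw3_comm inner sw3c ..
    then show ?thesis
      unfolding lift_def d_nth \<iota>_E by (subst E_swap[of B], subst E_swap[of A]) simp
  qed
  also have "\<dots> = f * E X (\<lambda>c. sw3 H sr (b c) (\<lambda>h1 h2 h3. ext3 (kappa H \<omega>) (crd h1) A B * (crd h2 l * crd h3 l')))"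
    by (rule value_at_contract[OF d])
  also have "\<dots> = f * gc.gm A B X * (X l * X l')"
    using P by (simp add: ext1_dbas[symmetric]) (simp add: calc ext3_kappa gm_points mult.assoc)
  finally show "E A (\<lambda>i. E B (\<lambda>i'. lift (D_comul H \<omega> d) ((i, l), (i', l')))) = f * gc.gm A B X * (X l * X l')" .
qed

section \<open>Antipode\<close>

definition antic :: "'n \<times> 'n \<Rightarrow> 'n \<times> 'n \<Rightarrow> 'k" where
  "antic p t = sw4 H (*) (b (snd p)) (\<lambda>h1 h2 h3 h4. dsw2 H (*) (\<kappa>' h4) (\<lambda>k1 k2.
     D_mul H \<omega> (hash H (cou H) (anti H h1))
       (hash H (dmul H (dmul H (\<sigma>' h2 (anti H h3)) (danti H (dmul H (dbas H (fst p)) k1))) k2) 1) $ t))"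

lemma D_anti_nth: "D_anti H \<omega> d $ t = E (($) d) (\<lambda>p. antic p t)"
  by (simp add: D_anti_def hash_lift_nth sw4_nth dsw2_nth antic_def)

lemma hash_kern:
  assumes "P A" "P X"
  shows "E X (\<lambda>c. E (lift (hash H f 1)) (\<lambda>q. kern A c q l)) = ext1 f (hc A X) * X l"
proof -
  have "E X (\<lambda>c. E (lift (hash H f 1)) (\<lambda>q. kern A c q l)) =
      E (lift (hash H f 1)) (\<lambda>q. hc A X (fst q) * kern2 A X l (snd q))"
    using assms by (subst E_swap) (simp add: kern_contract)
  also have "\<dots> = ext1 f (hc A X) * E pone (kern2 A X l)"
    using assms by (subst value_at_contract[OF value_at_hash_one]) simp_all
  finally show ?thesis using assms by (simp add: kern2_contract pmul_one)
qed

lemma ext1_danti: "klin H f \<Longrightarrow> ext1 (danti H f) A = ext1 f (pinv A)"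
  unfolding danti_def comp_def by (rule ext1_pinv_eq)

text \<open>
  For \<open>g = A\<close> and \<open>h = X\<close>, this is \<open>s(\<phi> # h)(g) = \<theta>(hgh\<inverse>; h, h\<inverse>)\<inverse> \<gamma>(hg\<inverse>h\<inverse>, hgh\<inverse>; h)\<inverse> \<phi>(hg\<inverse>h\<inverse>) h\<inverse>\<close> for
  \<open>\<phi> = e\<^sup>a\<close>.
\<close>

lemma antic_points:
  assumes P: "P A" "P X"
  defines "A' \<equiv> hc A (pinv X)"
  shows "E X (\<lambda>c. E A (\<lambda>i. \<iota> (antic (a, c) (i, l)))) =
    gc.th' A' X (pinv X) * gc.gm' (pinv A') A' X * pinv A' a * pinv X l"
proof -
  have A': "P A'" using P by (simp add: A'_def)
  let ?f = "\<lambda>h2 h3 p q. dmul H (dmul H (\<sigma>' h2 (anti H h3)) (danti H (dmul H (dbas H a) (dbas H p)))) (dbas H q)"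
  let ?K = "\<lambda>h2 h3 p q c. E (lift (hash H (?f h2 h3 p q) 1)) (\<lambda>r. kern A c r l)"
  have 1: "E A (\<lambda>i. \<iota> (D_mul H \<omega> (hash H (cou H) h1) (hash H f 1) $ (i, l))) =
     E (crd h1) (\<lambda>c. E (lift (hash H f 1)) (\<lambda>r. kern A c r l))" for h1 f
    using E_sc_mul_kern[OF P(1) value_at_hash[of "cou H" h1], of "lift (hash H f 1)" l] P(1)
    unfolding lift_D_mul[symmetric] by (simp add: lift_def)
  have f: "ext1 (?f h2 h3 p q) A' = ext3 \<sigma>' (crd h2) (pinv (crd h3)) A' * (pinv A' a * pinv A' p) * A' q" for h2 h3 p q
  proof -
    have "ext1 (\<sigma>' h2 (anti H h3)) A' = ext3 \<sigma>' (crd h2) (pinv (crd h3)) A'"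
      unfolding ext1_def by (simp add: tri_crd[OF tri_sigma_inv] calc)
    then show ?thesis using A' by (simp add: ext1_dmul ext1_danti ext1_dbas)
  qed
  have "E X (\<lambda>c. E A (\<lambda>i. \<iota> (antic (a, c) (i, l)))) =
    E X (\<lambda>i1. E X (\<lambda>i2. E X (\<lambda>i3. E X (\<lambda>i4. \<Sum>p\<in>UNIV. \<Sum>q\<in>UNIV. \<iota> (\<kappa>' (b i4) (b p) (b q)) *
      E (crd (anti H (b i1))) (?K (b i2) (b i3) p q)))))"
    using P by (simp add: antic_def sw_defs \<iota>_sw2 sw2_comm E_sw2 \<iota>_dsw2 E_sum E_mult_left 1)
  \<comment> \<open>the component \<open>h\<^sub>1\<close> occurs in the outer product only and is evaluated first\<close>
  also have "\<dots> = E X (\<lambda>i2. E X (\<lambda>i3. E X (\<lambda>i4. E X (\<lambda>i1. \<Sum>p\<in>UNIV. \<Sum>q\<in>UNIV. \<iota> (\<kappa>' (b i4) (b p) (b q)) *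
      E (crd (anti H (b i1))) (?K (b i2) (b i3) p q)))))"
    by (rule E_rotate)
  also have "\<dots> = E X (\<lambda>i2. E X (\<lambda>i3. E X (\<lambda>i4. \<Sum>p\<in>UNIV. \<Sum>q\<in>UNIV. \<iota> (\<kappa>' (b i4) (b p) (b q)) *
      E (pinv X) (?K (b i2) (b i3) p q))))"
    by (simp add: E_sum E_mult_left E_EV[symmetric] calc)
  also have "\<dots> = E X (\<lambda>i2. E X (\<lambda>i3. E X (\<lambda>i4. (\<Sum>p\<in>UNIV. \<Sum>q\<in>UNIV. \<iota> (\<kappa>' (b i4) (b p) (b q)) * (pinv A' p * A' q)) *
      (ext3 \<sigma>' (crd (b i2)) (pinv (crd (b i3))) A' * (pinv A' a * pinv X l)))))"
    using P by (simp add: hash_kern A'_def[symmetric] f) (simp add: sum_distrib_right sum_distrib_left ac_simps)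
  also have "\<dots> = ext3 \<kappa>' X (pinv A') A' * (ext3 \<sigma>' X (pinv X) A' * (pinv A' a * pinv X l))"
    unfolding dsw2_points ext2_def by (simp add: tri_crd[OF tri_kappa_inv] calc)
  finally show ?thesis using P A' by (simp add: gm'_points th'_points ac_simps)
qed

text \<open>
  The scalar factor \<open>\<theta>(hgh\<inverse>; h, h\<inverse>)\<inverse> \<gamma>(hg\<inverse>h\<inverse>, hgh\<inverse>; h)\<inverse>\<close> of the antipode, as a bilinear form on \<open>H\<close>.  It has to be a
  form on \<open>H\<close> and not only a function of points, as the traces are sums over a basis of \<open>H\<close>.
\<close>

definition anti_coeff :: "'h \<Rightarrow> 'h \<Rightarrow> 'k" where
  "anti_coeff h g = sw6 H (*) h (\<lambda>h1 h2 h3 h4 h5 h6. sw3 H (*) g (\<lambda>g1 g2 g3.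
     \<sigma>' h1 (anti H h2) (hact H g1 (anti H h3)) *
     \<kappa>' h4 (hact H (anti H g2) (anti H h5)) (hact H g3 (anti H h6))))"

lemma klin_anti_coeff: "klin H (\<lambda>x. anti_coeff x y)" "klin H (anti_coeff x)"
  unfolding anti_coeff_def sw_defs by (intro klin_sw)+

lemma hc_pinv: "P A \<Longrightarrow> P X \<Longrightarrow> hc (pinv A) X = pinv (hc A X)"
  by (simp add: hc_pt pinv_pmul pinv_pinv pmul_assoc)

lemma anti_coeff_points:
  assumes "P A" "P X"
  shows "ext2 anti_coeff X A = gc.th' (hc A (pinv X)) X (pinv X) * gc.gm' (pinv (hc A (pinv X))) (hc A (pinv X)) X"
  using assms unfolding ext2_def anti_coeff_def
  by (simp add: calc tri_crd[OF tri_sigma_inv] tri_crd[OF tri_kappa_inv] th'_points gm'_points hc_pinv)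

lemma hc_self: "P A \<Longrightarrow> hc A (pinv A) = A" "P A \<Longrightarrow> hc A A = A"
  by (simp_all add: hc_pt pinv_pinv pmul_assoc pinv_right pinv_left pmul_one)

lemma anti_coeff_diag: "P A \<Longrightarrow> ext2 anti_coeff A A = gc.bt' A * gc.bt' A"
  by (simp add: anti_coeff_points hc_self gc.th'_self_inv gc.gm'_inv_self)

lemma E_antic:
  assumes "P A" "P X"
  shows "E X (\<lambda>c. E A (\<lambda>i. \<iota> (antic (a, c) (i, l)))) = ext2 anti_coeff X A * pinv (hc A (pinv X)) a * pinv X l"
  by (simp add: antic_points[OF assms] anti_coeff_points[OF assms])

lemma D_mul_hash_hash_points:
  assumes "P A"
  shows "E A (\<lambda>i. \<iota> (D_mul H \<omega> (hash H f h) (hash H g 1) $ (i, l))) =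
     ext1 f A * E (crd h) (\<lambda>c. E (lift (hash H g 1)) (\<lambda>r. kern A c r l))"
  using E_sc_mul_kern[OF assms value_at_hash[of f h], of "lift (hash H g 1)" l]
  unfolding lift_D_mul[symmetric] by (simp add: lift_def)

lemma D_mul_hash_one: "D_mul H \<omega> (hash H f 1) (hash H g 1) = hash H (dmul H f g) 1"
proof (rule D_eqI)
  fix A assume A: "P A"
  have "value_at (lift (D_mul H \<omega> (hash H f 1) (hash H g 1))) A (ext1 (dmul H f g) A) pone"
    using value_at_D_mul[OF value_at_hash_one value_at_hash_one, of A f g] A by (simp add: pmul_one ext1_dmul)
  then show "\<exists>f' X. value_at (lift (D_mul H \<omega> (hash H f 1) (hash H g 1))) A f' X \<and> value_at (lift (hash H (dmul H f g) 1)) A f' X"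
    using value_at_hash_one by blast
qed

lemma D_anti_hash: "D_anti H \<omega> (hash H f 1) = hash H (danti H f) 1" if f: "klin H f"
proof (rule D_eqI)
  fix A assume A: "P A"
  have "value_at (lift (D_anti H \<omega> (hash H f 1))) A (ext1 (danti H f) A) pone"
    unfolding value_at_def
  proof
    fix l
    have "E A (\<lambda>i. lift (D_anti H \<omega> (hash H f 1)) (i, l)) =
      (\<Sum>a\<in>UNIV. \<iota> (f (b a)) * E pone (\<lambda>c. E A (\<lambda>i. \<iota> (antic (a, c) (i, l)))))"
      unfolding lift_def D_anti_nth \<iota>_E
      by (subst E_swap) (simp add: E_pair hash_nth \<iota>_mult pone_def crd_def E_def[of "\<lambda>i. \<iota> (dbas H i 1)"] sum_distrib_left mult.assoc)
    also have "\<dots> = (\<Sum>a\<in>UNIV. pinv A a * \<iota> (f (b a))) * pone l"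
      using A by (simp add: E_antic anti_coeff_points pmul_pone_cancel sum_distrib_right sum_distrib_left ac_simps)
    finally show "E A (\<lambda>i. lift (D_anti H \<omega> (hash H f 1)) (i, l)) = ext1 (danti H f) A * pone l"
      unfolding ext1_danti[OF f] ext1_def[of f "pinv A"] E_def[of "pinv A"] .
  qed
  then show "\<exists>f' X. value_at (lift (D_anti H \<omega> (hash H f 1))) A f' X \<and> value_at (lift (hash H (danti H f) 1)) A f' X"
    using value_at_hash_one by blast
qed

text \<open>
  \<open>(\<epsilon> # h)(f # 1) = (h\<^sub>1 \<rightharpoonup> f \<leftharpoonup> S(h\<^sub>2)) # h\<^sub>3\<close>, the element to which the antipode is applied in \<open>u\<close>.
\<close>

lemma D_mul_cou_hash:
  assumes f: "klin H f"
  shows "D_mul H \<omega> (hash H (cou H) (b c)) (hash H f 1) $ (i, l) =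
    sw3 H (*) (b c) (\<lambda>h1 h2 h3. f (anti H h2 * b i * h1) * dbas H l h3)"
proof (rule transfer2[of "\<lambda>c i. D_mul H \<omega> (hash H (cou H) (b c)) (hash H f 1) $ (i, l)"
      "\<lambda>c i. sw3 H (*) (b c) (\<lambda>h1 h2 h3. f (anti H h2 * b i * h1) * dbas H l h3)"])
  fix X A assume P: "P X" "P A"
  show "E X (\<lambda>c. E A (\<lambda>i. \<iota> (D_mul H \<omega> (hash H (cou H) (b c)) (hash H f 1) $ (i, l)))) =
      E X (\<lambda>c. E A (\<lambda>i. \<iota> (sw3 H (*) (b c) (\<lambda>h1 h2 h3. f (anti H h2 * b i * h1) * dbas H l h3))))"
    using P by (simp add: D_mul_hash_hash_points E_EV[symmetric] EV_crd hash_kern)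
      (simp add: calc ext1_crd[OF f] hc_pt, simp add: ext1_dbas)
qed

lemma value_at_anti_cou_hash:
  assumes f: "klin H f" and P: "P A" "P X"
  shows "value_at (EV X (\<lambda>c. lift (D_anti H \<omega> (D_mul H \<omega> (hash H (cou H) (b c)) (hash H f 1))))) A
    (ext2 anti_coeff X A * ext1 f (pinv A)) (pinv X)"
  unfolding value_at_def
proof
  fix l
  let ?T = "\<lambda>c. D_mul H \<omega> (hash H (cou H) (b c)) (hash H f 1)"
  let ?A = "pinv (hc A (pinv X))"
  have T: "E X (\<lambda>c. \<iota> (?T c $ (a, d))) = ext1 f (pinv X \<odot> crd (b a) \<odot> X) * X d" for a d
    unfolding D_mul_cou_hash[OF f] using P by (simp add: calc ext1_crd[OF f]) (simp add: ext1_dbas)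
  have "E A (\<lambda>i. EV X (\<lambda>c. lift (D_anti H \<omega> (?T c))) (i, l)) =
    E A (\<lambda>i. E X (\<lambda>c. \<Sum>a\<in>UNIV. \<Sum>d\<in>UNIV. \<iota> (?T c $ (a, d)) * \<iota> (antic (a, d) (i, l))))"
    by (simp add: EV_apply lift_def D_anti_nth E_pair \<iota>_sum \<iota>_mult)
  also have "\<dots> = (\<Sum>a\<in>UNIV. \<Sum>d\<in>UNIV. ext1 f (pinv X \<odot> crd (b a) \<odot> X) * X d * E A (\<lambda>i. \<iota> (antic (a, d) (i, l))))"
    by (simp add: E_sum E_mult_right E_mult_left T)
  also have "\<dots> = (\<Sum>a\<in>UNIV. ext1 f (pinv X \<odot> crd (b a) \<odot> X) * E X (\<lambda>d. E A (\<lambda>i. \<iota> (antic (a, d) (i, l)))))"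
    by (simp add: E_def[of X] sum_distrib_left mult.assoc)
  also have "\<dots> = E ?A (\<lambda>a. ext1 f (pinv X \<odot> crd (b a) \<odot> X)) * (ext2 anti_coeff X A * pinv X l)"
    using P by (simp add: E_antic) (simp add: E_def[of ?A] sum_distrib_right sum_distrib_left ac_simps)
  also have "E ?A (\<lambda>a. ext1 f (pinv X \<odot> crd (b a) \<odot> X)) = ext1 f (pinv A)"
    using P by (simp add: calc hc_pt pinv_pmul pinv_pinv pmul_assoc pinv_left pmul_one)
  finally show "E A (\<lambda>i. EV X (\<lambda>c. lift (D_anti H \<omega> (?T c))) (i, l)) = ext2 anti_coeff X A * ext1 f (pinv A) * pinv X l"
    by (simp only: ac_simps)
qed

section \<open>The inverse of the reassociator\<close>

lemma E_sum_left: "E (\<lambda>p. \<Sum>a\<in>S. F a p) G = (\<Sum>a\<in>S. E (F a) G)"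
  unfolding E_def sum_distrib_right by (rule sum.swap)

text \<open>
  The embedding of \<open>H\<^sup>* \<otimes> H\<^sup>* \<otimes> H\<^sup>*\<close> in the third tensor power.  It takes convolution to the product, hence the
  reassociator, the image of \<open>\<omega>\<inverse>\<close>, has the image of \<open>\<omega>\<close> as its inverse.
\<close>

definition tri3 :: "('h \<Rightarrow> 'h \<Rightarrow> 'h \<Rightarrow> 'k) \<Rightarrow> 'k ^ (('n \<times> 'n) \<times> ('n \<times> 'n) \<times> ('n \<times> 'n))" where
  "tri3 T = dsw3 H (*s) T (\<lambda>w1 w2 w3. vtens3 (hash H w1 1) (hash H w2 1) (hash H w3 1))"

abbreviation "ehash a \<equiv> hash H (dbas H a) 1"

lemma tri3_nth: "tri3 T $ p = (\<Sum>i\<in>UNIV. \<Sum>j\<in>UNIV. \<Sum>l\<in>UNIV. T (b i) (b j) (b l) * (vtens3 (ehash i) (ehash j) (ehash l) $ p))"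
  by (simp add: tri3_def dsw3_def)

lemma tri3_nth': "tri3 T $ p = T (b (fst (fst p))) (b (fst (fst (snd p)))) (b (fst (snd (snd p)))) *
   (dbas H (snd (fst p)) 1 * (dbas H (snd (fst (snd p))) 1 * dbas H (snd (snd (snd p))) 1))"
proof -
  have "T (b i) (b j) (b l) * (vtens3 (ehash i) (ehash j) (ehash l) $ p) =
    (if l = fst (snd (snd p)) then if j = fst (fst (snd p)) then if i = fst (fst p) then
      T (b i) (b j) (b l) * (dbas H (snd (fst p)) 1 * (dbas H (snd (fst (snd p))) 1 * dbas H (snd (snd (snd p))) 1)) else 0 else 0 else 0)" for i j l
    by (simp add: vtens3_nth hash_nth dbas_bas)
  then show ?thesis unfolding tri3_nth by simp
qed

lemma sc_tensor_product:
  "sc_mul (sc_tensor m m') (\<lambda>p. x (fst p) * x' (snd p)) (\<lambda>p. y (fst p) * y' (snd p)) t = sc_mul m x y (fst t) * sc_mul m' x' y' (snd t)"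
proof -
  have "E (\<lambda>p. y (fst p) * y' (snd p)) (\<lambda>q. m p (fst q) (fst t) * m' p' (snd q) (snd t)) =
     E y (\<lambda>q. m p q (fst t)) * E y' (\<lambda>q. m' p' q (snd t))" for p p'
    by (rule E_product)
  then show ?thesis
    using E_product[of x x' "\<lambda>p. E y (\<lambda>q. m p q (fst t))" "\<lambda>p'. E y' (\<lambda>q. m' p' q (snd t))"]
    by (simp add: sc_mul_apply sc_tensor_def)
qed

lemma qmul3_vtens3: "qmul3 D (vtens3 x y z) (vtens3 x' y' z') =
    vtens3 (D_mul H \<omega> x x') (D_mul H \<omega> y y') (D_mul H \<omega> z z')"
proof -
  have "($) (qmul3 D (vtens3 x y z) (vtens3 x' y' z')) = ($) (vtens3 (D_mul H \<omega> x x') (D_mul H \<omega> y y') (D_mul H \<omega> z z'))"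
  proof
    fix t
    have "(\<lambda>p. y $ fst p * z $ snd p) = ($) (vtens2 y z)" "(\<lambda>p. y' $ fst p * z' $ snd p) = ($) (vtens2 y' z')"
      by (simp_all add: fun_eq_iff vtens2_nth)
    then show "qmul3 D (vtens3 x y z) (vtens3 x' y' z') $ t = vtens3 (D_mul H \<omega> x x') (D_mul H \<omega> y y') (D_mul H \<omega> z z') $ t"
      using sc_tensor_product[of mulc mulc2 "($) x" "\<lambda>p. y $ fst p * z $ snd p" "($) x'" "\<lambda>p. y' $ fst p * z' $ snd p" t]
        sc_tensor_product[of mulc mulc "($) y" "($) z" "($) y'" "($) z'" "snd t"]
      by (simp add: qmul3_nth vtens3_nth D_mul_nth vtens3_nth[abs_def])
  qed
  then show ?thesis by (simp add: nth_inject)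
qed

lemma qmul3_tri3: "qmul3 D (tri3 T) (tri3 T') = tri3 (conv3 H T T')"
proof -
  have dm: "dmul H (dbas H i) (dbas H j) x = comul H x $ (i, j)" for i j x
    unfolding dmul_def comul_sw2 ..
  have "qmul3 D (tri3 T) (tri3 T') $ t = tri3 (conv3 H T T') $ t" for t
  proof -
    let ?x = "b (fst (fst t))" and ?y = "b (fst (fst (snd t)))" and ?z = "b (fst (snd (snd t)))"
    let ?u = "dbas H (snd (fst t)) 1 * (dbas H (snd (fst (snd t))) 1 * dbas H (snd (snd (snd t))) 1)"
    let ?F = "\<lambda>i j l i' j' l'. comul H ?x $ (i, i') * (comul H ?y $ (j, j') * (comul H ?z $ (l, l') *
       (T (b i) (b j) (b l) * T' (b i') (b j') (b l')))) * ?u"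
    have "qmul3 D (tri3 T) (tri3 T') $ t = (\<Sum>i\<in>UNIV. \<Sum>j\<in>UNIV. \<Sum>l\<in>UNIV. T (b i) (b j) (b l) *
       (\<Sum>i'\<in>UNIV. \<Sum>j'\<in>UNIV. \<Sum>l'\<in>UNIV. T' (b i') (b j') (b l') * (qmul3 D (vtens3 (ehash i) (ehash j) (ehash l)) (vtens3 (ehash i') (ehash j') (ehash l')) $ t)))"
      unfolding qmul3_nth tri3_nth[abs_def] sc_mul_apply by (simp add: E_sum_left E_smult E_sum E_mult_left)
    also have "\<dots> = (\<Sum>i\<in>UNIV. \<Sum>j\<in>UNIV. \<Sum>l\<in>UNIV. \<Sum>i'\<in>UNIV. \<Sum>j'\<in>UNIV. \<Sum>l'\<in>UNIV. ?F i j l i' j' l')"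
      unfolding qmul3_vtens3 D_mul_hash_one vtens3_nth hash_nth dm
      by (simp add: sum_distrib_left sum_distrib_right ac_simps)
    also have "\<dots> = (\<Sum>i\<in>UNIV. \<Sum>j\<in>UNIV. \<Sum>i'\<in>UNIV. \<Sum>l\<in>UNIV. \<Sum>j'\<in>UNIV. \<Sum>l'\<in>UNIV. ?F i j l i' j' l')"
      by (intro sum.cong refl sum.swap)
    also have "\<dots> = (\<Sum>i\<in>UNIV. \<Sum>i'\<in>UNIV. \<Sum>j\<in>UNIV. \<Sum>l\<in>UNIV. \<Sum>j'\<in>UNIV. \<Sum>l'\<in>UNIV. ?F i j l i' j' l')"
      by (intro sum.cong refl sum.swap)
    also have "\<dots> = (\<Sum>i\<in>UNIV. \<Sum>i'\<in>UNIV. \<Sum>j\<in>UNIV. \<Sum>j'\<in>UNIV. \<Sum>l\<in>UNIV. \<Sum>l'\<in>UNIV. ?F i j l i' j' l')"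
      by (intro sum.cong refl sum.swap)
    also have "\<dots> = conv3 H T T' ?x ?y ?z * ?u"
      unfolding conv3_def sw2_def sum_distrib_left sum_distrib_right ..
    finally show ?thesis by (simp add: tri3_nth')
  qed
  then show ?thesis by (simp add: vec_eq_iff)
qed

lemma tri3_counit: "tri3 (\<lambda>x y z. cou H x * cou H y * cou H z) = vtens3 one one one"
  by (simp add: vec_eq_iff tri3_nth' vtens3_nth hash_nth)

lemma qinv3_assoc: "qinv3 D (D_assoc H \<omega>) = tri3 \<omega>"
proof (rule qinv3_eq)
  have "D_assoc H \<omega> = tri3 \<omega>'" by (simp add: D_assoc_def tri3_def)
  then show "qmul3 D (D_assoc H \<omega>) (tri3 \<omega>) = vtens3 one one one" "qmul3 D (tri3 \<omega>) (D_assoc H \<omega>) = vtens3 one one one"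
    using conv_inverse by (simp_all add: qmul3_tri3 conv_inverse3_def tri3_counit)
qed

section \<open>Expansion of the Drinfeld element\<close>

text \<open>
  Linearity, stated as the expansion in coordinates in which it is used.
\<close>

definition vlin :: "('k ^ 'a::finite \<Rightarrow> 'k ^ 'c::finite) \<Rightarrow> bool" where
  "vlin g \<longleftrightarrow> (\<forall>x t. g x $ t = E (($) x) (\<lambda>p. g (axis p 1) $ t))"

lemma vlin_nth: "vlin g \<Longrightarrow> g x $ t = E (($) x) (\<lambda>p. g (axis p 1) $ t)"
  unfolding vlin_def by blast

lemma vlinI: "(\<And>x t. g x $ t = E (($) x) (\<lambda>p. g (axis p 1) $ t)) \<Longrightarrow> vlin g"
  unfolding vlin_def by (intro allI)

lemma vlin_comp:
  assumes g: "vlin g" and h: "vlin h"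
  shows "vlin (\<lambda>x. g (h x))"
proof (rule vlinI)
  fix x t
  have hx: "($) (h x) = EV (($) x) (\<lambda>p. ($) (h (axis p 1)))"
    unfolding EV_def by (rule ext) (rule vlin_nth[OF h])
  have gh: "E (($) (h (axis p 1))) (\<lambda>q. g (axis q 1) $ t) = g (h (axis p 1)) $ t" for p
    by (rule vlin_nth[OF g, symmetric])
  have "g (h x) $ t = E (($) (h x)) (\<lambda>q. g (axis q 1) $ t)" by (rule vlin_nth[OF g])
  also have "\<dots> = E (($) x) (\<lambda>p. g (h (axis p 1)) $ t)" unfolding hx E_EV gh ..
  finally show "g (h x) $ t = E (($) x) (\<lambda>p. g (h (axis p 1)) $ t)" .
qed

lemma vlin_id: "vlin (\<lambda>x :: 'k ^ 'a::finite. x)"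
proof -
  have "axis p (1::'k) $ t = of_bool (p = t)" for p t :: 'a by (auto simp: axis_def)
  then show ?thesis by (simp add: vlin_def E_of_bool)
qed

lemma vlin_sum: "(\<And>i. vlin (g i)) \<Longrightarrow> vlin (\<lambda>x. \<Sum>i\<in>A. g i x)"
  by (rule vlinI) (simp only: sum_component E_sum vlin_nth[symmetric])

lemma vlin_cmult: "vlin g \<Longrightarrow> vlin (\<lambda>x. c *s g x)"
  by (rule vlinI) (simp only: vector_smult_component E_mult_left vlin_nth[symmetric])

lemma vlin_D_mul: "vlin (\<lambda>x. D_mul H \<omega> x y)" "vlin (D_mul H \<omega> y)"
proof -
  show "vlin (\<lambda>x. D_mul H \<omega> x y)"
    by (rule vlinI) (simp add: D_mul_nth sc_mul_apply axis_E)
  show "vlin (D_mul H \<omega> y)"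
    by (rule vlinI, simp add: D_mul_nth sc_mul_apply axis_E) (rule E_swap)
qed

lemma vlin_D_anti: "vlin (D_anti H \<omega>)"
  by (rule vlinI) (simp add: D_anti_nth axis_E)

lemma vsw2_vtens2:
  assumes g: "\<And>y. vlin (\<lambda>x. g x y)" "\<And>x. vlin (g x)"
  shows "vsw2 (vtens2 x y) g = g x y"
proof -
  have "vsw2 (vtens2 x y) g $ t = g x y $ t" for t
  proof -
    have "vsw2 (vtens2 x y) g $ t = E (($) x) (\<lambda>p. E (($) y) (\<lambda>q. g (axis p 1) (axis q 1) $ t))"
      unfolding vsw2_nth E_pair by (simp add: vtens2_nth E_def sum_distrib_left ac_simps)
    also have "\<dots> = g x y $ t"
      unfolding vlin_nth[OF g(2), of _ y t, symmetric] by (rule vlin_nth[OF g(1), symmetric])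
    finally show ?thesis .
  qed
  then show ?thesis by (simp add: vec_eq_iff)
qed

lemma vsw3_vtens3:
  assumes g: "\<And>y z. vlin (\<lambda>x. g x y z)" "\<And>x z. vlin (\<lambda>y. g x y z)" "\<And>x y. vlin (g x y)"
  shows "vsw3 (vtens3 x y z) g = g x y z"
proof -
  have "vsw3 (vtens3 x y z) g $ t = g x y z $ t" for t
  proof -
    have "vsw3 (vtens3 x y z) g $ t = E (($) x) (\<lambda>p. E (($) y) (\<lambda>q. E (($) z) (\<lambda>r. g (axis p 1) (axis q 1) (axis r 1) $ t)))"
      unfolding vsw3_nth E_pair sum_pair by (simp add: vtens3_nth E_def sum_distrib_left ac_simps)
    also have "\<dots> = E (($) x) (\<lambda>p. E (($) y) (\<lambda>q. g (axis p 1) (axis q 1) z $ t))"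
      unfolding vlin_nth[OF g(3), of _ _ z t, symmetric] ..
    also have "\<dots> = E (($) x) (\<lambda>p. g (axis p 1) y z $ t)"
      unfolding vlin_nth[OF g(2), of _ y z t, symmetric] ..
    also have "\<dots> = g x y z $ t"
      by (rule vlin_nth[OF g(1), symmetric])
    finally show ?thesis .
  qed
  then show ?thesis by (simp add: vec_eq_iff)
qed

lemma vsw2_sum: "vsw2 (\<Sum>i\<in>A. X i) g = (\<Sum>i\<in>A. vsw2 (X i) g)"
proof -
  have "($) (sum X A) = (\<lambda>p. \<Sum>i\<in>A. X i $ p)" by (rule ext) simp
  then show ?thesis by (simp add: vec_eq_iff vsw2_nth E_sum_left)
qed

lemma vsw3_tri3:
  assumes "\<And>y z. vlin (\<lambda>x. g x y z)" "\<And>x z. vlin (\<lambda>y. g x y z)" "\<And>x y. vlin (g x y)"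
  shows "vsw3 (tri3 T) g = (\<Sum>i\<in>UNIV. \<Sum>j\<in>UNIV. \<Sum>l\<in>UNIV. T (b i) (b j) (b l) *s g (ehash i) (ehash j) (ehash l))"
proof -
  have "vsw3 (tri3 T) g $ t = (\<Sum>i\<in>UNIV. \<Sum>j\<in>UNIV. \<Sum>l\<in>UNIV. T (b i) (b j) (b l) * (vsw3 (vtens3 (ehash i) (ehash j) (ehash l)) g $ t))" for t
    unfolding vsw3_nth tri3_nth[abs_def] by (simp add: E_sum_left E_smult)
  then show ?thesis by (simp add: vec_eq_iff vsw3_vtens3[OF assms])
qed

text \<open>
  The form \<open>e\<^sup>j \<beta> S(e\<^sup>l)\<close>, which collects \<open>x\<^sup>2\<close>, \<open>\<beta>\<close> and \<open>s(x\<^sup>3)\<close>.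
\<close>

definition chi :: "'n \<Rightarrow> 'n \<Rightarrow> 'h \<Rightarrow> 'k" where
  "chi j l = dmul H (dmul H (dbas H j) \<beta>) (danti H (dbas H l))"

lemma drinfeld_u_expand:
  "drinfeld_u D = (\<Sum>a\<in>UNIV. \<Sum>i\<in>UNIV. \<Sum>j\<in>UNIV. \<Sum>l\<in>UNIV. \<omega> (b i) (b j) (b l) *s
     D_mul H \<omega> (D_mul H \<omega> (D_anti H \<omega> (D_mul H \<omega> (hash H (cou H) (b a)) (hash H (chi j l) 1))) (ehash a)) (ehash i))"
proof -
  let ?g = "\<lambda>R1 R2 x1 x2 x3. D_mul H \<omega> (D_mul H \<omega> (D_mul H \<omega>
         (D_anti H \<omega> (D_mul H \<omega> (D_mul H \<omega> (D_mul H \<omega> R2 x2) (hash H \<beta> 1)) (D_anti H \<omega> x3)))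
         one) R1) x1"
  note v = vlin_comp[OF vlin_D_mul(1)] vlin_comp[OF vlin_D_mul(2)] vlin_comp[OF vlin_D_anti] vlin_id
  have g: "vlin (\<lambda>x1. ?g R1 R2 x1 x2 x3)" "vlin (\<lambda>x2. ?g R1 R2 x1 x2 x3)" "vlin (\<lambda>x3. ?g R1 R2 x1 x2 x3)"
     "vlin (\<lambda>R1. ?g R1 R2 x1 x2 x3)" "vlin (\<lambda>R2. ?g R1 R2 x1 x2 x3)" for R1 R2 x1 x2 x3
    by (intro v)+
  have "drinfeld_u D = vsw2 (D_R H) (\<lambda>R1 R2. vsw3 (tri3 \<omega>) (?g R1 R2))"
    by (simp add: drinfeld_u_def qinv3_assoc)
  also have "\<dots> = vsw2 (D_R H) (\<lambda>R1 R2. \<Sum>i\<in>UNIV. \<Sum>j\<in>UNIV. \<Sum>l\<in>UNIV. \<omega> (b i) (b j) (b l) *s ?g R1 R2 (ehash i) (ehash j) (ehash l))"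
    by (subst vsw3_tri3) (simp_all only: g)
  also have "\<dots> = (\<Sum>a\<in>UNIV. \<Sum>i\<in>UNIV. \<Sum>j\<in>UNIV. \<Sum>l\<in>UNIV. \<omega> (b i) (b j) (b l) *s ?g (ehash a) (hash H (cou H) (b a)) (ehash i) (ehash j) (ehash l))"
    unfolding D_R_def vsw2_sum by (subst vsw2_vtens2) (intro vlin_sum vlin_cmult g refl)+
  finally show ?thesis
    by (simp add: D_mul_one D_anti_hash) (simp add: D_mul_assoc D_mul_hash_one chi_def)
qed

end

section \<open>The ribbon element\<close>

locale ribbon_points = cocycle_points H \<iota> \<omega> + integral_points H \<iota> t \<mu>
  for H :: "('k::field, 'h::ring_1, 'n::finite) hopf" and \<iota> :: "'k \<Rightarrow> 'r::comm_ring_1" and \<omega> t \<mu>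
begin

abbreviation "m \<equiv> ext1 \<mu>"

lemma m_inverse: "P A \<Longrightarrow> m A * m (pinv A) = 1"
  using character_pmul[OF klin_\<mu> \<mu>_mult, of A "pinv A"] by (simp add: pmul_cancel ext1_pone \<mu>_one \<iota>_one)

text \<open>
  The element \<open>g \<mapsto> f(g) g\<inverse>\<close>; \<open>u\<close>, \<open>\<nu>\<close> and their images under \<open>s\<close> are of this form.
\<close>

definition inv_elem :: "('h \<Rightarrow> 'k) \<Rightarrow> 'k ^ ('n \<times> 'n)" where
  "inv_elem f = (\<chi> p. sw2 H (*) (b (fst p)) (\<lambda>x y. f x * dbas H (snd p) (anti H y)))"

lemma value_at_inv_elem: "klin H f \<Longrightarrow> P A \<Longrightarrow> value_at (lift (inv_elem f)) A (ext1 f A) (pinv A)"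
  unfolding value_at_def lift_def inv_elem_def by (simp add: calc ext1_crd[of f]) (simp add: ext1_dbas)

text \<open>
  A point has counit \<open>1\<close>, so the scalar can be read off from the multiple.
\<close>

lemma value_at_unique:
  assumes "value_at d A f X" "value_at d A g X" "P X"
  shows "f = g"
proof -
  have "f * ext1 (cou H) X = g * ext1 (cou H) X"
    using assms(1,2) unfolding ext1_def E_mult_left[symmetric]
    by (simp add: value_at_def E_def) (metis mult.assoc mult.commute)
  then show ?thesis using assms(3) by simp
qed

text \<open>
  The form \<open>B\<close> to which \<open>trace_conj_inv\<close> is applied: coordinate \<open>l\<close> of \<open>f(r) A(g, r\<inverse>) r\<close>, where \<open>A\<close> is the
  factor \<open>anti_coeff\<close>.
\<close>

definition anti_weight :: "('h \<Rightarrow> 'k) \<Rightarrow> 'n \<Rightarrow> 'h \<Rightarrow> 'h \<Rightarrow> 'k" where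
  "anti_weight f l r g = sw3 H (*) r (\<lambda>r1 r2 r3. f r1 * anti_coeff (anti H r2) g * dbas H l r3)"

lemma anti_coeff_crd: "\<iota> (anti_coeff x y) = ext2 anti_coeff (crd x) (crd y)"
  by (rule ext2_crd) (rule klin_anti_coeff)+

lemma klin_anti_weight: "klin H (\<lambda>r. anti_weight f l r g)" "klin H (anti_weight f l r)"
  unfolding anti_weight_def sw_defs by (intro klin_sw klin_cmult klin_anti_coeff)+

lemma anti_weight_crd: "\<iota> (anti_weight f l x y) = ext2 (anti_weight f l) (crd x) (crd y)"
  by (rule ext2_crd) (rule klin_anti_weight)+

lemma anti_weight_points:
  assumes "klin H f" "P X"
  shows "ext2 (anti_weight f l) X A = ext1 f X * ext2 anti_coeff (pinv X) A * X l"
  unfolding ext2_def[of "anti_weight _ _"] anti_weight_def using assms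
  by (simp add: calc ext1_crd[of f] anti_coeff_crd) (simp add: ext1_dbas)

text \<open>
  By the formula for the antipode, \<open>s\<close> of \<open>\<Sum>\<^sub>a (f e\<^sup>a) # S(e\<^sub>a)\<close> is a sum over \<open>a\<close> in which \<open>e\<^sup>a\<close> is evaluated at
  \<open>S(e\<^sub>a) S(g) e\<^sub>a\<close> in the Sweedler sense.  Separating the two roles of \<open>a\<close>, the summand with \<open>e\<^sup>a\<close> fixed and \<open>e\<^sub>a\<close>
  replaced by a generic point is computed first; then the sum is a trace.
\<close>

lemma D_anti_inv_elem_nth:
  assumes f: "klin H f"
  shows "D_anti H \<omega> (inv_elem f) $ (i, l) = sw2 H (*) (b i) (\<lambda>g1 g2. sw2 H (*) (anti H g1) (\<lambda>p q. \<mu> p * anti_weight f l q g2))"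
proof -
  let ?Z = "\<lambda>c i a. \<Sum>d\<in>UNIV. sw2 H (*) (b c) (\<lambda>x y. f x * dbas H d (anti H y)) * antic (a, d) (i, l)"
  let ?Y = "\<lambda>c i a. sw2 H (*) (b i) (\<lambda>g1 g2. sw3 H (*) (b c) (\<lambda>p q r. dbas H a (anti H p * anti H g1 * q) * anti_weight f l r g2))"
  have Z: "?Z c i a = ?Y c i a" for c i a
  proof (rule transfer2[of "\<lambda>c i. ?Z c i a" "\<lambda>c i. ?Y c i a"])
    fix X A assume P: "P X" "P A"
    have 1: "E X (\<lambda>c. \<iota> (sw2 H (*) (b c) (\<lambda>x y. f x * dbas H d (anti H y)))) = ext1 f X * pinv X d" for d
      using P by (simp add: calc ext1_crd[OF f]) (simp add: ext1_dbas)
    have "E X (\<lambda>c. E A (\<lambda>i. \<iota> (?Z c i a))) =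
        (\<Sum>d\<in>UNIV. ext1 f X * pinv X d * E A (\<lambda>i. \<iota> (antic (a, d) (i, l))))"
      by (simp add: \<iota>_sum \<iota>_mult E_sum E_mult_left E_mult_right 1)
    also have "\<dots> = ext1 f X * E (pinv X) (\<lambda>d. E A (\<lambda>i. \<iota> (antic (a, d) (i, l))))"
      by (simp add: E_def[of "pinv X"] sum_distrib_left mult.assoc)
    also have "\<dots> = ext1 f X * (ext2 anti_coeff (pinv X) A * pinv (hc A X) a * X l)"
      using P by (simp add: E_antic pinv_pinv)
    also have "\<dots> = E X (\<lambda>c. E A (\<lambda>i. \<iota> (?Y c i a)))"
      using P by (simp add: calc anti_weight_crd anti_weight_points[OF f] hc_pt pinv_pmul pinv_pinv pmul_assoc) (simp add: ext1_dbas ac_simps)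
    finally show "E X (\<lambda>c. E A (\<lambda>i. \<iota> (?Z c i a))) = E X (\<lambda>c. E A (\<lambda>i. \<iota> (?Y c i a)))" .
  qed
  have "D_anti H \<omega> (inv_elem f) $ (i, l) = (\<Sum>a\<in>UNIV. ?Z a i a)"
    by (simp add: D_anti_nth E_pair inv_elem_def)
  also have "\<dots> = sw2 H (*) (b i) (\<lambda>g1 g2. \<Sum>a\<in>UNIV. sw3 H (*) (b a) (\<lambda>p q r. dbas H a (anti H p * anti H g1 * q) * anti_weight f l r g2))"
    unfolding Z by (rule sw2_sum[symmetric])
  also have "\<dots> = sw2 H (*) (b i) (\<lambda>g1 g2. sw2 H (*) (anti H g1) (\<lambda>p q. \<mu> p * anti_weight f l q g2))"
    by (simp only: trace_conj_inv[OF klin_anti_weight(1)])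
  finally show ?thesis .
qed

lemma value_at_anti_inv_elem:
  assumes f: "klin H f" and A: "P A"
  shows "value_at (lift (D_anti H \<omega> (inv_elem f))) A (m (pinv A) * ext1 f (pinv A) * (gc.bt' A * gc.bt' A)) (pinv A)"
  unfolding value_at_def
proof
  fix l
  let ?Q = "\<lambda>x g. sw2 H (*) x (\<lambda>p q. \<mu> p * anti_weight f l q g)"
  have Q: "\<iota> (?Q x g) = ext2 ?Q (crd x) (crd g)" for x g
    by (rule ext2_crd) (intro klin_sw klin_cmult klin_anti_weight)+
  have Q': "ext2 ?Q X A = m X * ext2 (anti_weight f l) X A" if "P X" for X
    unfolding ext2_def[of ?Q] using that A by (simp add: calc anti_weight_crd ext1_crd[OF klin_\<mu>])
  have "E A (\<lambda>i. \<iota> (sw2 H (*) (b i) (\<lambda>g1 g2. ?Q (anti H g1) g2))) = ext2 ?Q (pinv A) A"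
    using A unfolding \<iota>_sw2[of "b _"] Q by (simp add: calc)
  then show "E A (\<lambda>i. lift (D_anti H \<omega> (inv_elem f)) (i, l)) = m (pinv A) * ext1 f (pinv A) * (gc.bt' A * gc.bt' A) * pinv A l"
    using A by (simp add: lift_def D_anti_inv_elem_nth[OF f] Q' anti_weight_points[OF f] pinv_pinv anti_coeff_diag mult.assoc)
qed

text \<open>
  The weight in the trace that computes \<open>u\<close>: coordinate \<open>l\<close> of \<open>A(g, r) \<omega>(rgr\<inverse>, g\<inverse>, g) \<beta>(g\<inverse>) r\<inverse>\<close>,
  where \<open>A\<close> is the factor \<open>anti_coeff\<close>.
\<close>

definition u_weight :: "'n \<Rightarrow> 'h \<Rightarrow> 'h \<Rightarrow> 'k" where
  "u_weight l r g = sw3 H (*) r (\<lambda>r1 r2 r3. sw5 H (*) g (\<lambda>g1 g2 g3 g4 g5.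
     anti_coeff r1 g1 * \<omega> (hact H g2 (anti H r2)) (anti H g3) g4 * \<beta> (anti H g5) * dbas H l (anti H r3)))"

lemma klin_u_weight: "klin H (\<lambda>r. u_weight l r g)" "klin H (u_weight l r)"
  unfolding u_weight_def sw_defs by (intro klin_sw)+

lemma u_weight_crd: "\<iota> (u_weight l x y) = ext2 (u_weight l) (crd x) (crd y)"
  by (rule ext2_crd) (rule klin_u_weight)+

lemma u_weight_points:
  assumes "P X" "P A"
  shows "ext2 (u_weight l) X A = ext2 anti_coeff X A * ext3 \<omega> (hc A (pinv X)) (pinv A) A * ext1 \<beta> (pinv A) * pinv X l"
  unfolding ext2_def[of "u_weight _"] u_weight_def using assms
  by (simp add: calc ext1_crd[OF klin_beta] anti_coeff_crd tri_crd[OF tri_\<omega>]) (simp add: ext1_dbas)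

lemma chi_points: "P A \<Longrightarrow> ext1 (chi j l) A = A j * ext1 \<beta> A * pinv A l"
  by (simp add: chi_def ext1_dmul ext1_danti ext1_dbas)

lemma klin_chi: "klin H (chi j l)"
  by (simp add: chi_def)

lemma EV_EV: "EV (EV X F) G = EV X (\<lambda>i. EV (F i) G)"
  by (rule ext) (simp add: EV_apply E_EV)

lemma sc_mul_EV: "sc_mul c (EV X F) y = EV X (\<lambda>i. sc_mul c (F i) y)"
  by (simp add: sc_mul_def EV_EV)

text \<open>
  The sum over the dual bases in \<open>R\<close> is a trace again: \<open>R\<^sup>1 = e\<^sup>a # 1\<close> is multiplied from the left by
  an antipode with value in the multiples of \<open>S(e\<^sub>a)\<close>, so \<open>e\<^sup>a\<close> is evaluated at \<open>e\<^sub>a g S(e\<^sub>a)\<close>.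
\<close>

lemma drinfeld_u_nth:
  "drinfeld_u D $ (i, l) = sw2 H (*) (b i) (\<lambda>g1 g2. sw2 H (*) g1 (\<lambda>p q. \<mu> (anti H p) * u_weight l q g2))"
proof -
  let ?s = "\<lambda>c j k. D_anti H \<omega> (D_mul H \<omega> (hash H (cou H) (b c)) (hash H (chi j k) 1))"
  let ?V = "\<lambda>c a x j k. D_mul H \<omega> (D_mul H \<omega> (?s c j k) (ehash a)) (ehash x)"
  let ?Z = "\<lambda>c i a. \<Sum>x\<in>UNIV. \<Sum>j\<in>UNIV. \<Sum>k\<in>UNIV. \<omega> (b x) (b j) (b k) * (?V c a x j k $ (i, l))"
  let ?Y = "\<lambda>c i a. sw2 H (*) (b i) (\<lambda>g1 g2. sw3 H (*) (b c) (\<lambda>p q r. dbas H a (p * g1 * anti H q) * u_weight l r g2))"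
  have Z: "?Z c i a = ?Y c i a" for c i a
  proof (rule transfer2[of "\<lambda>c i. ?Z c i a" "\<lambda>c i. ?Y c i a"])
    fix X A assume P: "P X" "P A"
    let ?A = "hc A (pinv X)"
    have A': "P ?A" using P by simp
    have V: "E X (\<lambda>c. E A (\<lambda>i. \<iota> (?V c a x j k $ (i, l)))) =
       (ext2 anti_coeff X A * ?A a * ext1 \<beta> (pinv A) * pinv X l) * (?A x * (pinv A j * A k))" for x j k
    proof -
      let ?S = "EV X (\<lambda>c. lift (?s c j k))"
      have 1: "value_at ?S A (ext2 anti_coeff X A * ext1 (chi j k) (pinv A)) (pinv X)"
        by (rule value_at_anti_cou_hash[OF klin_chi P(2,1)])
      have 2: "value_at (sc_mul mulr ?S (lift (ehash a))) A (ext2 anti_coeff X A * ext1 (chi j k) (pinv A) * ?A a) (pinv X)"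
        using value_at_mul[OF 1 value_at_hash_one[of "dbas H a"]] P by (simp add: ext1_dbas pmul_one)
      have 3: "value_at (sc_mul mulr (sc_mul mulr ?S (lift (ehash a))) (lift (ehash x))) A (ext2 anti_coeff X A * ext1 (chi j k) (pinv A) * ?A a * ?A x) (pinv X)"
        using value_at_mul[OF 2 value_at_hash_one[of "dbas H x"]] P by (simp add: ext1_dbas pmul_one)
      have "E X (\<lambda>c. E A (\<lambda>i. \<iota> (?V c a x j k $ (i, l)))) = E A (\<lambda>i. sc_mul mulr (sc_mul mulr ?S (lift (ehash a))) (lift (ehash x)) (i, l))"
        unfolding sc_mul_EV lift_D_mul[symmetric] EV_apply by (subst E_swap) (simp add: lift_def)
      also have "\<dots> = ext2 anti_coeff X A * ext1 (chi j k) (pinv A) * ?A a * ?A x * pinv X l"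
        using 3 by (simp add: value_at_def)
      finally show ?thesis using P by (simp add: chi_points pinv_pinv ac_simps)
    qed
    have "E X (\<lambda>c. E A (\<lambda>i. \<iota> (?Z c i a))) =
       (\<Sum>x\<in>UNIV. \<Sum>j\<in>UNIV. \<Sum>k\<in>UNIV. \<iota> (\<omega> (b x) (b j) (b k)) *
          ((ext2 anti_coeff X A * ?A a * ext1 \<beta> (pinv A) * pinv X l) * (?A x * (pinv A j * A k))))"
      by (simp add: \<iota>_sum \<iota>_mult E_sum E_mult_left V)
    also have "\<dots> = ext3 \<omega> ?A (pinv A) A * (ext2 anti_coeff X A * ?A a * ext1 \<beta> (pinv A) * pinv X l)"
      by (simp add: ext3_def E_def[of ?A] E_def[of "pinv A"] E_def[of A] sum_distrib_left sum_distrib_right ac_simps)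
    also have "\<dots> = E X (\<lambda>c. E A (\<lambda>i. \<iota> (?Y c i a)))"
      using P by (simp add: calc u_weight_crd u_weight_points hc_pt pinv_pinv pmul_assoc) (simp add: ext1_dbas ac_simps)
    finally show "E X (\<lambda>c. E A (\<lambda>i. \<iota> (?Z c i a))) = E X (\<lambda>c. E A (\<lambda>i. \<iota> (?Y c i a)))" .
  qed
  have "drinfeld_u D $ (i, l) = (\<Sum>a\<in>UNIV. ?Z a i a)"
    by (simp add: drinfeld_u_expand)
  also have "\<dots> = sw2 H (*) (b i) (\<lambda>g1 g2. \<Sum>a\<in>UNIV. sw3 H (*) (b a) (\<lambda>p q r. dbas H a (p * g1 * anti H q) * u_weight l r g2))"
    unfolding Z by (rule sw2_sum[symmetric])
  also have "\<dots> = sw2 H (*) (b i) (\<lambda>g1 g2. sw2 H (*) g1 (\<lambda>p q. \<mu> (anti H p) * u_weight l q g2))"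
    by (simp only: trace_conj[OF klin_u_weight(1)])
  finally show ?thesis .
qed

text \<open>
  At the fixed point \<open>e\<^sub>a = g\<close> of the trace, the weight is \<open>\<beta>(g)\<^sup>-\<^sup>2 \<omega>(g, g\<inverse>, g) \<beta>(g\<inverse>) g\<inverse> = \<beta>(g)\<^sup>-\<^sup>2 g\<inverse>\<close>.
\<close>

lemma value_at_drinfeld_u:
  assumes A: "P A"
  shows "value_at (lift (drinfeld_u D)) A (m (pinv A) * (gc.bt' A * gc.bt' A)) (pinv A)"
  unfolding value_at_def
proof
  fix l
  let ?Q = "\<lambda>x g. sw2 H (*) x (\<lambda>p q. \<mu> (anti H p) * u_weight l q g)"
  have Q: "\<iota> (?Q x g) = ext2 ?Q (crd x) (crd g)" for x g
    by (rule ext2_crd) (intro klin_sw klin_cmult klin_u_weight)+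
  have Q': "ext2 ?Q A A = m (pinv A) * ext2 (u_weight l) A A"
    unfolding ext2_def[of ?Q] using A by (simp add: calc u_weight_crd ext1_crd[OF klin_\<mu>])
  have 1: "E A (\<lambda>i. \<iota> (sw2 H (*) (b i) (\<lambda>g1 g2. ?Q g1 g2))) = ext2 ?Q A A"
    using A unfolding \<iota>_sw2[of "b _"] Q by (simp add: calc)
  have "ext3 \<omega> A (pinv A) A * ext1 \<beta> (pinv A) = 1"
    using A gc.bt_inverse[of A] by (simp add: bt_points gc.bt_inv) (simp add: gc.bt_def)
  then have "ext2 (u_weight l) A A = gc.bt' A * gc.bt' A * pinv A l"
    using A by (simp add: u_weight_points anti_coeff_diag hc_self mult.assoc)
  with 1 show "E A (\<lambda>i. lift (drinfeld_u D) (i, l)) = m (pinv A) * (gc.bt' A * gc.bt' A) * pinv A l"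
    by (simp add: lift_def drinfeld_u_nth Q' mult.assoc)
qed

definition u_form :: "'h \<Rightarrow> 'k" where
  "u_form = dmul H (\<lambda>y. \<mu> (anti H y)) (dmul H \<beta>' \<beta>')"

lemma klin_u_form [simp]: "klin H u_form"
  by (simp add: u_form_def)

lemma u_form_points: "P A \<Longrightarrow> ext1 u_form A = m (pinv A) * (gc.bt' A * gc.bt' A)"
  by (simp add: u_form_def ext1_dmul ext1_pinv_eq bt'_points)

lemma drinfeld_u_eq: "drinfeld_u D = inv_elem u_form"
proof (rule D_eqI)
  fix A assume A: "P A"
  show "\<exists>f X. value_at (lift (drinfeld_u D)) A f X \<and> value_at (lift (inv_elem u_form)) A f X"
    using value_at_drinfeld_u[OF A] value_at_inv_elem[OF klin_u_form A] by (auto simp: u_form_points[OF A])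
qed

lemma D_mul_inv_elem_hash:
  assumes f: "klin H f"
  shows "D_mul H \<omega> (inv_elem f) (hash H g 1) = inv_elem (dmul H f g)"
proof (rule D_eqI)
  fix A assume A: "P A"
  have "value_at (lift (D_mul H \<omega> (inv_elem f) (hash H g 1))) A (ext1 f A * ext1 g A) (pinv A)"
    using value_at_D_mul[OF value_at_inv_elem value_at_hash_one, of f A g] A f by (simp add: pmul_one hc_self)
  moreover have "value_at (lift (inv_elem (dmul H f g))) A (ext1 f A * ext1 g A) (pinv A)"
    using value_at_inv_elem[of "dmul H f g" A] A by (simp add: ext1_dmul)
  ultimately show "\<exists>f' X. value_at (lift (D_mul H \<omega> (inv_elem f) (hash H g 1))) A f' X \<and> value_at (lift (inv_elem (dmul H f g))) A f' X"
    by blast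
qed

lemma bt'_pinv: "P A \<Longrightarrow> gc.bt' (pinv A) = gc.bt A"
  using gc.bt_inv[of "pinv A"] by (simp add: pinv_pinv)

lemma value_at_inv_elem_mul:
  assumes "klin H f" "klin H g" "P A"
  shows "value_at (lift (D_mul H \<omega> (inv_elem f) (inv_elem g))) A (ext1 f A * ext1 g A * gc.th A (pinv A) (pinv A)) (pinv A \<odot> pinv A)"
  using value_at_D_mul[OF value_at_inv_elem value_at_inv_elem, of f A g] assms by (simp add: hc_self)

context
  fixes \<zeta> :: "'h \<Rightarrow> 'k"
  assumes \<zeta>: "algebra_map H \<zeta>"
begin

lemma klin_\<zeta>: "klin H \<zeta>" and \<zeta>_mult: "\<zeta> (x * y) = \<zeta> x * \<zeta> y" and \<zeta>_one: "\<zeta> 1 = 1"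
  using \<zeta> by (simp_all add: algebra_map_def linear_iff_klin)

abbreviation "z \<equiv> ext1 \<zeta>"

lemma z_mult: "z (X \<odot> Y) = z X * z Y"
  by (rule character_pmul[OF klin_\<zeta> \<zeta>_mult])

lemma m_mult: "m (X \<odot> Y) = m X * m Y"
  by (rule character_pmul[OF klin_\<mu> \<mu>_mult])

lemma z_inverse: "P A \<Longrightarrow> z A * z (pinv A) = 1"
  using z_mult[of A "pinv A"] by (simp add: pmul_cancel ext1_pone klin_\<zeta> \<zeta>_one \<iota>_one)

definition nu_form :: "'h \<Rightarrow> 'k" where
  "nu_form = dmul H u_form (dmul H \<zeta> \<beta>)"

abbreviation "\<nu> \<equiv> inv_elem nu_form"

lemma klin_nu_form [simp]: "klin H nu_form"
  by (simp add: nu_form_def)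

lemma nu_form_points:
  assumes A: "P A"
  shows "ext1 nu_form A = m (pinv A) * z A * gc.bt' A"
proof -
  have "ext1 nu_form A = m (pinv A) * z A * gc.bt' A * (gc.bt A * gc.bt' A)"
    using A by (simp add: nu_form_def ext1_dmul u_form_points bt_points ac_simps)
  then show ?thesis using A by (simp add: gc.bt_inverse)
qed

lemma nu_eq: "D_mul H \<omega> (drinfeld_u D) (hash H (dmul H \<zeta> \<beta>) 1) = \<nu>"
  by (simp add: drinfeld_u_eq D_mul_inv_elem_hash nu_form_def)

text \<open>The character \<open>\<mu>\<inverse>\<zeta>\<close> at points.\<close>

definition twist :: "('n \<Rightarrow> 'r) \<Rightarrow> 'r" where "twist A = m (pinv A) * z A"

lemma twist_mult: "P X \<Longrightarrow> P Y \<Longrightarrow> twist (X \<odot> Y) = twist X * twist Y"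
  by (simp add: twist_def pinv_pmul m_mult z_mult ac_simps)

lemma twist_inverse: "P A \<Longrightarrow> twist A * twist (pinv A) = 1"
  using twist_mult[of A "pinv A"] pmul_pone_cancel
  by (simp add: pmul_cancel) (simp add: twist_def ext1_pone klin_\<zeta> \<zeta>_one \<mu>_one \<iota>_one)

lemma twist_hc: "P A \<Longrightarrow> P X \<Longrightarrow> twist (hc A X) = twist A"
  using twist_inverse[of X] by (simp add: hc_pt twist_mult) (metis mult.assoc mult.commute mult_1)

lemma nu_points: "P A \<Longrightarrow> ext1 nu_form A = twist A * gc.bt' A"
  by (simp add: nu_form_points twist_def)

lemma nu_central: "D_mul H \<omega> \<nu> d = D_mul H \<omega> d \<nu>"
proof -
  have *: "E (($) \<nu>) (\<lambda>p. mulc p q s) = E (($) \<nu>) (\<lambda>p. mulc q p s)" for q s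
  proof -
    obtain a e where q: "q = (a, e)" by fastforce
    obtain i l where s: "s = (i, l)" by fastforce
    have K: "E A (\<lambda>i. E X (\<lambda>e. \<iota> (E (($) \<nu>) (\<lambda>p. mulc p (a, e) (i, l))))) =
        E A (\<lambda>i. E X (\<lambda>e. \<iota> (E (($) \<nu>) (\<lambda>p. mulc (a, e) p (i, l)))))" (is "?l = ?r") if P: "P A" "P X" for A X
    proof -
      have "?l = E A (\<lambda>i. sc_mul mulr (lift \<nu>) (elem a X) (i, l))"
        unfolding sc_mul_apply E_elem by (subst (2) E_swap) (simp add: \<iota>_E mulr_def lift_def)
      also have "\<dots> = twist A * gc.bt' A * A a * gc.th A (pinv A) X * (pinv A \<odot> X) l"
        using value_at_mul[OF value_at_inv_elem value_at_elem, of nu_form A X a] P by (simp add: value_at_def hc_self nu_points)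
      also have "\<dots> = twist A * A a * (gc.bt' A * gc.th A (pinv A) X) * (pinv A \<odot> X) l"
        by (simp only: ac_simps)
      also have "\<dots> = A a * (twist (hc A X) * gc.bt' (hc A X)) * gc.th A X (pinv (hc A X)) * (X \<odot> pinv (hc A X)) l"
        using P gc.th_central[of A X] by (simp add: twist_hc hc_conj[symmetric] ac_simps) (simp add: hc_pt pinv_pmul pinv_pinv pmul_assoc)
      also have "\<dots> = E A (\<lambda>i. sc_mul mulr (elem a X) (lift \<nu>) (i, l))"
        using value_at_mul[OF value_at_elem value_at_inv_elem, of nu_form A X a] P by (simp add: value_at_def nu_points)
      also have "\<dots> = ?r"
        unfolding sc_mul_apply E_elem by (simp add: \<iota>_E mulr_def lift_def)
      finally show ?thesis .
    qed
    show ?thesis unfolding q s by (rule transfer2[OF K])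
  qed
  have "D_mul H \<omega> \<nu> d $ s = D_mul H \<omega> d \<nu> $ s" for s
    unfolding D_mul_nth sc_mul_apply by (subst E_swap) (simp only: *)
  then show ?thesis by (simp add: vec_eq_iff)
qed

text \<open>
  \<open>R\<^sub>2\<^sub>1 R\<close> has the value \<open>b \<otimes> b\<inverse>ab\<close> at \<open>(a, b)\<close>.  It is used at the conjugates of \<open>a\<close> and \<open>b\<close> by \<open>(ab)\<inverse>\<close>, where it
  is \<open>aba\<inverse> \<otimes> a\<close>.
\<close>

lemma nu_comul_M: "qmul2 D (D_comul H \<omega> \<nu>) M = vtens2 \<nu> \<nu>"
proof (rule D2_eqI)
  fix A B assume P: "P A" "P B"
  let ?C = "pinv (A \<odot> B)"
  let ?A = "hc A ?C" and ?B = "hc B ?C"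
  have B: "?B = A \<odot> B \<odot> pinv A" "?C \<odot> ?B = pinv A" and A: "hc ?A ?B = A" "?C \<odot> A = pinv B"
    using P by (simp_all add: hc_pt pinv_pmul pinv_pinv pmul_assoc pinv_right pinv_left pmul_one)
  have 1: "value_at2 (lift (D_comul H \<omega> \<nu>)) A B (twist (A \<odot> B) * gc.bt' (A \<odot> B) * gc.gm A B ?C) ?C ?C"
    using value_at2_D_comul[OF value_at_inv_elem, of nu_form A B] P by (simp add: nu_points)
  have 2: "value_at2 (lift M) ?A ?B 1 ?B A"
    using value_at2_M[of ?A ?B] P A by simp
  have "twist (A \<odot> B) * gc.bt' (A \<odot> B) * gc.gm A B ?C * (gc.th A ?C ?B * gc.th B ?C A) =
        twist A * gc.bt' A * (twist B * gc.bt' B)"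
    using gc.th_gm_coproduct[of A B] P unfolding B(1) by (simp add: twist_mult ac_simps del: gc.inv_mul)
  then have "value_at2 (lift (qmul2 D (D_comul H \<omega> \<nu>) M)) A B (twist A * gc.bt' A * (twist B * gc.bt' B)) (pinv A) (pinv B)"
    using value_at2_qmul2[OF 1 2] P B(2) A(2) by simp
  moreover have "value_at2 (lift (vtens2 \<nu> \<nu>)) A B (twist A * gc.bt' A * (twist B * gc.bt' B)) (pinv A) (pinv B)"
    using value_at2_vtens2[OF value_at_inv_elem value_at_inv_elem, of nu_form A nu_form B] P by (simp add: nu_points)
  ultimately show "\<exists>f X Y. value_at2 (lift (qmul2 D (D_comul H \<omega> \<nu>) M)) A B f X Y \<and> value_at2 (lift (vtens2 \<nu> \<nu>)) A B f X Y"
    by blast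
qed

lemma nu_comul: "qcomul D \<nu> = qmul2 D (vtens2 \<nu> \<nu>) (qinv2 D (qmul2 D (qR21 D) (qR D)))"
  unfolding nu_comul_M[symmetric] qR21_eq D_omega_simps qmul2_assoc[of "D_comul H \<omega> \<nu>" M] M_inverse qmul2_one ..

lemma value_at_anti_nu:
  assumes A: "P A"
  shows "value_at (lift (D_anti H \<omega> \<nu>)) A (z (pinv A) * gc.bt' A) (pinv A)"
proof -
  have "m (pinv A) * ext1 nu_form (pinv A) * (gc.bt' A * gc.bt' A) =
      z (pinv A) * gc.bt' A * (m A * m (pinv A)) * (gc.bt A * gc.bt' A)"
    using A by (simp add: nu_form_points bt'_pinv pinv_pinv ac_simps)
  then show ?thesis
    using value_at_anti_inv_elem[OF klin_nu_form A] A by (simp add: m_inverse gc.bt_inverse)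
qed

lemma z_square_points: "P A \<Longrightarrow> ext1 (dmul H \<zeta> \<zeta>) A = z A * z A"
  by (simp add: ext1_dmul)

text \<open>
  Centrality and the comultiplication formula impose nothing on \<open>\<zeta>\<close>.  After cancelling \<open>\<beta>\<inverse>\<close>, the condition
  \<open>s(\<nu>) = \<nu>\<close> reads \<open>\<zeta>(g\<inverse>) = \<mu>(g\<inverse>) \<zeta>(g)\<close> at the generic point \<open>g\<close>, and \<open>\<nu>\<^sup>2 = u s(u)\<close> is
  \<open>(\<mu>\<inverse>\<zeta>)\<^sup>2 = \<mu>\<inverse>\<close> there.
\<close>

lemma ribbon_iff: "ribbon_element D \<nu> \<longleftrightarrow> dmul H \<zeta> \<zeta> = \<mu>"
proof
  assume "ribbon_element D \<nu>"
  then have s: "D_anti H \<omega> \<nu> = \<nu>" by (simp add: ribbon_element_def)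
  show "dmul H \<zeta> \<zeta> = \<mu>"
  proof
    fix x
    show "dmul H \<zeta> \<zeta> x = \<mu> x"
    proof (rule klin_transfer)
      fix A assume A: "P A"
      have "z (pinv A) * gc.bt' A = m (pinv A) * z A * gc.bt' A"
        by (rule value_at_unique[OF _ value_at_inv_elem[OF klin_nu_form A, unfolded nu_form_points[OF A]]])
          (use value_at_anti_nu[OF A] A s in simp_all)
      then have "m A * z A * (z (pinv A) * gc.bt' A) * gc.bt A = m A * z A * (m (pinv A) * z A * gc.bt' A) * gc.bt A" by simp
      then have "m A * (z A * z (pinv A)) * (gc.bt A * gc.bt' A) = (m A * m (pinv A)) * (z A * z A) * (gc.bt A * gc.bt' A)"
        by (simp only: ac_simps)
      then have "m A = z A * z A" using A by (simp add: z_inverse m_inverse gc.bt_inverse)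
      then show "E A (\<lambda>i. \<iota> (dmul H \<zeta> \<zeta> (b i))) = E A (\<lambda>i. \<iota> (\<mu> (b i)))"
        using z_square_points[OF A] by (simp add: ext1_def)
    qed simp_all
  qed
next
  assume "dmul H \<zeta> \<zeta> = \<mu>"
  then have zz: "m A = z A * z A" if "P A" for A
    using z_square_points[OF that] by simp
  have nu_anti: "D_anti H \<omega> \<nu> = \<nu>"
  proof (rule D_eqI)
    fix A assume A: "P A"
    have "m (pinv A) * z A * gc.bt' A = z (pinv A) * (z A * z (pinv A)) * gc.bt' A"
      using A by (simp add: zz ac_simps)
    then have "m (pinv A) * z A * gc.bt' A = z (pinv A) * gc.bt' A" using A by (simp add: z_inverse)
    then show "\<exists>f X. value_at (lift (D_anti H \<omega> \<nu>)) A f X \<and> value_at (lift \<nu>) A f X"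
      using value_at_anti_nu[OF A] value_at_inv_elem[OF klin_nu_form A] nu_form_points[OF A] by auto
  qed
  have nu_square: "D_mul H \<omega> \<nu> \<nu> = D_mul H \<omega> (inv_elem u_form) (D_anti H \<omega> (inv_elem u_form))"
  proof (rule D_eqI)
    fix A assume A: "P A"
    have "m (pinv A) * ext1 u_form (pinv A) * (gc.bt' A * gc.bt' A) = (m A * m (pinv A)) * (gc.bt A * gc.bt' A) * (gc.bt A * gc.bt' A)"
      using A by (simp add: u_form_points bt'_pinv pinv_pinv ac_simps)
    then have "value_at (lift (D_anti H \<omega> (inv_elem u_form))) A 1 (pinv A)"
      using value_at_anti_inv_elem[OF klin_u_form A] A by (simp add: m_inverse gc.bt_inverse)
    then have 1: "value_at (lift (D_mul H \<omega> (inv_elem u_form) (D_anti H \<omega> (inv_elem u_form)))) A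
        (m (pinv A) * (gc.bt' A * gc.bt' A) * gc.th A (pinv A) (pinv A)) (pinv A \<odot> pinv A)"
      using value_at_D_mul[OF value_at_inv_elem, of u_form A "D_anti H \<omega> (inv_elem u_form)" 1 "pinv A"] A
      by (simp add: hc_self u_form_points)
    have "(m (pinv A) * z A * gc.bt' A) * (m (pinv A) * z A * gc.bt' A) =
        (m (pinv A) * (z A * z A)) * (m (pinv A) * (gc.bt' A * gc.bt' A))" by (simp only: ac_simps)
    also have "\<dots> = m (pinv A) * (gc.bt' A * gc.bt' A)"
      using m_inverse[OF A] zz[OF A] by (simp add: mult.commute)
    finally have "value_at (lift (D_mul H \<omega> \<nu> \<nu>)) A
        (m (pinv A) * (gc.bt' A * gc.bt' A) * gc.th A (pinv A) (pinv A)) (pinv A \<odot> pinv A)"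
      using value_at_inv_elem_mul[of nu_form nu_form A] A by (simp add: nu_form_points)
    with 1 show "\<exists>f X. value_at (lift (D_mul H \<omega> \<nu> \<nu>)) A f X \<and> value_at (lift (D_mul H \<omega> (inv_elem u_form) (D_anti H \<omega> (inv_elem u_form)))) A f X"
      by blast
  qed
  show "ribbon_element D \<nu>"
    unfolding ribbon_element_def
  proof (intro conjI allI)
    show "qmul D \<nu> a = qmul D a \<nu>" for a
      unfolding D_omega_simps by (rule nu_central)
    show "qcomul D \<nu> = qmul2 D (vtens2 \<nu> \<nu>) (qinv2 D (qmul2 D (qR21 D) (qR D)))"
      by (rule nu_comul)
    show "qanti D \<nu> = \<nu>"
      unfolding D_omega_simps by (rule nu_anti)
    show "qmul D \<nu> \<nu> = qmul D (drinfeld_u D) (qanti D (drinfeld_u D))"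
      unfolding D_omega_simps drinfeld_u_eq by (rule nu_square)
  qed
qed

end

end

theorem theorem5p3:
  fixes H :: "('k::field, 'h::ring_1, 'n::finite) hopf"
    and \<omega> :: "'h \<Rightarrow> 'h \<Rightarrow> 'h \<Rightarrow> 'k"
    and \<zeta> \<mu> :: "'h \<Rightarrow> 'k"
  assumes "fd_hopf_algebra H"
    and "cocommutative H"
    and "normalized_3cocycle H \<omega>"
    and "algebra_map H \<zeta>"
    and "modular_element H \<mu>"
  shows "ribbon_element (D_omega H \<omega>)
           (qmul (D_omega H \<omega>) (drinfeld_u (D_omega H \<omega>)) (hash H (dmul H \<zeta> (beta H \<omega>)) 1))
         \<longleftrightarrow> dmul H \<zeta> \<zeta> = \<mu>"
proof -
  obtain t where t: "t \<noteq> 0" "left_integral H t" "\<And>h. t * h = scl H (\<mu> h) t"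
    using assms(5) by (auto simp: modular_element_def)
  interpret cocommutative_hopf H using assms(1,2) by unfold_locales
  interpret generic_points H "emb4 :: 'k \<Rightarrow> ('k, 'n) conv4" by (rule generic_points_emb4)
  interpret ribbon_points H "emb4 :: 'k \<Rightarrow> ('k, 'n) conv4" \<omega> t \<mu>
    using assms(3) t by unfold_locales (auto simp: left_integral_def)
  show ?thesis
    unfolding D_omega_simps nu_eq[OF assms(4)] by (rule ribbon_iff[OF assms(4)])
qed

end
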